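(* Let $0<q<1$ and $n\ge1$, and let $G_{2n}=p(e^{2n}_{2n})\in M_{2^n}(\mathrm{Pol}(\Sigma_q^{2n}))$. The Chern–Connes pairings of $[G_{2n}]$ with the Fredholm modules $[\epsilon]$ and $[\mathrm{tr}_{\sigma_n}]$ are $$\langle[\epsilon],[G_{2n}]\rangle=2^{n-1},\qquad \langle[\mathrm{tr}_{\sigma_n}],[G_{2n}]\rangle=-1 .$$
   Context: $\mathrm{Pol}(\mathbb{R}^{2n+1}_q)$ is the unital complex $*$-algebra generated by $x_i,x_i^*$ ($1\le i\le n$) and $y=y^*$ with relations $$x_iy=q^2yx_i,\qquad x_ix_j=q^{-1}x_jx_i\ (i<j),\qquad x_ix_j^*=q^3x_j^*x_i\ (i<j),$$ $$x_ix_i^*=q^2x_i^*x_i+q^2(1-q^2)\sum_{\ell<i}x_\ell^*x_\ell+(1-q^2)y^2 .$$ $\mathrm{Pol}(\Sigma^{2n}_q)=\mathrm{Pol}(\mathbb{R}^{2n+1}_q)/I_n$, where $I_n$ is the ideal generated by $q^2\sum_{i=1}^nx_i^*x_i-y+y^2$; $p$ is the quotient map (applied entrywise to matrices), $a_i=p(x_i)$, $t=p(y)$. $\phi_n$ is the $*$-automorphism of $\mathrm{Pol}(\mathbb{R}^{2n+1}_q)$ with $\phi_n(x_i)=q^2x_i$, $\phi_n(y)=q^2y$, applied entrywise to matrices. The matrices $e^{2n}_{2k}\in M_{2^k}(\mathrm{Pol}(\mathbb{R}^{2n+1}_q))$ and the diagonal matrices $C^{2n}_{2k}\in M_{2^k}(\mathbb{C})$,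 $0\le k\le n$, are defined recursively by $e^{2n}_0=1-y$, $C^{2n}_0=q$, $$e^{2n}_{2(k+1)}=\begin{pmatrix}e^{2n}_{2k}&C^{2n}_{2k}x^*_{k+1}\\ C^{2n}_{2k}x_{k+1}&1-\phi_n(e^{2n}_{2k})\end{pmatrix},\qquad C^{2n}_{2(k+1)}=\begin{pmatrix}C^{2n}_{2k}&0\\0&qC^{2n}_{2k}\end{pmatrix}.$$ The matrix $G_{2n}$ is an idempotent. $\epsilon:\mathrm{Pol}(\Sigma_q^{2n})\to\mathbb{C}$ is the character with $\epsilon(a_i)=\epsilon(t)=0$, $\epsilon(1)=1$. The representation $\sigma_n$ of $\mathrm{Pol}(\Sigma_q^{2n})$ on $\ell^2(\mathbb{N})^{\otimes n}$ is defined as follows: on $\ell^2(\mathbb{N})$ with orthonormal basis $|m\rangle$, $m=0,1,2,\dots$, let $\sigma(\alpha)|m\rangle=q^{m-1}(1-q^{2m})^{1/2}|m-1\rangle$, $\sigma(\tau)|m\rangle=q^{2m}|m\rangle$; let $\alpha_i,\tau_i$ be the operators on $\ell^2(\mathbb{N})^{\otimes n}$ acting as $\sigma(\alpha),\sigma(\tau)$ on the $i$-th factor and as the identity on the others; let $M_{ii}=0$ and $M_{ij}=1$, $M_{ji}=1/2$ for $i<j$. Then $\sigma_n(a_i)=\alpha_i\prod_k\tau_k^{M_{ik}}$, $\sigma_n(t)=\prod_i\tau_i$, with $\tau_k^{1/2}$ the positive square root. $[\epsilon]$ has character $\epsilon$. $[\mathrm{tr}_{\sigma_n}]$ is the class of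 the 1-summable Fredholm module $(H,\pi,F)$ with $H=\ell^2(\mathbb{N})^{\otimes n}\oplus\ell^2(\mathbb{N})^{\otimes n}$, $\pi=\begin{pmatrix}\sigma_n&0\\0&\epsilon\end{pmatrix}$ (where $\epsilon$ acts by scalars), $F=\begin{pmatrix}0&1\\1&0\end{pmatrix}$; its character is the cyclic $0$-cocycle $\mathrm{tr}_{\sigma_n}(a)=\mathrm{tr}(\sigma_n(a)-\epsilon(a)1)$, $a\in\mathrm{Pol}(\Sigma_q^{2n})$. For an idempotent $G\in M_N(\mathrm{Pol}(\Sigma_q^{2n}))$ with matrix trace $\mathrm{Tr}(G)=\sum_jG_{jj}$, the pairings are $\langle[\epsilon],[G]\rangle=\epsilon(\mathrm{Tr}(G))$ and $\langle[\mathrm{tr}_{\sigma_n}],[G]\rangle=\mathrm{tr}_{\sigma_n}(\mathrm{Tr}(G))$. *)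

theory Defs
  imports
    "HOL-Algebra.QuotRing"
    "HOL-Analysis.Infinite_Sum"
    "HOL-Library.FuncSet"
    "HOL-Library.Nonpos_Ints"
    "HOL-Library.Poly_Mapping"
    "Jordan_Normal_Form.Matrix"
begin

section \<open>Complex \<open>*\<close>-algebras and their quotients\<close>

record 'a star_alg = "'a ring" +
  scale :: "complex \<Rightarrow> 'a \<Rightarrow> 'a"
  star :: "'a \<Rightarrow> 'a"

definition alg_prod :: "('a, 'b) ring_scheme \<Rightarrow> 'a list \<Rightarrow> 'a" where
  "alg_prod A xs = foldr (\<lambda>a b. a \<otimes>\<^bsub>A\<^esub> b) xs \<one>\<^bsub>A\<^esub>"

definition complex_alg :: "complex star_alg" where
  "complex_alg = \<lparr>carrier = UNIV, monoid.mult = (*), one = 1, zero = 0, add = (+),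
     scale = (*), star = cnj\<rparr>"

definition quot_alg :: "'a star_alg \<Rightarrow> 'a set \<Rightarrow> 'a set star_alg" where
  "quot_alg A I = \<lparr>carrier = carrier (A Quot I), monoid.mult = monoid.mult (A Quot I),
     one = one (A Quot I), zero = zero (A Quot I), add = add (A Quot I),
     scale = (\<lambda>c U. \<Union>a\<in>U. I +>\<^bsub>A\<^esub> scale A c a),
     star = (\<lambda>U. \<Union>a\<in>U. I +>\<^bsub>A\<^esub> star A a)\<rparr>"

text \<open>The map on a quotient induced by a map that is constant on every coset.\<close>

definition descend :: "('a \<Rightarrow> 'b) \<Rightarrow> 'a set \<Rightarrow> 'b" where
  "descend h U = the_elem (h ` U)"

section \<open>The free \<open>*\<close>-algebra on \<open>x\<^sub>1, \<dots>, x\<^sub>n\<close> and \<open>y = y\<^sup>*\<close>\<close>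

datatype letter = LX nat | LXs nat | LY

fun star_letter :: "letter \<Rightarrow> letter" where
  "star_letter (LX i) = LXs i"
| "star_letter (LXs i) = LX i"
| "star_letter LY = LY"

text \<open>Words are written additively so that \<open>word \<Rightarrow>\<^sub>0 complex\<close>, with the convolution
  product, is the (noncommutative) free algebra on the letters.\<close>

datatype word = Word (letters: "letter list")

instantiation word :: monoid_add
begin
definition zero_word :: word where "zero_word = Word []"
definition plus_word :: "word \<Rightarrow> word \<Rightarrow> word" where
  "plus_word v w = Word (letters v @ letters w)"
instance
  by standard (simp_all add: zero_word_def plus_word_def)
end

type_synonym free = "word \<Rightarrow>\<^sub>0 complex"

definition gen :: "letter \<Rightarrow> free" where
  "gen l = Poly_Mapping.single (Word [l]) 1"

definition free_scale :: "complex \<Rightarrow> free \<Rightarrow> free" where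
  "free_scale c f = Poly_Mapping.single 0 c * f"

definition free_star :: "free \<Rightarrow> free" where
  "free_star f = (\<Sum>w\<in>Poly_Mapping.keys f.
     Poly_Mapping.single (Word (rev (map star_letter (letters w)))) (cnj (Poly_Mapping.lookup f w)))"

definition letters_upto :: "nat \<Rightarrow> letter set" where
  "letters_upto n = LX ` {1..n} \<union> LXs ` {1..n} \<union> {LY}"

definition free_alg :: "nat \<Rightarrow> free star_alg" where
  "free_alg n = \<lparr>carrier = {f. \<forall>w\<in>Poly_Mapping.keys f. set (letters w) \<subseteq> letters_upto n},
     monoid.mult = (*), one = 1, zero = 0, add = (+), scale = free_scale, star = free_star\<rparr>"

text \<open>The \<open>*\<close>-homomorphism from the free \<open>*\<close>-algebra to \<open>A\<close> with \<open>x\<^sub>i \<mapsto> a i\<close>,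
  \<open>x\<^sub>i\<^sup>* \<mapsto> (a i)\<^sup>*\<close> and \<open>y \<mapsto> b\<close>.\<close>

fun letter_value :: "'a star_alg \<Rightarrow> (nat \<Rightarrow> 'a) \<Rightarrow> 'a \<Rightarrow> letter \<Rightarrow> 'a" where
  "letter_value A a b (LX i) = a i"
| "letter_value A a b (LXs i) = star A (a i)"
| "letter_value A a b LY = b"

definition free_hom :: "'a star_alg \<Rightarrow> (nat \<Rightarrow> 'a) \<Rightarrow> 'a \<Rightarrow> free \<Rightarrow> 'a" where
  "free_hom A a b f = (\<Oplus>\<^bsub>A\<^esub>w\<in>Poly_Mapping.keys f.
     scale A (Poly_Mapping.lookup f w) (alg_prod A (map (letter_value A a b) (letters w))))"

section \<open>The quantum Euclidean space and the quantum sphere\<close>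

definition euclid_rels :: "real \<Rightarrow> nat \<Rightarrow> free set" where
  "euclid_rels q n =
     (let x = (\<lambda>i. gen (LX i)); xs = (\<lambda>i. gen (LXs i)); y = gen LY;
          sc = (\<lambda>r::real. free_scale (complex_of_real r))
      in {x i * y - sc (q^2) (y * x i) | i. i \<in> {1..n}}
       \<union> {x i * x j - sc (1 / q) (x j * x i) | i j. i \<in> {1..n} \<and> j \<in> {1..n} \<and> i < j}
       \<union> {x i * xs j - sc (q^3) (xs j * x i) | i j. i \<in> {1..n} \<and> j \<in> {1..n} \<and> i < j}
       \<union> {x i * xs i - (sc (q^2) (xs i * x i)
             + sc (q^2 * (1 - q^2)) (\<Sum>l\<in>{1..<i}. xs l * x l)
             + sc (1 - q^2) (y * y)) | i. i \<in> {1..n}})"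

text \<open>A presentation of a \<open>*\<close>-algebra imposes each relation together with its adjoint.\<close>

definition euclid_ideal :: "real \<Rightarrow> nat \<Rightarrow> free set" where
  "euclid_ideal q n = Idl\<^bsub>free_alg n\<^esub> (euclid_rels q n \<union> free_star ` euclid_rels q n)"

definition Pol_R :: "real \<Rightarrow> nat \<Rightarrow> free set star_alg" where
  "Pol_R q n = quot_alg (free_alg n) (euclid_ideal q n)"

definition x_R :: "real \<Rightarrow> nat \<Rightarrow> nat \<Rightarrow> free set" where
  "x_R q n i = euclid_ideal q n +>\<^bsub>free_alg n\<^esub> gen (LX i)"

definition y_R :: "real \<Rightarrow> nat \<Rightarrow> free set" where
  "y_R q n = euclid_ideal q n +>\<^bsub>free_alg n\<^esub> gen LY"

definition sphere_ideal :: "real \<Rightarrow> nat \<Rightarrow> free set set" where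
  "sphere_ideal q n = (let A = Pol_R q n in
     Idl\<^bsub>A\<^esub> {scale A (complex_of_real (q^2)) (\<Oplus>\<^bsub>A\<^esub>i\<in>{1..n}. star A (x_R q n i) \<otimes>\<^bsub>A\<^esub> x_R q n i)
             \<ominus>\<^bsub>A\<^esub> y_R q n \<oplus>\<^bsub>A\<^esub> y_R q n \<otimes>\<^bsub>A\<^esub> y_R q n})"

definition Pol_S :: "real \<Rightarrow> nat \<Rightarrow> free set set star_alg" where
  "Pol_S q n = quot_alg (Pol_R q n) (sphere_ideal q n)"

definition proj_S :: "real \<Rightarrow> nat \<Rightarrow> free set \<Rightarrow> free set set" where
  "proj_S q n u = sphere_ideal q n +>\<^bsub>Pol_R q n\<^esub> u"

text \<open>The \<open>*\<close>-homomorphism on \<open>Pol(\<Sigma>\<^sub>q\<^sup>2\<^sup>n)\<close> determined by the images of \<open>a\<^sub>i\<close> and \<open>t\<close>.\<close>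

definition sphere_hom :: "'a star_alg \<Rightarrow> (nat \<Rightarrow> 'a) \<Rightarrow> 'a \<Rightarrow> free set set \<Rightarrow> 'a" where
  "sphere_hom A a b = descend (descend (free_hom A a b))"

section \<open>The idempotents\<close>

definition phi :: "real \<Rightarrow> nat \<Rightarrow> free set \<Rightarrow> free set" where
  "phi q n = (let A = Pol_R q n in
     descend (free_hom A (\<lambda>i. scale A (complex_of_real (q^2)) (x_R q n i))
                         (scale A (complex_of_real (q^2)) (y_R q n))))"

primrec C_mat :: "real \<Rightarrow> nat \<Rightarrow> complex mat" where
  "C_mat q 0 = mat 1 1 (\<lambda>_. complex_of_real q)"
| "C_mat q (Suc k) =
     four_block_mat (C_mat q k) (0\<^sub>m (2^k) (2^k))
                    (0\<^sub>m (2^k) (2^k)) (complex_of_real q \<cdot>\<^sub>m C_mat q k)"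

text \<open>The matrix \<open>C \<cdot> u\<close> for a scalar matrix \<open>C\<close> and an algebra element \<open>u\<close>.\<close>

definition mat_times_elt :: "'a star_alg \<Rightarrow> complex mat \<Rightarrow> 'a \<Rightarrow> 'a mat" where
  "mat_times_elt A C u = map_mat (\<lambda>c. scale A c u) C"

definition one_minus_mat :: "'a star_alg \<Rightarrow> 'a mat \<Rightarrow> 'a mat" where
  "one_minus_mat A E = mat (dim_row E) (dim_col E)
     (\<lambda>(i, j). (if i = j then \<one>\<^bsub>A\<^esub> else \<zero>\<^bsub>A\<^esub>) \<ominus>\<^bsub>A\<^esub> E $$ (i, j))"

primrec e_mat :: "real \<Rightarrow> nat \<Rightarrow> nat \<Rightarrow> free set mat" where
  "e_mat q n 0 = mat 1 1 (\<lambda>_. \<one>\<^bsub>Pol_R q n\<^esub> \<ominus>\<^bsub>Pol_R q n\<^esub> y_R q n)"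
| "e_mat q n (Suc k) =
     four_block_mat
       (e_mat q n k)
       (mat_times_elt (Pol_R q n) (C_mat q k) (star (Pol_R q n) (x_R q n (Suc k))))
       (mat_times_elt (Pol_R q n) (C_mat q k) (x_R q n (Suc k)))
       (one_minus_mat (Pol_R q n) (map_mat (phi q n) (e_mat q n k)))"

definition G_mat :: "real \<Rightarrow> nat \<Rightarrow> free set set mat" where
  "G_mat q n = map_mat (proj_S q n) (e_mat q n n)"

section \<open>Operators on \<open>\<ell>\<^sup>2(I)\<close>\<close>

type_synonym 'i oper = "('i \<Rightarrow> complex) \<Rightarrow> ('i \<Rightarrow> complex)"

definition ell2 :: "'i set \<Rightarrow> ('i \<Rightarrow> complex) set" where
  "ell2 I = {\<psi>. (\<forall>i. i \<notin> I \<longrightarrow> \<psi> i = 0) \<and> (\<lambda>i. (cmod (\<psi> i))\<^sup>2) summable_on I}"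

definition ip :: "'i set \<Rightarrow> ('i \<Rightarrow> complex) \<Rightarrow> ('i \<Rightarrow> complex) \<Rightarrow> complex" where
  "ip I \<psi> \<chi> = (\<Sum>\<^sub>\<infinity>i\<in>I. cnj (\<psi> i) * \<chi> i)"

definition ell2_norm :: "'i set \<Rightarrow> ('i \<Rightarrow> complex) \<Rightarrow> real" where
  "ell2_norm I \<psi> = sqrt (\<Sum>\<^sub>\<infinity>i\<in>I. (cmod (\<psi> i))\<^sup>2)"

definition ket :: "'i \<Rightarrow> 'i \<Rightarrow> complex" where
  "ket m = (\<lambda>k. if k = m then 1 else 0)"

text \<open>Operators are extensional, i.e. \<open>undefined\<close> outside \<open>ell2 I\<close>, so that equality of
  functions is equality of operators.\<close>

definition bounded_ops :: "'i set \<Rightarrow> 'i oper set" where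
  "bounded_ops I = {T \<in> ell2 I \<rightarrow>\<^sub>E ell2 I.
     (\<forall>\<psi>\<in>ell2 I. \<forall>\<chi>\<in>ell2 I. T (\<lambda>i. \<psi> i + \<chi> i) = (\<lambda>i. T \<psi> i + T \<chi> i)) \<and>
     (\<forall>c. \<forall>\<psi>\<in>ell2 I. T (\<lambda>i. c * \<psi> i) = (\<lambda>i. c * T \<psi> i)) \<and>
     (\<exists>B. \<forall>\<psi>\<in>ell2 I. ell2_norm I (T \<psi>) \<le> B * ell2_norm I \<psi>)}"

definition adjoint_op :: "'i set \<Rightarrow> 'i oper \<Rightarrow> 'i oper" where
  "adjoint_op I T = (THE S. S \<in> bounded_ops I \<and>
     (\<forall>\<psi>\<in>ell2 I. \<forall>\<chi>\<in>ell2 I. ip I (S \<psi>) \<chi> = ip I \<psi> (T \<chi>)))"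

definition op_alg :: "'i set \<Rightarrow> 'i oper star_alg" where
  "op_alg I = \<lparr>carrier = bounded_ops I, monoid.mult = compose (ell2 I),
     one = restrict (\<lambda>\<psi>. \<psi>) (ell2 I), zero = restrict (\<lambda>\<psi> i. 0) (ell2 I),
     add = (\<lambda>S T. restrict (\<lambda>\<psi> i. S \<psi> i + T \<psi> i) (ell2 I)),
     scale = (\<lambda>c T. restrict (\<lambda>\<psi> i. c * T \<psi> i) (ell2 I)),
     star = adjoint_op I\<rparr>"

text \<open>The bounded operator with prescribed values \<open>T |m\<rangle> = v m\<close> on the orthonormal basis.\<close>

definition op_on_basis :: "'i set \<Rightarrow> ('i \<Rightarrow> 'i \<Rightarrow> complex) \<Rightarrow> 'i oper" where
  "op_on_basis I v = (THE T. T \<in> bounded_ops I \<and> (\<forall>m\<in>I. T (ket m) = v m))"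

definition positive_op :: "'i set \<Rightarrow> 'i oper \<Rightarrow> bool" where
  "positive_op I T \<longleftrightarrow> T \<in> bounded_ops I \<and> (\<forall>\<psi>\<in>ell2 I. ip I \<psi> (T \<psi>) \<in> \<real>\<^sub>\<ge>\<^sub>0)"

definition pos_sqrt_op :: "'i set \<Rightarrow> 'i oper \<Rightarrow> 'i oper" where
  "pos_sqrt_op I T = (THE S. positive_op I S \<and> compose (ell2 I) S S = T)"

definition abs_op :: "'i set \<Rightarrow> 'i oper \<Rightarrow> 'i oper" where
  "abs_op I T = pos_sqrt_op I (compose (ell2 I) (adjoint_op I T) T)"

definition trace_class :: "'i set \<Rightarrow> 'i oper \<Rightarrow> bool" where
  "trace_class I T \<longleftrightarrow> T \<in> bounded_ops I \<and> (\<lambda>m. ip I (ket m) (abs_op I T (ket m))) summable_on I"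

definition op_trace :: "'i set \<Rightarrow> 'i oper \<Rightarrow> complex" where
  "op_trace I T = (if trace_class I T then \<Sum>\<^sub>\<infinity>m\<in>I. ip I (ket m) (T (ket m)) else 0)"

section \<open>The representation \<open>\<sigma>\<^sub>n\<close>\<close>

definition sig_alpha :: "real \<Rightarrow> nat oper" where
  "sig_alpha q = op_on_basis UNIV
     (\<lambda>m k. complex_of_real (q powi (int m - 1) * sqrt (1 - q^(2 * m))) * ket (m - 1) k)"

definition sig_tau :: "real \<Rightarrow> nat oper" where
  "sig_tau q = op_on_basis UNIV (\<lambda>m k. complex_of_real (q^(2 * m)) * ket m k)"

text \<open>\<open>\<ell>\<^sup>2(\<nat>)\<^sup>\<otimes>\<^sup>n\<close> is realised as \<open>\<ell>\<^sup>2(\<nat>\<^sup>n)\<close>, with \<open>\<nat>\<^sup>n\<close> the (extensional) functions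
  on \<open>{1..n}\<close>; \<open>elem_tensor n v\<close> is \<open>v 1 \<otimes> \<dots> \<otimes> v n\<close>, so \<open>ket m\<close> is
  \<open>|m 1\<rangle> \<otimes> \<dots> \<otimes> |m n\<rangle>\<close>.\<close>

definition multi :: "nat \<Rightarrow> (nat \<Rightarrow> nat) set" where
  "multi n = {1..n} \<rightarrow>\<^sub>E UNIV"

definition elem_tensor :: "nat \<Rightarrow> (nat \<Rightarrow> nat \<Rightarrow> complex) \<Rightarrow> (nat \<Rightarrow> nat) \<Rightarrow> complex" where
  "elem_tensor n v = (\<lambda>m. if m \<in> multi n then \<Prod>j\<in>{1..n}. v j (m j) else 0)"

text \<open>\<open>T\<close> acting on the \<open>i\<close>-th tensor factor and the identity on the others.\<close>

definition leg_op :: "nat \<Rightarrow> nat \<Rightarrow> nat oper \<Rightarrow> (nat \<Rightarrow> nat) oper" where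
  "leg_op n i T = op_on_basis (multi n)
     (\<lambda>m. elem_tensor n ((\<lambda>j. ket (m j))(i := T (ket (m i)))))"

definition alpha_op :: "real \<Rightarrow> nat \<Rightarrow> nat \<Rightarrow> (nat \<Rightarrow> nat) oper" where
  "alpha_op q n i = leg_op n i (sig_alpha q)"

definition tau_op :: "real \<Rightarrow> nat \<Rightarrow> nat \<Rightarrow> (nat \<Rightarrow> nat) oper" where
  "tau_op q n i = leg_op n i (sig_tau q)"

text \<open>\<open>\<tau>\<^sub>k\<close> to the power \<open>M\<^sub>i\<^sub>k\<close>, where \<open>M\<^sub>i\<^sub>k\<close> is \<open>1\<close> for \<open>i < k\<close>,
  \<open>1/2\<close> for \<open>k < i\<close> and \<open>0\<close> for \<open>i = k\<close>.\<close>

definition tau_pow_M :: "real \<Rightarrow> nat \<Rightarrow> nat \<Rightarrow> nat \<Rightarrow> (nat \<Rightarrow> nat) oper" where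
  "tau_pow_M q n i k =
     (if i < k then tau_op q n k
      else if k < i then pos_sqrt_op (multi n) (tau_op q n k)
      else \<one>\<^bsub>op_alg (multi n)\<^esub>)"

definition sigma_a :: "real \<Rightarrow> nat \<Rightarrow> nat \<Rightarrow> (nat \<Rightarrow> nat) oper" where
  "sigma_a q n i = alpha_op q n i \<otimes>\<^bsub>op_alg (multi n)\<^esub>
     alg_prod (op_alg (multi n)) (map (tau_pow_M q n i) [1..<Suc n])"

definition sigma_t :: "real \<Rightarrow> nat \<Rightarrow> (nat \<Rightarrow> nat) oper" where
  "sigma_t q n = alg_prod (op_alg (multi n)) (map (tau_op q n) [1..<Suc n])"

definition sigma_rep :: "real \<Rightarrow> nat \<Rightarrow> free set set \<Rightarrow> (nat \<Rightarrow> nat) oper" where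
  "sigma_rep q n = sphere_hom (op_alg (multi n)) (sigma_a q n) (sigma_t q n)"

section \<open>Characters and Chern--Connes pairings\<close>

definition eps_char :: "free set set \<Rightarrow> complex" where
  "eps_char = sphere_hom complex_alg (\<lambda>i. 0) 0"

definition tr_sigma :: "real \<Rightarrow> nat \<Rightarrow> free set set \<Rightarrow> complex" where
  "tr_sigma q n u = (let B = op_alg (multi n) in
     op_trace (multi n) (sigma_rep q n u \<ominus>\<^bsub>B\<^esub> scale B (eps_char u) \<one>\<^bsub>B\<^esub>))"

definition mat_trace :: "'a star_alg \<Rightarrow> 'a mat \<Rightarrow> 'a" where
  "mat_trace A G = (\<Oplus>\<^bsub>A\<^esub>j\<in>{..<dim_row G}. G $$ (j, j))"

text \<open>The pairing of the class of an idempotent matrix \<open>G\<close> over \<open>A\<close> with a Fredholm module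
  whose character is the cyclic \<open>0\<close>-cocycle \<open>\<chi>\<close>.\<close>

definition chern_pairing :: "'a star_alg \<Rightarrow> ('a \<Rightarrow> complex) \<Rightarrow> 'a mat \<Rightarrow> complex" where
  "chern_pairing A \<chi> G = \<chi> (mat_trace A G)"

end

theory Submission
  imports Defs
begin

text \<open>Both pairings only see the matrix trace of \<open>G\<^bsub>2n\<^esub>\<close>, and this trace is affine in \<open>t\<close>. Passing from
  \<open>e\<^bsub>2k\<^esub>\<close> to \<open>e\<^bsub>2(k+1)\<^esub>\<close> turns the trace \<open>T\<close> into \<open>T + 2\<^sup>k - \<phi>(T)\<close>. The automorphism \<open>\<phi>\<close> fixes
  scalars and multiplies \<open>y\<close> by \<open>q\<^sup>2\<close>, so the constant term becomes \<open>2\<^sup>k\<close> and the coefficient of \<open>y\<close>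
  gains a factor \<open>1 - q\<^sup>2\<close>; starting from \<open>1 - y\<close> this gives
  \<open>Tr G\<^bsub>2n\<^esub> = 2\<^bsup>n-1\<^esup> - (1 - q\<^sup>2)\<^sup>n t\<close> (\<open>mat_trace_G_mat\<close>). The character \<open>\<epsilon>\<close> picks the
  constant term. The other pairing is \<open>-(1 - q\<^sup>2)\<^sup>n\<close> times the trace of \<open>\<sigma>\<^sub>n(t)\<close>, and \<open>\<sigma>\<^sub>n(t)\<close> is
  diagonal with entries \<open>\<Prod>\<^sub>k q\<^bsup>2m\<^sub>k\<^esup>\<close>, whose sum is a product of \<open>n\<close> geometric series,
  \<open>(1 - q\<^sup>2)\<^bsup>-n\<^esup>\<close> (\<open>infsum_t_weight\<close>).

  The bulk of the work is that \<open>\<phi>\<close>, \<open>\<epsilon>\<close> and \<open>\<sigma>\<^sub>n\<close>, which are prescribed on generators, respect the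
  relations: only then do the maps they induce on cosets have the expected values. A homomorphism
  out of the free algebra kills the ideals as soon as it kills their generators
  (\<open>free_hom_kills_euclid_ideal\<close>, \<open>sphere_hom_proj_S\<close>). For \<open>\<phi>\<close> this holds because all relations
  of the quantum Euclidean space are homogeneous of degree 2, and for \<open>\<epsilon>\<close> because no relation has a
  constant term. For \<open>\<sigma>\<^sub>n\<close> every generator acts as a weighted shift of the basis of
  \<open>\<ell>\<^sup>2(\<nat>\<^sup>n)\<close>, so each relation becomes an identity between weights. The quadratic
  relations among the \<open>a\<^sub>i\<^sup>*a\<^sub>i\<close> hold because \<open>q\<^sup>2a\<^sub>i\<^sup>*a\<^sub>i\<close> is a difference of consecutive terms of a
  sequence from \<open>t\<^sup>2\<close> to \<open>t\<close> (\<open>a_star_a_weight\<close>, \<open>sum_a_star_a_weight\<close>). The adjoint relations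
  follow from adjointness on letters (\<open>free_hom_adjoint_pair\<close>).

  Operators, adjoints and square roots are given by definite descriptions. They are identified by
  uniqueness: a bounded operator is determined by its values on the basis (\<open>op_eq_on_basis\<close>), and a
  positive square root of a diagonal operator with positive entries is diagonal
  (\<open>pos_sqrt_op_diag\<close>).\<close>

section \<open>Complex algebras and homomorphisms out of the free algebra\<close>

locale complex_algebra = ring A for A :: "'a star_alg" (structure) +
  assumes scale_closed [simp, intro]: "a \<in> carrier A \<Longrightarrow> scale A c a \<in> carrier A"
    and scale_add: "\<lbrakk>a \<in> carrier A; b \<in> carrier A\<rbrakk> \<Longrightarrow>
          scale A c (a \<oplus> b) = scale A c a \<oplus> scale A c b"
    and add_scale: "a \<in> carrier A \<Longrightarrow> scale A (c + d) a = scale A c a \<oplus> scale A d a"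
    and scale_scale: "a \<in> carrier A \<Longrightarrow> scale A c (scale A d a) = scale A (c * d) a"
    and one_scale [simp]: "a \<in> carrier A \<Longrightarrow> scale A 1 a = a"
    and scale_mult_left: "\<lbrakk>a \<in> carrier A; b \<in> carrier A\<rbrakk> \<Longrightarrow>
          scale A c a \<otimes> b = scale A c (a \<otimes> b)"
    and scale_mult_right: "\<lbrakk>a \<in> carrier A; b \<in> carrier A\<rbrakk> \<Longrightarrow>
          a \<otimes> scale A c b = scale A c (a \<otimes> b)"
begin

lemma zero_scale [simp]:
  assumes "a \<in> carrier A" shows "scale A 0 a = \<zero>"
proof -
  have "scale A 0 a \<oplus> scale A 0 a = scale A 0 a"
    using add_scale[OF assms, of 0 0] by simp
  then show ?thesis using assms by (metis add.l_cancel_one' scale_closed)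
qed

lemma scale_zero [simp]: "scale A c \<zero> = \<zero>"
  using scale_scale[OF zero_closed, of c 0] zero_scale[OF zero_closed] by simp

lemma scale_mult_scale:
  "\<lbrakk>a \<in> carrier A; b \<in> carrier A\<rbrakk> \<Longrightarrow> scale A c a \<otimes> scale A d b = scale A (c * d) (a \<otimes> b)"
  by (simp add: scale_mult_left scale_mult_right scale_scale mult.commute)

lemma alg_prod_closed [simp, intro]: "set xs \<subseteq> carrier A \<Longrightarrow> alg_prod A xs \<in> carrier A"
  by (induction xs) (auto simp: alg_prod_def)

lemma alg_prod_append:
  "\<lbrakk>set xs \<subseteq> carrier A; set ys \<subseteq> carrier A\<rbrakk> \<Longrightarrow>
     alg_prod A (xs @ ys) = alg_prod A xs \<otimes> alg_prod A ys"
proof (induction xs)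
  case Nil
  then show ?case using alg_prod_closed[of ys] by (simp add: alg_prod_def)
next
  case (Cons x xs)
  then show ?case
    using alg_prod_closed[of xs] alg_prod_closed[of ys] by (simp add: alg_prod_def m_assoc)
qed

end

lemma alg_prod_Nil [simp]: "alg_prod A [] = \<one>\<^bsub>A\<^esub>"
  and alg_prod_Cons [simp]: "alg_prod A (x # xs) = x \<otimes>\<^bsub>A\<^esub> alg_prod A xs"
  by (simp_all add: alg_prod_def)

lemma letters_zero [simp]: "letters 0 = []"
  by (simp add: zero_word_def)

lemma letters_plus [simp]: "letters (v + w) = letters v @ letters w"
  by (simp add: plus_word_def)

lemma letters_eq_Nil_iff [simp]: "letters w = [] \<longleftrightarrow> w = 0"
  by (cases w) (simp add: zero_word_def)

lemma carrier_free_alg: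
  "f \<in> carrier (free_alg n) \<longleftrightarrow>
     (\<forall>w\<in>Poly_Mapping.keys f. set (letters w) \<subseteq> letters_upto n)"
  by (simp add: free_alg_def)

lemma free_alg_simps [simp]:
  "f \<otimes>\<^bsub>free_alg n\<^esub> g = f * g" "\<one>\<^bsub>free_alg n\<^esub> = 1" "\<zero>\<^bsub>free_alg n\<^esub> = 0"
  "f \<oplus>\<^bsub>free_alg n\<^esub> g = f + g" "scale (free_alg n) = free_scale" "star (free_alg n) = free_star"
  by (simp_all add: free_alg_def)

lemma free_carrier_zero [simp, intro]: "0 \<in> carrier (free_alg n)"
  by (simp add: carrier_free_alg)

lemma free_carrier_one [simp, intro]: "1 \<in> carrier (free_alg n)"
  by (simp add: carrier_free_alg)

lemma free_carrier_uminus [simp, intro]: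
  "f \<in> carrier (free_alg n) \<Longrightarrow> - f \<in> carrier (free_alg n)"
  by (simp add: carrier_free_alg in_keys_iff)

lemma free_carrier_add [simp, intro]:
  "\<lbrakk>f \<in> carrier (free_alg n); g \<in> carrier (free_alg n)\<rbrakk> \<Longrightarrow> f + g \<in> carrier (free_alg n)"
  using keys_add[of f g] by (auto simp: carrier_free_alg)

lemma free_carrier_diff [simp, intro]:
  "\<lbrakk>f \<in> carrier (free_alg n); g \<in> carrier (free_alg n)\<rbrakk> \<Longrightarrow> f - g \<in> carrier (free_alg n)"
  using free_carrier_add[of f n "- g"] by simp

lemma free_carrier_mult [simp, intro]:
  "\<lbrakk>f \<in> carrier (free_alg n); g \<in> carrier (free_alg n)\<rbrakk> \<Longrightarrow> f * g \<in> carrier (free_alg n)"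
  using keys_mult[of f g] by (fastforce simp: carrier_free_alg)

lemma free_carrier_single [simp, intro]:
  "set (letters w) \<subseteq> letters_upto n \<Longrightarrow> Poly_Mapping.single w c \<in> carrier (free_alg n)"
  by (simp add: carrier_free_alg)

lemma free_carrier_scale [simp, intro]:
  "f \<in> carrier (free_alg n) \<Longrightarrow> free_scale c f \<in> carrier (free_alg n)"
  by (simp add: free_scale_def)

lemma free_carrier_gen [simp, intro]: "l \<in> letters_upto n \<Longrightarrow> gen l \<in> carrier (free_alg n)"
  by (simp add: gen_def)

lemma free_carrier_sum [simp, intro]:
  "(\<And>i. i \<in> S \<Longrightarrow> f i \<in> carrier (free_alg n)) \<Longrightarrow> sum f S \<in> carrier (free_alg n)"
  by (induction S rule: infinite_finite_induct) auto

lemma ring_free_alg: "ring (free_alg n)"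
proof (rule ringI)
  show "abelian_group (free_alg n)"
  proof (rule abelian_groupI)
    fix f assume f: "f \<in> carrier (free_alg n)"
    show "\<exists>g\<in>carrier (free_alg n). g \<oplus>\<^bsub>free_alg n\<^esub> f = \<zero>\<^bsub>free_alg n\<^esub>"
      by (rule bexI[where x = "- f"]) (use f in auto)
  qed (auto simp: algebra_simps)
  show "monoid (free_alg n)"
    by (rule monoidI) (auto simp: algebra_simps)
qed (auto simp: algebra_simps)

lemma a_inv_free_alg [simp]:
  "f \<in> carrier (free_alg n) \<Longrightarrow> \<ominus>\<^bsub>free_alg n\<^esub> f = - f"
proof -
  interpret ring "free_alg n" by (rule ring_free_alg)
  assume "f \<in> carrier (free_alg n)"
  then show ?thesis by (intro minus_equality) auto
qed

lemma free_scale_simps: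
  "free_scale c (Poly_Mapping.single w d) = Poly_Mapping.single w (c * d)"
  "free_scale c (f + g) = free_scale c f + free_scale c g"
  "free_scale (c + d) f = free_scale c f + free_scale d f"
  "free_scale c (free_scale d f) = free_scale (c * d) f"
  "free_scale c f * g = free_scale c (f * g)"
  "free_scale 1 f = f"
  by (simp_all add: free_scale_def mult_single algebra_simps single_add flip: mult.assoc)

lemma lookup_free_scale [simp]:
  "Poly_Mapping.lookup (free_scale c f) w = c * Poly_Mapping.lookup f w"
proof -
  have "free_scale c f = Poly_Mapping.map ((*) c) f"
    by (simp add: free_scale_def mult_map_scale_conv_mult)
  then show ?thesis by (simp add: Poly_Mapping.map.rep_eq when_def)
qed

lemma free_eq_sum_singles:
  "f = (\<Sum>w\<in>Poly_Mapping.keys f. Poly_Mapping.single w (Poly_Mapping.lookup f w))"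
proof (rule poly_mapping_eqI)
  fix v
  have "(\<Sum>w\<in>Poly_Mapping.keys f. Poly_Mapping.lookup (Poly_Mapping.single w (Poly_Mapping.lookup f w)) v)
      = (\<Sum>w\<in>Poly_Mapping.keys f. if w = v then Poly_Mapping.lookup f v else 0)"
    by (intro sum.cong) (auto simp: lookup_single when_def)
  also have "\<dots> = Poly_Mapping.lookup f v"
    by (auto simp: in_keys_iff)
  finally show "Poly_Mapping.lookup f v = Poly_Mapping.lookup
      (\<Sum>w\<in>Poly_Mapping.keys f. Poly_Mapping.single w (Poly_Mapping.lookup f w)) v"
    by (simp add: lookup_sum)
qed

text \<open>The free algebra is spanned by the words, so additive statements need only be checked there.\<close>

lemma free_induct [consumes 1, case_names zero single add]:
  assumes f: "f \<in> carrier (free_alg n)"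
    and zero: "P 0"
    and single: "\<And>w c. set (letters w) \<subseteq> letters_upto n \<Longrightarrow> P (Poly_Mapping.single w c)"
    and add: "\<And>f g. \<lbrakk>f \<in> carrier (free_alg n); g \<in> carrier (free_alg n); P f; P g\<rbrakk> \<Longrightarrow> P (f + g)"
  shows "P f"
proof -
  let ?s = "\<lambda>w. Poly_Mapping.single w (Poly_Mapping.lookup f w)"
  have "finite S \<Longrightarrow> S \<subseteq> Poly_Mapping.keys f \<Longrightarrow> sum ?s S \<in> carrier (free_alg n) \<and> P (sum ?s S)" for S
  proof (induction S rule: finite_induct)
    case (insert w S)
    then have w: "set (letters w) \<subseteq> letters_upto n"
      using f by (auto simp: carrier_free_alg)
    show ?case
      using insert w add[of "?s w" "sum ?s S"] single[OF w] by auto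
  qed (simp add: zero)
  from this[of "Poly_Mapping.keys f"] show ?thesis
    using free_eq_sum_singles[of f] by simp
qed

lemma free_scale_mult_right: "f * free_scale c g = free_scale c (f * g)"
proof -
  have comm: "f * Poly_Mapping.single 0 c = Poly_Mapping.single 0 c * f" for f :: free
  proof -
    have "(\<Sum>w\<in>S. Poly_Mapping.single w (d w)) * Poly_Mapping.single 0 c
        = Poly_Mapping.single 0 c * (\<Sum>w\<in>S. Poly_Mapping.single w (d w))"
      for S :: "word set" and d :: "word \<Rightarrow> complex"
      by (simp add: sum_distrib_left sum_distrib_right mult_single mult.commute)
    from this[of "Poly_Mapping.lookup f" "Poly_Mapping.keys f"] show ?thesis
      by (simp flip: free_eq_sum_singles)
  qed
  show ?thesis unfolding free_scale_def by (metis comm mult.assoc)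
qed

lemma complex_algebra_free_alg: "complex_algebra (free_alg n)"
proof -
  interpret ring "free_alg n" by (rule ring_free_alg)
  show ?thesis
    by standard (auto simp: free_scale_simps free_scale_mult_right)
qed

context complex_algebra
begin

definition admissible :: "nat \<Rightarrow> (nat \<Rightarrow> 'a) \<Rightarrow> 'a \<Rightarrow> bool" where
  "admissible n a b \<longleftrightarrow> letter_value A a b ` letters_upto n \<subseteq> carrier A"

lemma word_value_closed:
  "\<lbrakk>admissible n a b; set (letters w) \<subseteq> letters_upto n\<rbrakk> \<Longrightarrow>
     alg_prod A (map (letter_value A a b) (letters w)) \<in> carrier A"
  by (rule alg_prod_closed) (auto simp: admissible_def)

lemma free_hom_over_superset:
  assumes "admissible n a b" "finite S" "Poly_Mapping.keys f \<subseteq> S"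
    and "\<And>w. w \<in> S \<Longrightarrow> set (letters w) \<subseteq> letters_upto n"
  shows "free_hom A a b f = (\<Oplus>w\<in>S. scale A (Poly_Mapping.lookup f w)
           (alg_prod A (map (letter_value A a b) (letters w))))"
  unfolding free_hom_def
  by (rule add.finprod_mono_neutral_cong_left)
     (use assms word_value_closed in \<open>auto simp: in_keys_iff\<close>)

lemma free_hom_single:
  assumes "admissible n a b" "set (letters w) \<subseteq> letters_upto n"
  shows "free_hom A a b (Poly_Mapping.single w c) =
    scale A c (alg_prod A (map (letter_value A a b) (letters w)))"
proof -
  have "free_hom A a b (Poly_Mapping.single w c) = (\<Oplus>v\<in>{w}.
     scale A (Poly_Mapping.lookup (Poly_Mapping.single w c) v)
           (alg_prod A (map (letter_value A a b) (letters v))))"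
    using assms by (intro free_hom_over_superset) auto
  then show ?thesis
    using word_value_closed[OF assms] by simp
qed

lemma free_hom_closed:
  assumes "admissible n a b" "f \<in> carrier (free_alg n)"
  shows "free_hom A a b f \<in> carrier A"
  unfolding free_hom_def
  by (rule finsum_closed)
     (use assms word_value_closed[OF assms(1)] in \<open>auto simp: carrier_free_alg\<close>)

lemma free_hom_add:
  assumes ab: "admissible n a b" and f: "f \<in> carrier (free_alg n)" and g: "g \<in> carrier (free_alg n)"
  shows "free_hom A a b (f + g) = free_hom A a b f \<oplus> free_hom A a b g"
proof -
  let ?S = "Poly_Mapping.keys f \<union> Poly_Mapping.keys g"
  have valid: "set (letters w) \<subseteq> letters_upto n" if "w \<in> ?S" for w
    using that f g by (auto simp: carrier_free_alg)
  have over: "free_hom A a b h = (\<Oplus>w\<in>?S. scale A (Poly_Mapping.lookup h w)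
           (alg_prod A (map (letter_value A a b) (letters w))))"
    if "Poly_Mapping.keys h \<subseteq> ?S" for h
    using that valid by (intro free_hom_over_superset[OF ab]) auto
  have keys: "Poly_Mapping.keys f \<subseteq> ?S" "Poly_Mapping.keys g \<subseteq> ?S"
    "Poly_Mapping.keys (f + g) \<subseteq> ?S"
    using keys_add[of f g] by auto
  have P: "alg_prod A (map (letter_value A a b) (letters w)) \<in> carrier A" if "w \<in> ?S" for w
    using that word_value_closed[OF ab] valid by auto
  have "free_hom A a b (f + g) = (\<Oplus>w\<in>?S.
      scale A (Poly_Mapping.lookup f w) (alg_prod A (map (letter_value A a b) (letters w)))
    \<oplus> scale A (Poly_Mapping.lookup g w) (alg_prod A (map (letter_value A a b) (letters w))))"
    unfolding over[OF keys(3)] using P by (intro finsum_cong') (auto simp: lookup_add add_scale)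
  also have "\<dots> = free_hom A a b f \<oplus> free_hom A a b g"
    unfolding over[OF keys(1)] over[OF keys(2)] using P by (intro finsum_addf) auto
  finally show ?thesis .
qed

lemma free_hom_zero: "free_hom A a b 0 = \<zero>"
  by (simp add: free_hom_def)

lemma free_hom_scale:
  assumes ab: "admissible n a b" and f: "f \<in> carrier (free_alg n)"
  shows "free_hom A a b (free_scale c f) = scale A c (free_hom A a b f)"
  using f
proof (induction f rule: free_induct)
  case zero
  then show ?case by (simp add: free_hom_zero free_scale_def)
next
  case (single w d)
  then show ?case
    using word_value_closed[OF ab single]
    by (simp add: free_scale_simps free_hom_single[OF ab] scale_scale)
next
  case (add f g)
  then show ?case
    by (simp add: free_scale_simps free_hom_add[OF ab] scale_add free_hom_closed[OF ab])
qed

lemma free_hom_mult: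
  assumes ab: "admissible n a b" and f: "f \<in> carrier (free_alg n)" and g: "g \<in> carrier (free_alg n)"
  shows "free_hom A a b (f * g) = free_hom A a b f \<otimes> free_hom A a b g"
  using f
proof (induction f rule: free_induct)
  case zero
  show ?case using free_hom_closed[OF ab g] by (simp add: free_hom_zero)
next
  case w: (single w c)
  from g show ?case
  proof (induction g rule: free_induct)
    case zero
    then show ?case using free_hom_closed[OF ab free_carrier_single[OF w]] by (simp add: free_hom_zero)
  next
    case v: (single v d)
    have *: "set (map (letter_value A a b) (letters w)) \<subseteq> carrier A"
      "set (map (letter_value A a b) (letters v)) \<subseteq> carrier A"
      using w v ab by (auto simp: admissible_def)
    show ?case
      using w v alg_prod_append[OF *] word_value_closed[OF ab w] word_value_closed[OF ab v]
      by (simp add: mult_single free_hom_single[OF ab] scale_mult_scale)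
  next
    case (add g h)
    then show ?case
      using w by (simp add: distrib_left free_hom_add[OF ab] r_distr free_hom_closed[OF ab])
  qed
next
  case (add f h)
  then show ?case
    using g by (simp add: distrib_right free_hom_add[OF ab] l_distr free_hom_closed[OF ab])
qed

lemma free_hom_one: "admissible n a b \<Longrightarrow> free_hom A a b 1 = \<one>"
  using free_hom_single[of n a b 0 1] by simp

lemma free_hom_gen:
  "\<lbrakk>admissible n a b; l \<in> letters_upto n\<rbrakk> \<Longrightarrow> free_hom A a b (gen l) = letter_value A a b l"
  using free_hom_single[of n a b "Word [l]" 1]
  by (auto simp: gen_def admissible_def)

lemma free_hom_ring_hom:
  "admissible n a b \<Longrightarrow> free_hom A a b \<in> Ring.ring_hom (free_alg n) A"
  by (rule ring_hom_memI)
     (simp_all add: free_hom_closed free_hom_mult free_hom_add free_hom_one)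

lemma free_hom_sum:
  assumes ab: "admissible n a b" and "finite S" and "\<And>i. i \<in> S \<Longrightarrow> f i \<in> carrier (free_alg n)"
  shows "free_hom A a b (sum f S) = (\<Oplus>i\<in>S. free_hom A a b (f i))"
  using assms(2,3)
proof (induction S rule: finite_induct)
  case empty
  show ?case unfolding sum.empty finsum_empty by (rule free_hom_zero)
next
  case (insert i S)
  have "free_hom A a b (sum f (insert i S)) = free_hom A a b (f i) \<oplus> (\<Oplus>i\<in>S. free_hom A a b (f i))"
    using insert by (simp add: free_hom_add[OF ab])
  also have "\<dots> = (\<Oplus>i\<in>insert i S. free_hom A a b (f i))"
    using insert by (intro finsum_insert[symmetric]) (auto intro: free_hom_closed[OF ab])
  finally show ?case .
qed

lemma free_hom_diff_eq_zero:
  assumes ab: "admissible n a b" and f: "f \<in> carrier (free_alg n)" and g: "g \<in> carrier (free_alg n)"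
    and eq: "free_hom A a b f = free_hom A a b g"
  shows "free_hom A a b (f - g) = \<zero>"
proof -
  have "free_hom A a b f = free_hom A a b (f - g) \<oplus> free_hom A a b g"
    using free_hom_add[OF ab, of "f - g" g] f g by simp
  moreover have "free_hom A a b (f - g) \<in> carrier A" "free_hom A a b g \<in> carrier A"
    using f g by (auto intro: free_hom_closed[OF ab])
  ultimately show ?thesis
    using eq add.r_cancel_one' by metis
qed

end

section \<open>Quotients\<close>

lemma quot_alg_simps [simp]:
  "carrier (quot_alg A I) = carrier (A Quot I)"
  "\<one>\<^bsub>quot_alg A I\<^esub> = \<one>\<^bsub>A Quot I\<^esub>" "\<zero>\<^bsub>quot_alg A I\<^esub> = \<zero>\<^bsub>A Quot I\<^esub>"
  "u \<otimes>\<^bsub>quot_alg A I\<^esub> v = u \<otimes>\<^bsub>A Quot I\<^esub> v" "u \<oplus>\<^bsub>quot_alg A I\<^esub> v = u \<oplus>\<^bsub>A Quot I\<^esub> v"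
  by (simp_all add: quot_alg_def)

lemma (in ideal) quot_carrierE:
  assumes "u \<in> carrier (R Quot I)"
  obtains a where "a \<in> carrier R" "u = I +> a"
  using assms by (auto simp: FactRing_def A_RCOSETS_def' a_r_coset_def)

lemma ring_quot_alg:
  assumes "ideal I A" shows "ring (quot_alg A I)"
proof -
  interpret Q: ring "A Quot I" using assms by (rule ideal.quotient_is_ring)
  show ?thesis
  proof (rule ringI)
    show "abelian_group (quot_alg A I)"
    proof (rule abelian_groupI)
      fix u assume "u \<in> carrier (quot_alg A I)"
      then show "\<exists>v\<in>carrier (quot_alg A I). v \<oplus>\<^bsub>quot_alg A I\<^esub> u = \<zero>\<^bsub>quot_alg A I\<^esub>"
        by (intro bexI[of _ "\<ominus>\<^bsub>A Quot I\<^esub> u"]) (auto simp: Q.l_neg)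
    qed (auto simp: Q.a_assoc Q.a_comm Q.a_lcomm)
    show "monoid (quot_alg A I)"
      by (rule monoidI) (auto simp: Q.m_assoc)
  qed (auto simp: Q.l_distr Q.r_distr)
qed

lemma coset_ring_hom_quot_alg:
  assumes "ideal I A" shows "(+>\<^bsub>A\<^esub>) I \<in> Ring.ring_hom A (quot_alg A I)"
  using ideal.rcos_ring_hom[OF assms] by (simp add: Ring.ring_hom_def)

text \<open>A homomorphism that kills \<open>I\<close> is constant on cosets, so the map it induces is well defined.\<close>

lemma descend_coset:
  assumes I: "ideal I R" and S: "ring S" and h: "h \<in> Ring.ring_hom R S"
    and kill: "\<And>a. a \<in> I \<Longrightarrow> h a = \<zero>\<^bsub>S\<^esub>" and a: "a \<in> carrier R"
  shows "descend h (I +>\<^bsub>R\<^esub> a) = h a"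
proof -
  interpret I: ideal I R by (rule I)
  interpret S: ring S by (rule S)
  have "h (i \<oplus>\<^bsub>R\<^esub> a) = h a" if "i \<in> I" for i
    using that a kill[OF that] ring_hom_add[OF h I.Icarr[OF that] a] ring_hom_closed[OF h a] by simp
  moreover have "I +>\<^bsub>R\<^esub> a = (\<lambda>i. i \<oplus>\<^bsub>R\<^esub> a) ` I"
    by (auto simp: a_r_coset_def')
  ultimately have "h ` (I +>\<^bsub>R\<^esub> a) = (\<lambda>_. h a) ` I"
    by (simp add: image_image)
  also have "\<dots> = {h a}"
    using additive_subgroup.zero_closed[OF I.is_additive_subgroup] by (rule image_constant)
  finally have "h ` (I +>\<^bsub>R\<^esub> a) = {h a}" .
  then show ?thesis by (simp add: descend_def)
qed

lemma descend_ring_hom: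
  assumes I: "ideal I R" and S: "ring S" and h: "h \<in> Ring.ring_hom R S"
    and kill: "\<And>a. a \<in> I \<Longrightarrow> h a = \<zero>\<^bsub>S\<^esub>"
  shows "descend h \<in> Ring.ring_hom (quot_alg R I) S"
proof -
  interpret I: ideal I R by (rule I)
  note d = descend_coset[OF I S h kill]
  show ?thesis
  proof (rule ring_hom_memI)
    fix u assume "u \<in> carrier (quot_alg R I)"
    then show "descend h u \<in> carrier S"
      by (auto elim!: I.quot_carrierE simp: d ring_hom_closed[OF h])
  next
    fix u v assume "u \<in> carrier (quot_alg R I)" "v \<in> carrier (quot_alg R I)"
    then obtain a b where ab: "a \<in> carrier R" "u = I +>\<^bsub>R\<^esub> a" "b \<in> carrier R" "v = I +>\<^bsub>R\<^esub> b"
      by (auto elim!: I.quot_carrierE)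
    show "descend h (u \<otimes>\<^bsub>quot_alg R I\<^esub> v) = descend h u \<otimes>\<^bsub>S\<^esub> descend h v"
      "descend h (u \<oplus>\<^bsub>quot_alg R I\<^esub> v) = descend h u \<oplus>\<^bsub>S\<^esub> descend h v"
      using ab ring_hom_mult[OF coset_ring_hom_quot_alg[OF I], of a b, symmetric]
        ring_hom_add[OF coset_ring_hom_quot_alg[OF I], of a b, symmetric]
      by (simp_all add: d ring_hom_mult[OF h] ring_hom_add[OF h] del: quot_alg_simps)
  next
    show "descend h \<one>\<^bsub>quot_alg R I\<^esub> = \<one>\<^bsub>S\<^esub>"
      using ring_hom_one[OF coset_ring_hom_quot_alg[OF I], symmetric] ring_hom_one[OF h]
      by (simp add: d del: quot_alg_simps)
  qed
qed

lemma ring_hom_kills_genideal: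
  assumes R: "ring R" and S: "ring S" and h: "h \<in> Ring.ring_hom R S"
    and X: "X \<subseteq> carrier R" "\<And>x. x \<in> X \<Longrightarrow> h x = \<zero>\<^bsub>S\<^esub>" and a: "a \<in> Idl\<^bsub>R\<^esub> X"
  shows "h a = \<zero>\<^bsub>S\<^esub>"
proof -
  interpret R: ring R by (rule R)
  interpret h: ring_hom_ring R S h by (rule ring_hom_ringI2[OF R S h])
  have "Idl\<^bsub>R\<^esub> X \<subseteq> a_kernel R S h"
  proof (rule R.genideal_minimal[OF h.kernel_is_ideal])
    show "X \<subseteq> a_kernel R S h"
      unfolding a_kernel_def' using X by blast
  qed
  then show ?thesis using a unfolding a_kernel_def' by blast
qed

lemma ring_hom_finsum:
  assumes R: "ring R" and S: "ring S" and h: "h \<in> Ring.ring_hom R S"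
    and "finite X" "\<And>x. x \<in> X \<Longrightarrow> f x \<in> carrier R"
  shows "h (\<Oplus>\<^bsub>R\<^esub>x\<in>X. f x) = (\<Oplus>\<^bsub>S\<^esub>x\<in>X. h (f x))"
proof -
  interpret R: ring R by (rule R)
  interpret S: ring S by (rule S)
  interpret h: ring_hom_ring R S h by (rule ring_hom_ringI2[OF R S h])
  show ?thesis using assms(4,5)
  proof (induction X rule: finite_induct)
    case (insert x X)
    have "h (\<Oplus>\<^bsub>R\<^esub>x\<in>insert x X. f x) = h (f x) \<oplus>\<^bsub>S\<^esub> (\<Oplus>\<^bsub>S\<^esub>x\<in>X. h (f x))"
      using insert by (subst R.finsum_insert) auto
    also have "\<dots> = (\<Oplus>\<^bsub>S\<^esub>x\<in>insert x X. h (f x))"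
      using insert by (intro S.finsum_insert[symmetric]) auto
    finally show ?case .
  qed simp
qed

lemma finsum_free_alg:
  assumes "finite X" "\<And>x. x \<in> X \<Longrightarrow> f x \<in> carrier (free_alg n)"
  shows "(\<Oplus>\<^bsub>free_alg n\<^esub>x\<in>X. f x) = sum f X"
proof -
  interpret ring "free_alg n" by (rule ring_free_alg)
  show ?thesis using assms
  proof (induction X rule: finite_induct)
    case (insert x X)
    have "finsum (free_alg n) f (insert x X) = f x \<oplus>\<^bsub>free_alg n\<^esub> finsum (free_alg n) f X"
      using insert by (intro finsum_insert) auto
    then show ?case using insert by simp
  qed simp
qed

lemma (in ideal) coset_absorb:
  "\<lbrakk>i \<in> I; a \<in> carrier R\<rbrakk> \<Longrightarrow> I +> (i \<oplus> a) = I +> a"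
  using quotient_eq_iff_same_a_r_cos[OF is_ideal, of "i \<oplus> a" a] Icarr[of i]
  by (simp add: a_minus_def a_assoc r_neg)

lemma (in ideal) coset_eq_zero_iff:
  assumes "a \<in> carrier R" shows "I +> a = \<zero>\<^bsub>R Quot I\<^esub> \<longleftrightarrow> a \<in> I"
  using quotient_eq_iff_same_a_r_cos[OF is_ideal assms zero_closed]
    ring_hom_zero[OF rcos_ring_hom ring_axioms quotient_is_ring] assms
  by (simp add: a_minus_def)

lemma (in ideal) coset_elemE:
  assumes "b \<in> I +> a"
  obtains i where "i \<in> I" "b = i \<oplus> a"
  using assms by (auto simp: a_r_coset_def')

text \<open>An operation that is additive and preserves \<open>I\<close> passes to the quotient.\<close>

lemma (in ideal) UN_coset:
  assumes a: "a \<in> carrier R"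
    and closed: "\<And>b. b \<in> carrier R \<Longrightarrow> g b \<in> carrier R"
    and additive: "\<And>b c. \<lbrakk>b \<in> carrier R; c \<in> carrier R\<rbrakk> \<Longrightarrow> g (b \<oplus> c) = g b \<oplus> g c"
    and preserves: "\<And>i. i \<in> I \<Longrightarrow> g i \<in> I"
  shows "(\<Union>b\<in>I +> a. I +> g b) = I +> g a"
proof -
  have "I +> g b = I +> g a" if b: "b \<in> I +> a" for b
    using b
  proof (rule coset_elemE)
    fix i assume i: "i \<in> I" "b = i \<oplus> a"
    then show ?thesis
      using additive[OF Icarr[OF i(1)] a] coset_absorb[OF preserves[OF i(1)] closed[OF a]] by simp
  qed
  then have "(\<Union>b\<in>I +> a. I +> g b) = (\<Union>b\<in>I +> a. I +> g a)"
    by (rule SUP_cong[OF refl])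
  then show ?thesis
    using a_rcos_self[OF a] by (simp only:) blast
qed

context complex_algebra
begin

lemma scale_in_ideal:
  assumes I: "ideal I A" and i: "i \<in> I" shows "scale A c i \<in> I"
proof -
  have "i \<in> carrier A" using ideal.Icarr[OF I i] .
  then have "scale A c i = scale A c \<one> \<otimes> i" by (simp add: scale_mult_left)
  then show ?thesis using ideal.I_l_closed[OF I i, of "scale A c \<one>"] by simp
qed

lemma scale_quot_alg:
  assumes I: "ideal I A" and a: "a \<in> carrier A"
  shows "scale (quot_alg A I) c (I +> a) = I +> scale A c a"
  unfolding quot_alg_def star_alg.simps
  by (rule ideal.UN_coset[OF I a]) (auto simp: scale_add scale_in_ideal[OF I])

lemma complex_algebra_quot_alg:
  assumes I: "ideal I A" shows "complex_algebra (quot_alg A I)"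
proof -
  interpret Q: ring "quot_alg A I" by (rule ring_quot_alg[OF I])
  note hom = coset_ring_hom_quot_alg[OF I]
  note simps = scale_quot_alg[OF I] ring_hom_add[OF hom, symmetric] ring_hom_mult[OF hom, symmetric]
    ring_hom_closed[OF hom]
  have ex: "\<exists>a\<in>carrier A. u = I +> a" if "u \<in> carrier (quot_alg A I)" for u
    using that by (auto elim!: ideal.quot_carrierE[OF I])
  show ?thesis
  proof
    fix u c d assume "u \<in> carrier (quot_alg A I)"
    then obtain a where a: "a \<in> carrier A" "u = I +> a" using ex by auto
    show "scale (quot_alg A I) c u \<in> carrier (quot_alg A I)"
      "scale (quot_alg A I) (c + d) u
         = scale (quot_alg A I) c u \<oplus>\<^bsub>quot_alg A I\<^esub> scale (quot_alg A I) d u"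
      "scale (quot_alg A I) c (scale (quot_alg A I) d u) = scale (quot_alg A I) (c * d) u"
      "scale (quot_alg A I) 1 u = u"
      using a by (simp_all add: simps add_scale scale_scale del: quot_alg_simps)
    fix v assume "v \<in> carrier (quot_alg A I)"
    then obtain b where b: "b \<in> carrier A" "v = I +> b" using ex by auto
    show "scale (quot_alg A I) c (u \<oplus>\<^bsub>quot_alg A I\<^esub> v)
         = scale (quot_alg A I) c u \<oplus>\<^bsub>quot_alg A I\<^esub> scale (quot_alg A I) c v"
      "scale (quot_alg A I) c u \<otimes>\<^bsub>quot_alg A I\<^esub> v = scale (quot_alg A I) c (u \<otimes>\<^bsub>quot_alg A I\<^esub> v)"
      "u \<otimes>\<^bsub>quot_alg A I\<^esub> scale (quot_alg A I) c v = scale (quot_alg A I) c (u \<otimes>\<^bsub>quot_alg A I\<^esub> v)"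
      using a b by (simp_all add: simps scale_add scale_mult_left scale_mult_right del: quot_alg_simps)
  qed
qed

end

section \<open>The involution of the free algebra\<close>

definition star_word :: "word \<Rightarrow> word" where
  "star_word w = Word (rev (map star_letter (letters w)))"

lemma star_letter_star_letter [simp]: "star_letter (star_letter l) = l"
  by (cases l) auto

lemma star_letter_mem [simp]: "star_letter l \<in> letters_upto n \<longleftrightarrow> l \<in> letters_upto n"
  by (cases l) (auto simp: letters_upto_def)

lemma letters_star_word [simp]: "letters (star_word w) = rev (map star_letter (letters w))"
  by (simp add: star_word_def)

lemma star_word_plus: "star_word (v + w) = star_word w + star_word v"
  by (simp add: star_word_def plus_word_def)

lemma star_word_star_word [simp]: "star_word (star_word w) = w"
  by (simp add: star_word_def rev_map comp_def)

lemma free_star_over_superset: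
  assumes "finite S" "Poly_Mapping.keys f \<subseteq> S"
  shows "free_star f = (\<Sum>w\<in>S. Poly_Mapping.single (star_word w) (cnj (Poly_Mapping.lookup f w)))"
  unfolding free_star_def star_word_def[symmetric]
  by (rule sum.mono_neutral_left) (use assms in \<open>auto simp: in_keys_iff\<close>)

lemma free_star_zero [simp]: "free_star 0 = 0"
  by (simp add: free_star_def)

lemma free_star_single [simp]:
  "free_star (Poly_Mapping.single w c) = Poly_Mapping.single (star_word w) (cnj c)"
  by (subst free_star_over_superset[where S = "{w}"]) auto

lemma free_star_add [simp]: "free_star (f + g) = free_star f + free_star g"
proof -
  let ?S = "Poly_Mapping.keys f \<union> Poly_Mapping.keys g"
  have "Poly_Mapping.keys (f + g) \<subseteq> ?S" by (rule keys_add)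
  then show ?thesis
    by (simp add: free_star_over_superset[where S = ?S] lookup_add single_add sum.distrib)
qed

lemma free_star_uminus [simp]: "free_star (- f) = - free_star f"
  using free_star_add[of f "- f"] by (metis add.right_inverse free_star_zero neg_eq_iff_add_eq_0)

lemma free_star_gen [simp]: "free_star (gen l) = gen (star_letter l)"
  by (simp add: gen_def star_word_def)

lemma free_star_closed [simp, intro]:
  "f \<in> carrier (free_alg n) \<Longrightarrow> free_star f \<in> carrier (free_alg n)"
  by (induction f rule: free_induct) (auto simp: subset_iff intro!: free_carrier_single)

lemma free_star_star:
  "f \<in> carrier (free_alg n) \<Longrightarrow> free_star (free_star f) = f"
  by (induction f rule: free_induct) auto

lemma free_star_mult:
  assumes f: "f \<in> carrier (free_alg n)" and g: "g \<in> carrier (free_alg n)"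
  shows "free_star (f * g) = free_star g * free_star f"
  using f
proof (induction f rule: free_induct)
  case (single w c)
  from g show ?case
    by (induction g rule: free_induct)
       (simp_all add: mult_single star_word_plus distrib_left distrib_right mult.commute)
qed (simp_all add: distrib_left distrib_right)

section \<open>The quantum Euclidean space\<close>

text \<open>Every relation of the quantum Euclidean space is homogeneous, which is what makes
  \<open>x\<^sub>i \<mapsto> q\<^sup>2x\<^sub>i\<close>, \<open>y \<mapsto> q\<^sup>2y\<close> an endomorphism.\<close>

definition homogeneous :: "nat \<Rightarrow> free \<Rightarrow> bool" where
  "homogeneous d f \<longleftrightarrow> (\<forall>w\<in>Poly_Mapping.keys f. length (letters w) = d)"

lemma homogeneous_add: "\<lbrakk>homogeneous d f; homogeneous d g\<rbrakk> \<Longrightarrow> homogeneous d (f + g)"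
  using keys_add[of f g] by (auto simp: homogeneous_def)

lemma homogeneous_zero: "homogeneous d 0"
  by (simp add: homogeneous_def)

lemma homogeneous_uminus: "homogeneous d f \<Longrightarrow> homogeneous d (- f)"
  by (simp add: homogeneous_def in_keys_iff)

lemma homogeneous_diff: "\<lbrakk>homogeneous d f; homogeneous d g\<rbrakk> \<Longrightarrow> homogeneous d (f - g)"
  using homogeneous_add[of d f "- g"] homogeneous_uminus[of d g] by simp

lemma homogeneous_scale: "homogeneous d f \<Longrightarrow> homogeneous d (free_scale c f)"
  by (auto simp: homogeneous_def in_keys_iff)

lemma homogeneous_sum: "(\<And>i. i \<in> S \<Longrightarrow> homogeneous d (f i)) \<Longrightarrow> homogeneous d (sum f S)"
  by (induction S rule: infinite_finite_induct) (auto intro: homogeneous_add homogeneous_zero)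

lemma homogeneous_gen_mult: "homogeneous 2 (gen k * gen l)"
  by (simp add: homogeneous_def gen_def mult_single)

lemma homogeneous_star: "homogeneous d f \<Longrightarrow> homogeneous d (free_star f)"
  unfolding free_star_def star_word_def[symmetric]
  by (rule homogeneous_sum) (simp add: homogeneous_def)

lemma LX_mem [simp]: "LX i \<in> letters_upto n \<longleftrightarrow> i \<in> {1..n}"
  and LXs_mem [simp]: "LXs i \<in> letters_upto n \<longleftrightarrow> i \<in> {1..n}"
  and LY_mem [simp]: "LY \<in> letters_upto n"
  by (auto simp: letters_upto_def)

lemma euclid_rels_closed: "euclid_rels q n \<subseteq> carrier (free_alg n)"
  unfolding euclid_rels_def Let_def
  by (auto intro!: free_carrier_diff free_carrier_add free_carrier_scale free_carrier_mult
      free_carrier_gen free_carrier_sum)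

lemma homogeneous_euclid_rels: "r \<in> euclid_rels q n \<Longrightarrow> homogeneous 2 r"
  unfolding euclid_rels_def Let_def
  by (auto intro!: homogeneous_diff homogeneous_add homogeneous_scale homogeneous_gen_mult
      homogeneous_sum)

lemma ideal_euclid_ideal: "ideal (euclid_ideal q n) (free_alg n)"
  unfolding euclid_ideal_def
  by (rule ring.genideal_ideal[OF ring_free_alg]) (use euclid_rels_closed in auto)

text \<open>The generating set of the ideal is closed under the involution, and the elements whose adjoint
  lies in the ideal form an ideal because the involution reverses products.\<close>

lemma free_star_euclid_ideal:
  assumes "f \<in> euclid_ideal q n" shows "free_star f \<in> euclid_ideal q n"
proof -
  let ?X = "euclid_rels q n \<union> free_star ` euclid_rels q n"
  let ?J = "{f \<in> carrier (free_alg n). free_star f \<in> euclid_ideal q n}"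
  interpret R: ring "free_alg n" by (rule ring_free_alg)
  interpret I: ideal "euclid_ideal q n" "free_alg n" by (rule ideal_euclid_ideal)
  have I_add: "f + g \<in> euclid_ideal q n" if "f \<in> euclid_ideal q n" "g \<in> euclid_ideal q n" for f g
    using additive_subgroup.a_closed[OF I.is_additive_subgroup that] by simp
  have I_minus: "- f \<in> euclid_ideal q n" if "f \<in> euclid_ideal q n" for f
    using additive_subgroup.a_inv_closed[OF I.is_additive_subgroup that] I.Icarr[OF that] by simp
  have X: "?X \<subseteq> carrier (free_alg n)" using euclid_rels_closed by auto
  have "ideal ?J (free_alg n)"
  proof (rule idealI)
    show "subgroup ?J (add_monoid (free_alg n))"
    proof
      fix f assume f: "f \<in> ?J"
      then have "inv\<^bsub>add_monoid (free_alg n)\<^esub> f = - f"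
        using a_inv_free_alg[of f n] by (simp add: a_inv_def)
      then show "inv\<^bsub>add_monoid (free_alg n)\<^esub> f \<in> ?J" using f I_minus by auto
    qed (use I_add additive_subgroup.zero_closed[OF I.is_additive_subgroup] in auto)
  next
    fix f g assume fg: "f \<in> ?J" "g \<in> carrier (free_alg n)"
    then show "g \<otimes>\<^bsub>free_alg n\<^esub> f \<in> ?J"
      using I.I_r_closed[of "free_star f" "free_star g"] by (auto simp: free_star_mult)
    show "f \<otimes>\<^bsub>free_alg n\<^esub> g \<in> ?J"
      using fg I.I_l_closed[of "free_star f" "free_star g"] by (auto simp: free_star_mult)
  qed (rule ring_free_alg)
  moreover have "?X \<subseteq> ?J"
  proof
    fix f assume f: "f \<in> ?X"
    then have "free_star f \<in> ?X"
    proof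
      assume "f \<in> free_star ` euclid_rels q n"
      then obtain r where r: "r \<in> euclid_rels q n" "f = free_star r" by blast
      then have "free_star f = r"
        using euclid_rels_closed[of q n] free_star_star[of r n] by blast
      then show ?thesis using r by blast
    qed blast
    then show "f \<in> ?J"
      using X f R.genideal_self[OF X] by (auto simp: euclid_ideal_def)
  qed
  ultimately have "euclid_ideal q n \<subseteq> ?J"
    unfolding euclid_ideal_def by (rule R.genideal_minimal)
  then show ?thesis using assms by blast
qed

definition cls :: "real \<Rightarrow> nat \<Rightarrow> free \<Rightarrow> free set" where
  "cls q n f = euclid_ideal q n +>\<^bsub>free_alg n\<^esub> f"

lemma complex_algebra_Pol_R: "complex_algebra (Pol_R q n)"
  unfolding Pol_R_def
  by (rule complex_algebra.complex_algebra_quot_alg[OF complex_algebra_free_alg ideal_euclid_ideal])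

lemma ring_Pol_R: "ring (Pol_R q n)"
  using complex_algebra_Pol_R by (rule complex_algebra.axioms)

lemma cls_ring_hom: "cls q n \<in> Ring.ring_hom (free_alg n) (Pol_R q n)"
proof -
  have "cls q n = (+>\<^bsub>free_alg n\<^esub>) (euclid_ideal q n)" by (simp add: cls_def fun_eq_iff)
  then show ?thesis
    using coset_ring_hom_quot_alg[OF ideal_euclid_ideal] by (simp add: Pol_R_def)
qed

lemma cls_closed [simp, intro]: "f \<in> carrier (free_alg n) \<Longrightarrow> cls q n f \<in> carrier (Pol_R q n)"
  using ring_hom_closed[OF cls_ring_hom] .

lemma cls_add:
  "\<lbrakk>f \<in> carrier (free_alg n); g \<in> carrier (free_alg n)\<rbrakk> \<Longrightarrow>
     cls q n f \<oplus>\<^bsub>Pol_R q n\<^esub> cls q n g = cls q n (f + g)"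
  using ring_hom_add[OF cls_ring_hom] by simp

lemma cls_mult:
  "\<lbrakk>f \<in> carrier (free_alg n); g \<in> carrier (free_alg n)\<rbrakk> \<Longrightarrow>
     cls q n f \<otimes>\<^bsub>Pol_R q n\<^esub> cls q n g = cls q n (f * g)"
  using ring_hom_mult[OF cls_ring_hom] by simp

lemma cls_one: "\<one>\<^bsub>Pol_R q n\<^esub> = cls q n 1"
  using ring_hom_one[OF cls_ring_hom, of q n] by simp

lemma cls_zero: "\<zero>\<^bsub>Pol_R q n\<^esub> = cls q n 0"
  using ring_hom_zero[OF cls_ring_hom ring_free_alg ring_Pol_R, of q n] by simp

lemma cls_diff:
  assumes "f \<in> carrier (free_alg n)" "g \<in> carrier (free_alg n)"
  shows "cls q n f \<ominus>\<^bsub>Pol_R q n\<^esub> cls q n g = cls q n (f - g)"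
proof -
  interpret ring "Pol_R q n" by (rule ring_Pol_R)
  have "\<ominus>\<^bsub>Pol_R q n\<^esub> cls q n g = cls q n (- g)"
    by (rule minus_equality) (use assms in \<open>auto simp: cls_add cls_zero\<close>)
  then show ?thesis using assms cls_add[of f n "- g" q] by (simp add: a_minus_def)
qed

lemma scale_cls:
  "f \<in> carrier (free_alg n) \<Longrightarrow> scale (Pol_R q n) c (cls q n f) = cls q n (free_scale c f)"
  using complex_algebra.scale_quot_alg[OF complex_algebra_free_alg ideal_euclid_ideal]
  by (simp add: cls_def Pol_R_def)

lemma star_cls:
  "f \<in> carrier (free_alg n) \<Longrightarrow> star (Pol_R q n) (cls q n f) = cls q n (free_star f)"
  unfolding cls_def Pol_R_def quot_alg_def star_alg.simps free_alg_simps
  by (rule ideal.UN_coset[OF ideal_euclid_ideal]) (auto simp: free_star_euclid_ideal)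

lemma cls_eq_zero: "f \<in> euclid_ideal q n \<Longrightarrow> cls q n f = \<zero>\<^bsub>Pol_R q n\<^esub>"
  using ideal.coset_eq_zero_iff[OF ideal_euclid_ideal, of f n q]
    ideal.Icarr[OF ideal_euclid_ideal, of f q n]
  by (simp add: cls_def Pol_R_def)

lemma finsum_cls:
  assumes "finite X" "\<And>i. i \<in> X \<Longrightarrow> f i \<in> carrier (free_alg n)"
  shows "(\<Oplus>\<^bsub>Pol_R q n\<^esub>i\<in>X. cls q n (f i)) = cls q n (\<Sum>i\<in>X. f i)"
  using ring_hom_finsum[OF ring_free_alg[of n] ring_Pol_R[of q n] cls_ring_hom assms]
    finsum_free_alg[OF assms] by simp

lemma x_R_eq: "x_R q n i = cls q n (gen (LX i))"
  and y_R_eq: "y_R q n = cls q n (gen LY)"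
  by (simp_all add: x_R_def y_R_def cls_def)

lemma (in complex_algebra) free_hom_kills_euclid_ideal:
  assumes ab: "admissible n a b"
    and rels: "\<And>r. r \<in> euclid_rels q n \<Longrightarrow> free_hom A a b r = \<zero>"
      "\<And>r. r \<in> euclid_rels q n \<Longrightarrow> free_hom A a b (free_star r) = \<zero>"
    and f: "f \<in> euclid_ideal q n"
  shows "free_hom A a b f = \<zero>"
  by (rule ring_hom_kills_genideal[OF ring_free_alg ring_axioms free_hom_ring_hom[OF ab] _ _
        f[unfolded euclid_ideal_def]])
     (use euclid_rels_closed rels in auto)

section \<open>The automorphism \<open>\<phi>\<close>\<close>

text \<open>The map \<open>\<phi>\<close> is the case \<open>c = q\<^sup>2\<close>. For real \<open>c\<close> the image of \<open>x\<^sub>i\<^sup>*\<close> is \<open>cx\<^sub>i\<^sup>*\<close>, so a word of length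
  \<open>d\<close> is multiplied by \<open>c\<^sup>d\<close>.\<close>

definition rescaling :: "real \<Rightarrow> nat \<Rightarrow> complex \<Rightarrow> free \<Rightarrow> free set" where
  "rescaling q n c = free_hom (Pol_R q n)
     (\<lambda>i. scale (Pol_R q n) c (x_R q n i)) (scale (Pol_R q n) c (y_R q n))"

lemma phi_eq_rescaling: "phi q n = descend (rescaling q n (complex_of_real (q^2)))"
  unfolding phi_def rescaling_def Let_def ..

lemma rescaling_letter_value:
  assumes "l \<in> letters_upto n" and c: "cnj c = c"
  shows "letter_value (Pol_R q n)
      (\<lambda>i. scale (Pol_R q n) c (x_R q n i)) (scale (Pol_R q n) c (y_R q n)) l
    = cls q n (Poly_Mapping.single (Word [l]) c)"
proof -
  have "free_scale c (gen l) = Poly_Mapping.single (Word [l]) c" for l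
    by (simp add: gen_def free_scale_simps)
  then show ?thesis
    using assms
    by (cases l)
       (auto simp: x_R_eq y_R_eq scale_cls star_cls star_word_def free_carrier_single)
qed

lemma rescaling_admissible:
  assumes c: "cnj c = c"
  shows "complex_algebra.admissible (Pol_R q n) n
     (\<lambda>i. scale (Pol_R q n) c (x_R q n i)) (scale (Pol_R q n) c (y_R q n))"
  unfolding complex_algebra.admissible_def[OF complex_algebra_Pol_R]
  using rescaling_letter_value[OF _ c, of _ n q] by auto

lemma rescaling_word:
  assumes "set ls \<subseteq> letters_upto n" and c: "cnj c = c"
  shows "alg_prod (Pol_R q n) (map (letter_value (Pol_R q n)
      (\<lambda>i. scale (Pol_R q n) c (x_R q n i)) (scale (Pol_R q n) c (y_R q n))) ls)
    = cls q n (Poly_Mapping.single (Word ls) (c ^ length ls))"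
  using assms(1)
proof (induction ls)
  case Nil
  show ?case by (simp add: cls_one flip: zero_word_def)
next
  case (Cons l ls)
  have "Poly_Mapping.single (Word [l]) c * Poly_Mapping.single (Word ls) (c ^ length ls)
    = Poly_Mapping.single (Word (l # ls)) (c ^ length (l # ls))"
    by (simp add: mult_single plus_word_def)
  then show ?case using Cons by (simp add: rescaling_letter_value[OF _ c] cls_mult)
qed

lemma rescaling_homogeneous:
  assumes f: "f \<in> carrier (free_alg n)" and d: "homogeneous d f" and c: "cnj c = c"
  shows "rescaling q n c f = cls q n (free_scale (c ^ d) f)"
proof -
  interpret complex_algebra "Pol_R q n" by (rule complex_algebra_Pol_R)
  let ?s = "\<lambda>w. Poly_Mapping.single w (Poly_Mapping.lookup f w)"
  note ad = rescaling_admissible[OF c]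
  have w: "set (letters w) \<subseteq> letters_upto n" "length (letters w) = d"
    if "w \<in> Poly_Mapping.keys f" for w
    using f d that by (auto simp: carrier_free_alg homogeneous_def)
  have "rescaling q n c (?s w) = cls q n (free_scale (c ^ d) (?s w))"
    if "w \<in> Poly_Mapping.keys f" for w
    using w[OF that] rescaling_word[OF w(1)[OF that] c]
    by (simp add: rescaling_def free_hom_single[OF ad] scale_cls free_scale_simps mult.commute)
  then have word: "(\<Oplus>\<^bsub>Pol_R q n\<^esub>w\<in>Poly_Mapping.keys f. rescaling q n c (?s w))
      = (\<Oplus>\<^bsub>Pol_R q n\<^esub>w\<in>Poly_Mapping.keys f. cls q n (free_scale (c ^ d) (?s w)))"
    using w by (intro finsum_cong') (auto intro!: cls_closed free_carrier_scale free_carrier_single)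
  have "rescaling q n c f = rescaling q n c (\<Sum>w\<in>Poly_Mapping.keys f. ?s w)"
    by (simp flip: free_eq_sum_singles)
  also have "\<dots> = (\<Oplus>\<^bsub>Pol_R q n\<^esub>w\<in>Poly_Mapping.keys f. rescaling q n c (?s w))"
    unfolding rescaling_def using w by (intro free_hom_sum[OF ad]) auto
  also note word
  also have "(\<Oplus>\<^bsub>Pol_R q n\<^esub>w\<in>Poly_Mapping.keys f. cls q n (free_scale (c ^ d) (?s w)))
      = cls q n (\<Sum>w\<in>Poly_Mapping.keys f. free_scale (c ^ d) (?s w))"
    using w by (intro finsum_cls) auto
  also have "(\<Sum>w\<in>Poly_Mapping.keys f. free_scale (c ^ d) (?s w)) = free_scale (c ^ d) f"
    by (simp add: free_scale_def sum_distrib_left[symmetric] flip: free_eq_sum_singles)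
  finally show ?thesis .
qed

lemma euclid_rels_in_ideal:
  "euclid_rels q n \<union> free_star ` euclid_rels q n \<subseteq> euclid_ideal q n"
  unfolding euclid_ideal_def
  by (rule ring.genideal_self[OF ring_free_alg]) (use euclid_rels_closed in auto)

lemma descend_rescaling:
  assumes f: "f \<in> carrier (free_alg n)" and c: "cnj c = c"
  shows "descend (rescaling q n c) (cls q n f) = rescaling q n c f"
proof -
  interpret complex_algebra "Pol_R q n" by (rule complex_algebra_Pol_R)
  note ad = rescaling_admissible[OF c]
  have kill: "rescaling q n c r = \<zero>\<^bsub>Pol_R q n\<^esub>" if r: "r \<in> euclid_ideal q n" "homogeneous 2 r" for r
  proof -
    have "free_scale (c\<^sup>2) r \<in> euclid_ideal q n"
      using complex_algebra.scale_in_ideal[OF complex_algebra_free_alg ideal_euclid_ideal r(1)] by simp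
    then show ?thesis
      using rescaling_homogeneous[OF ideal.Icarr[OF ideal_euclid_ideal r(1)] r(2) c]
      by (simp add: cls_eq_zero)
  qed
  have "rescaling q n c i = \<zero>\<^bsub>Pol_R q n\<^esub>" if "i \<in> euclid_ideal q n" for i
    unfolding rescaling_def
    by (rule free_hom_kills_euclid_ideal[OF ad _ _ that]; rule kill[unfolded rescaling_def])
       (use euclid_rels_in_ideal[of q n] in \<open>auto intro: homogeneous_euclid_rels homogeneous_star\<close>)
  then show ?thesis
    using free_hom_ring_hom[OF ad] unfolding cls_def rescaling_def
    by (intro descend_coset[OF ideal_euclid_ideal ring_axioms _ _ f]) auto
qed

text \<open>Only the diagonal of \<open>e\<close> matters for the trace, and its entries are affine in \<open>y\<close>.\<close>

definition affine_y :: "complex \<Rightarrow> complex \<Rightarrow> free" where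
  "affine_y c r = Poly_Mapping.single 0 c + Poly_Mapping.single (Word [LY]) r"

lemma affine_y_closed [simp, intro]: "affine_y c r \<in> carrier (free_alg n)"
  unfolding affine_y_def by (intro free_carrier_add free_carrier_single) auto

lemma lookup_affine_y [simp]: "Poly_Mapping.lookup (affine_y c r) 0 = c"
  by (simp add: affine_y_def lookup_add lookup_single when_def zero_word_def)

lemma phi_affine_y:
  "phi q n (cls q n (affine_y c r)) = cls q n (affine_y c (complex_of_real (q^2) * r))"
proof -
  interpret complex_algebra "Pol_R q n" by (rule complex_algebra_Pol_R)
  define s where "s = complex_of_real (q^2)"
  have s: "cnj s = s" by (simp add: s_def)
  have "phi q n (cls q n (affine_y c r)) = rescaling q n s (affine_y c r)"
    unfolding phi_eq_rescaling s_def[symmetric] by (rule descend_rescaling[OF affine_y_closed s])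
  also have "\<dots> = rescaling q n s (Poly_Mapping.single 0 c)
      \<oplus>\<^bsub>Pol_R q n\<^esub> rescaling q n s (Poly_Mapping.single (Word [LY]) r)"
    unfolding rescaling_def affine_y_def
    by (intro free_hom_add[OF rescaling_admissible[OF s]] free_carrier_single) auto
  also have "rescaling q n s (Poly_Mapping.single 0 c) = cls q n (Poly_Mapping.single 0 c)"
    by (subst rescaling_homogeneous[OF _ _ s, of _ _ 0])
       (auto simp: homogeneous_def free_scale_simps intro!: free_carrier_single)
  also have "rescaling q n s (Poly_Mapping.single (Word [LY]) r)
      = cls q n (Poly_Mapping.single (Word [LY]) (s * r))"
    by (subst rescaling_homogeneous[OF _ _ s, of _ _ 1])
       (auto simp: homogeneous_def free_scale_simps intro!: free_carrier_single)
  also have "cls q n (Poly_Mapping.single 0 c)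
      \<oplus>\<^bsub>Pol_R q n\<^esub> cls q n (Poly_Mapping.single (Word [LY]) (s * r)) = cls q n (affine_y c (s * r))"
    unfolding affine_y_def by (intro cls_add free_carrier_single) auto
  finally show ?thesis by (simp only: s_def)
qed

section \<open>The trace of the idempotent\<close>

text \<open>The \<open>j\<close>-th diagonal entry of \<open>e\<^bsub>2k\<^esub>\<close> is \<open>c + ry\<close> with \<open>(c, r)\<close> the pair below: the lower right
  block \<open>1 - \<phi>(e)\<close> replaces \<open>(c, r)\<close> by \<open>(1 - c, -q\<^sup>2r)\<close>.\<close>

fun diag_coeffs :: "real \<Rightarrow> nat \<Rightarrow> nat \<Rightarrow> complex \<times> complex" where
  "diag_coeffs q 0 j = (1, -1)"
| "diag_coeffs q (Suc k) j =
     (if j < 2 ^ k then diag_coeffs q k j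
      else (1 - fst (diag_coeffs q k (j - 2 ^ k)),
            - complex_of_real (q^2) * snd (diag_coeffs q k (j - 2 ^ k))))"

lemma dim_e_mat [simp]: "dim_row (e_mat q n k) = 2 ^ k" "dim_col (e_mat q n k) = 2 ^ k"
  by (induction k) (simp_all add: one_minus_mat_def)

lemma e_mat_diag:
  "j < 2 ^ k \<Longrightarrow> e_mat q n k $$ (j, j)
     = cls q n (affine_y (fst (diag_coeffs q k j)) (snd (diag_coeffs q k j)))"
proof (induction k arbitrary: j)
  case 0
  have "affine_y 1 (- 1) = 1 - gen LY"
    by (simp add: affine_y_def gen_def single_uminus)
  then show ?case
    using 0 by (simp add: cls_one y_R_eq cls_diff)
next
  case (Suc k)
  show ?case
  proof (cases "j < 2 ^ k")
    case True
    then show ?thesis using Suc.IH by (simp add: one_minus_mat_def)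
  next
    case False
    define i where "i = j - 2 ^ k"
    have i: "i < 2 ^ k" "j = i + 2 ^ k" using False Suc.prems by (auto simp: i_def)
    obtain c r where cr: "diag_coeffs q k i = (c, r)" by fastforce
    have "1 - affine_y c (complex_of_real (q^2) * r)
        = affine_y (1 - c) (- complex_of_real (q^2) * r)"
      unfolding affine_y_def by (simp add: single_diff single_uminus)
    then have "\<one>\<^bsub>Pol_R q n\<^esub> \<ominus>\<^bsub>Pol_R q n\<^esub> phi q n (e_mat q n k $$ (i, i))
        = cls q n (affine_y (1 - c) (- complex_of_real (q^2) * r))"
      using Suc.IH[OF i(1)] cr by (simp add: cls_one phi_affine_y cls_diff del: of_real_power)
    then show ?thesis
      using i cr by (simp add: one_minus_mat_def mat_times_elt_def del: of_real_power)
  qed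
qed

text \<open>The two halves of the diagonal pair \<open>c\<close> with \<open>1 - c\<close> and \<open>r\<close> with \<open>-q\<^sup>2r\<close>: the constants
  of each pair add to \<open>1\<close>, and the sum of the \<open>y\<close>-coefficients is multiplied by \<open>1 - q\<^sup>2\<close>.\<close>

lemma sum_diag_coeffs:
  "(\<Sum>j\<in>{..<2 ^ Suc k}. fst (diag_coeffs q (Suc k) j)) = 2 ^ k"
  "(\<Sum>j\<in>{..<2 ^ k}. snd (diag_coeffs q k j)) = - ((1 - complex_of_real (q^2)) ^ k)"
proof -
  have split: "(\<Sum>j\<in>{..<2 ^ Suc k}. f j) = (\<Sum>j\<in>{..<2 ^ k}. f j) + (\<Sum>j\<in>{..<2 ^ k}. f (j + 2 ^ k))"
    for f :: "nat \<Rightarrow> complex" and k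
    using sum.nat_group[of f "2 ^ k" 2] sum.atLeastLessThan_shift_bounds[of f 0 "2 ^ k" "2 ^ k"]
      sum.atLeastLessThan_concat[of 0 "2 ^ k" "2 ^ k + 2 ^ k" f]
    by (simp add: atLeast0LessThan mult_2 comp_def add.commute)
  show "(\<Sum>j\<in>{..<2 ^ Suc k}. fst (diag_coeffs q (Suc k) j)) = 2 ^ k"
    unfolding split by (simp add: sum_subtractf)
  show "(\<Sum>j\<in>{..<2 ^ k}. snd (diag_coeffs q k j)) = - ((1 - complex_of_real (q^2)) ^ k)"
  proof (induction k)
    case (Suc k)
    have "(\<Sum>j\<in>{..<2 ^ Suc k}. snd (diag_coeffs q (Suc k) j))
        = (1 - complex_of_real (q^2)) * (\<Sum>j\<in>{..<2 ^ k}. snd (diag_coeffs q k j))"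
      unfolding split by (simp add: sum_distrib_left sum_negf sum_subtractf algebra_simps)
    then show ?case using Suc by simp
  qed simp
qed

lemma sum_affine_y: "(\<Sum>j\<in>S. affine_y (c j) (r j)) = affine_y (\<Sum>j\<in>S. c j) (\<Sum>j\<in>S. r j)"
  by (induction S rule: infinite_finite_induct)
     (simp_all add: affine_y_def single_add algebra_simps)

section \<open>The quantum sphere\<close>

definition sphere_rel :: "real \<Rightarrow> nat \<Rightarrow> free" where
  "sphere_rel q n = free_scale (complex_of_real (q^2)) (\<Sum>i\<in>{1..n}. gen (LXs i) * gen (LX i))
     - gen LY + gen LY * gen LY"

lemma sphere_rel_closed: "sphere_rel q n \<in> carrier (free_alg n)"
  unfolding sphere_rel_def
  by (intro free_carrier_add free_carrier_diff free_carrier_scale free_carrier_sum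
      free_carrier_mult free_carrier_gen) auto

lemma sphere_ideal_eq: "sphere_ideal q n = Idl\<^bsub>Pol_R q n\<^esub> {cls q n (sphere_rel q n)}"
proof -
  interpret complex_algebra "Pol_R q n" by (rule complex_algebra_Pol_R)
  have "(\<Oplus>\<^bsub>Pol_R q n\<^esub>i\<in>{1..n}. star (Pol_R q n) (x_R q n i) \<otimes>\<^bsub>Pol_R q n\<^esub> x_R q n i)
      = (\<Oplus>\<^bsub>Pol_R q n\<^esub>i\<in>{1..n}. cls q n (gen (LXs i) * gen (LX i)))"
    by (intro finsum_cong') (auto simp: x_R_eq star_cls cls_mult)
  also have "\<dots> = cls q n (\<Sum>i\<in>{1..n}. gen (LXs i) * gen (LX i))"
    by (intro finsum_cls) auto
  finally have sum: "(\<Oplus>\<^bsub>Pol_R q n\<^esub>i\<in>{1..n}. star (Pol_R q n) (x_R q n i) \<otimes>\<^bsub>Pol_R q n\<^esub> x_R q n i)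
      = cls q n (\<Sum>i\<in>{1..n}. gen (LXs i) * gen (LX i))" .
  have "(\<Sum>i\<in>{1..n}. gen (LXs i) * gen (LX i)) \<in> carrier (free_alg n)"
    by (intro free_carrier_sum) auto
  then show ?thesis
    unfolding sphere_ideal_def Let_def sum sphere_rel_def
    by (simp add: scale_cls y_R_eq cls_diff cls_mult cls_add del: of_real_power)
qed

lemma ideal_sphere_ideal: "ideal (sphere_ideal q n) (Pol_R q n)"
  unfolding sphere_ideal_eq
  by (rule ring.genideal_ideal[OF ring_Pol_R]) (use sphere_rel_closed in auto)

lemma ring_Pol_S: "ring (Pol_S q n)"
  unfolding Pol_S_def by (rule ring_quot_alg[OF ideal_sphere_ideal])

lemma proj_S_ring_hom: "proj_S q n \<in> Ring.ring_hom (Pol_R q n) (Pol_S q n)"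
proof -
  have "proj_S q n = (+>\<^bsub>Pol_R q n\<^esub>) (sphere_ideal q n)" by (simp add: proj_S_def fun_eq_iff)
  then show ?thesis
    using coset_ring_hom_quot_alg[OF ideal_sphere_ideal] by (simp add: Pol_S_def)
qed

lemma mat_trace_G_mat:
  assumes "n \<ge> 1"
  shows "mat_trace (Pol_S q n) (G_mat q n)
    = proj_S q n (cls q n (affine_y (2 ^ (n - 1)) (- ((1 - complex_of_real (q^2)) ^ n))))"
proof -
  interpret S: ring "Pol_S q n" by (rule ring_Pol_S)
  interpret R: ring "Pol_R q n" by (rule ring_Pol_R)
  obtain m where m: "n = Suc m" using assms by (cases n) auto
  let ?d = "\<lambda>j. affine_y (fst (diag_coeffs q n j)) (snd (diag_coeffs q n j))"
  have "mat_trace (Pol_S q n) (G_mat q n)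
      = (\<Oplus>\<^bsub>Pol_S q n\<^esub>j\<in>{..<2 ^ n}. proj_S q n (cls q n (?d j)))"
    unfolding mat_trace_def G_mat_def
    by (intro S.finsum_cong')
       (auto simp: e_mat_diag intro!: ring_hom_closed[OF proj_S_ring_hom])
  also have "\<dots> = proj_S q n (\<Oplus>\<^bsub>Pol_R q n\<^esub>j\<in>{..<2 ^ n}. cls q n (?d j))"
    by (rule ring_hom_finsum[OF ring_Pol_R ring_Pol_S proj_S_ring_hom, symmetric]) auto
  also have "(\<Oplus>\<^bsub>Pol_R q n\<^esub>j\<in>{..<2 ^ n}. cls q n (?d j)) = cls q n (\<Sum>j\<in>{..<2 ^ n}. ?d j)"
    by (intro finsum_cls) auto
  also have "(\<Sum>j\<in>{..<2 ^ n}. ?d j) = affine_y (2 ^ (n - 1)) (- ((1 - complex_of_real (q^2)) ^ n))"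
    unfolding sum_affine_y m using sum_diag_coeffs(1)[of q m] sum_diag_coeffs(2)[of q "Suc m"] by simp
  finally show ?thesis .
qed

text \<open>A homomorphism given on the generators may be evaluated on the sphere algebra by lifting to
  the free algebra, once it respects the relations.\<close>

lemma (in complex_algebra) sphere_hom_proj_S:
  assumes ab: "admissible n a b"
    and rels: "\<And>r. r \<in> euclid_rels q n \<Longrightarrow> free_hom A a b r = \<zero>"
      "\<And>r. r \<in> euclid_rels q n \<Longrightarrow> free_hom A a b (free_star r) = \<zero>"
    and sphere: "free_hom A a b (sphere_rel q n) = \<zero>"
    and f: "f \<in> carrier (free_alg n)"
  shows "sphere_hom A a b (proj_S q n (cls q n f)) = free_hom A a b f"
proof -
  let ?h = "free_hom A a b" let ?H = "descend ?h"
  note kill = free_hom_kills_euclid_ideal[OF ab rels]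
  have H_cls: "?H (cls q n g) = ?h g" if "g \<in> carrier (free_alg n)" for g
    unfolding cls_def
    by (rule descend_coset[OF ideal_euclid_ideal ring_axioms free_hom_ring_hom[OF ab] kill that])
  have H_hom: "?H \<in> Ring.ring_hom (Pol_R q n) A"
    unfolding Pol_R_def
    by (rule descend_ring_hom[OF ideal_euclid_ideal ring_axioms free_hom_ring_hom[OF ab] kill])
  have H_kill: "?H u = \<zero>" if "u \<in> sphere_ideal q n" for u
    by (rule ring_hom_kills_genideal[OF ring_Pol_R ring_axioms H_hom _ _ that[unfolded sphere_ideal_eq]])
       (use sphere_rel_closed H_cls sphere in auto)
  have "sphere_hom A a b (proj_S q n (cls q n f)) = ?H (cls q n f)"
    unfolding sphere_hom_def proj_S_def
    by (rule descend_coset[OF ideal_sphere_ideal ring_axioms H_hom H_kill]) (use f in auto)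
  then show ?thesis using H_cls[OF f] by simp
qed

section \<open>The character \<open>\<epsilon>\<close>\<close>

lemma complex_alg_simps [simp]:
  "carrier complex_alg = UNIV" "x \<otimes>\<^bsub>complex_alg\<^esub> y = x * y" "\<one>\<^bsub>complex_alg\<^esub> = 1"
  "\<zero>\<^bsub>complex_alg\<^esub> = 0" "x \<oplus>\<^bsub>complex_alg\<^esub> y = x + y" "scale complex_alg c x = c * x"
  "star complex_alg x = cnj x"
  by (simp_all add: complex_alg_def)

lemma complex_algebra_complex_alg: "complex_algebra complex_alg"
proof -
  interpret ring complex_alg
  proof (rule ringI)
    show "abelian_group complex_alg"
    proof (rule abelian_groupI)
      fix x :: complex
      show "\<exists>y\<in>carrier complex_alg. y \<oplus>\<^bsub>complex_alg\<^esub> x = \<zero>\<^bsub>complex_alg\<^esub>"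
        by (rule bexI[of _ "- x"]) auto
    qed (auto simp: algebra_simps)
    show "monoid complex_alg" by (rule monoidI) auto
  qed (auto simp: algebra_simps)
  show ?thesis by standard (auto simp: algebra_simps)
qed

text \<open>A nonempty word contains a letter, and every letter goes to \<open>0\<close>.\<close>

lemma eps_free_hom:
  assumes f: "f \<in> carrier (free_alg n)"
  shows "free_hom complex_alg (\<lambda>i. 0) 0 f = Poly_Mapping.lookup f 0"
proof -
  interpret complex_algebra complex_alg by (rule complex_algebra_complex_alg)
  have ab: "admissible n (\<lambda>i. 0) 0" by (simp add: admissible_def)
  from f show ?thesis
  proof (induction f rule: free_induct)
    case (single w c)
    have "letter_value complex_alg (\<lambda>i. 0) 0 l = 0" for l by (cases l) auto
    then have "alg_prod complex_alg (map (letter_value complex_alg (\<lambda>i. 0) 0) (letters w))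
        = (if w = 0 then 1 else 0)"
      by (cases "letters w") auto
    then show ?case by (simp add: free_hom_single[OF ab single] lookup_single when_def)
  qed (auto simp: free_hom_zero free_hom_add[OF ab] lookup_add)
qed

lemma homogeneous_lookup_zero: "\<lbrakk>homogeneous d f; d \<noteq> 0\<rbrakk> \<Longrightarrow> Poly_Mapping.lookup f 0 = 0"
  by (auto simp: homogeneous_def in_keys_iff)

lemma eps_char_proj_S:
  assumes f: "f \<in> carrier (free_alg n)"
  shows "eps_char (proj_S q n (cls q n f)) = Poly_Mapping.lookup f 0"
proof -
  interpret complex_algebra complex_alg by (rule complex_algebra_complex_alg)
  have ab: "admissible n (\<lambda>i. 0) 0" by (simp add: admissible_def)
  have hom: "homogeneous 2 (free_scale (complex_of_real (q^2)) (\<Sum>i\<in>{1..n}. gen (LXs i) * gen (LX i)))"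
    "homogeneous 2 (gen LY * gen LY)" "homogeneous 1 (gen LY)"
    by (auto intro!: homogeneous_scale homogeneous_sum homogeneous_gen_mult)
       (simp add: homogeneous_def gen_def)
  have "Poly_Mapping.lookup (sphere_rel q n) 0 = 0"
    unfolding sphere_rel_def lookup_add lookup_minus
    using homogeneous_lookup_zero[OF hom(1)] homogeneous_lookup_zero[OF hom(2)]
      homogeneous_lookup_zero[OF hom(3)] by simp
  then have sphere: "free_hom complex_alg (\<lambda>i. 0) 0 (sphere_rel q n) = 0"
    by (simp add: eps_free_hom[OF sphere_rel_closed])
  have rels: "free_hom complex_alg (\<lambda>i. 0) 0 r = 0" "free_hom complex_alg (\<lambda>i. 0) 0 (free_star r) = 0"
    if "r \<in> euclid_rels q n" for r
  proof -
    have r: "r \<in> carrier (free_alg n)" using that euclid_rels_closed by blast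
    show "free_hom complex_alg (\<lambda>i. 0) 0 r = 0"
      using eps_free_hom[OF r] homogeneous_lookup_zero[OF homogeneous_euclid_rels[OF that]] by simp
    show "free_hom complex_alg (\<lambda>i. 0) 0 (free_star r) = 0"
      using eps_free_hom[OF free_star_closed[OF r]]
        homogeneous_lookup_zero[OF homogeneous_star[OF homogeneous_euclid_rels[OF that]]] by simp
  qed
  have "eps_char (proj_S q n (cls q n f)) = free_hom complex_alg (\<lambda>i. 0) 0 f"
    unfolding eps_char_def by (rule sphere_hom_proj_S[OF ab _ _ _ f]) (use rels sphere in auto)
  then show ?thesis by (simp add: eps_free_hom[OF f])
qed

section \<open>Bounded operators on \<open>\<ell>\<^sup>2(I)\<close>\<close>

definition nsq :: "'i set \<Rightarrow> ('i \<Rightarrow> complex) \<Rightarrow> real" where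
  "nsq I \<psi> = (\<Sum>\<^sub>\<infinity>i\<in>I. (cmod (\<psi> i))\<^sup>2)"

lemma nsq_nonneg [simp]: "0 \<le> nsq I \<psi>"
  unfolding nsq_def by (rule infsum_nonneg) simp

lemma ell2_norm_eq: "ell2_norm I \<psi> = sqrt (nsq I \<psi>)"
  by (simp add: ell2_norm_def nsq_def)

lemma ell2_outside: "\<lbrakk>\<psi> \<in> ell2 I; k \<notin> I\<rbrakk> \<Longrightarrow> \<psi> k = 0"
  by (simp add: ell2_def)

lemma ell2_summable: "\<psi> \<in> ell2 I \<Longrightarrow> (\<lambda>i. (cmod (\<psi> i))\<^sup>2) summable_on I"
  by (simp add: ell2_def)

lemma cmod_add_squared: "(cmod (a + b))\<^sup>2 \<le> 2 * (cmod a)\<^sup>2 + 2 * (cmod b)\<^sup>2"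
proof -
  have "(cmod (a + b))\<^sup>2 \<le> (cmod a + cmod b)\<^sup>2"
    by (intro power_mono norm_triangle_ineq) auto
  also have "\<dots> \<le> 2 * (cmod a)\<^sup>2 + 2 * (cmod b)\<^sup>2"
    using sum_squares_bound[of "cmod a" "cmod b"] by (simp add: power2_sum)
  finally show ?thesis .
qed

lemma ell2_add_nsq:
  assumes a: "\<psi> \<in> ell2 I" and b: "\<chi> \<in> ell2 I"
  shows "(\<lambda>i. \<psi> i + \<chi> i) \<in> ell2 I"
    and "nsq I (\<lambda>i. \<psi> i + \<chi> i) \<le> 2 * nsq I \<psi> + 2 * nsq I \<chi>"
proof -
  have s: "(\<lambda>i. 2 * (cmod (\<psi> i))\<^sup>2) summable_on I" "(\<lambda>i. 2 * (cmod (\<chi> i))\<^sup>2) summable_on I"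
    using a b by (auto intro!: summable_on_cmult_right ell2_summable)
  have t: "(\<lambda>i. (cmod (\<psi> i + \<chi> i))\<^sup>2) summable_on I"
    by (rule summable_on_comparison_test[OF summable_on_add[OF s]]) (simp_all add: cmod_add_squared)
  then show "(\<lambda>i. \<psi> i + \<chi> i) \<in> ell2 I"
    using a b by (simp add: ell2_def)
  have "nsq I (\<lambda>i. \<psi> i + \<chi> i) \<le> (\<Sum>\<^sub>\<infinity>i\<in>I. 2 * (cmod (\<psi> i))\<^sup>2 + 2 * (cmod (\<chi> i))\<^sup>2)"
    unfolding nsq_def by (rule infsum_mono[OF t summable_on_add[OF s]]) (rule cmod_add_squared)
  also have "\<dots> = 2 * nsq I \<psi> + 2 * nsq I \<chi>"
    unfolding infsum_add[OF s] nsq_def by (simp add: infsum_cmult_right')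
  finally show "nsq I (\<lambda>i. \<psi> i + \<chi> i) \<le> 2 * nsq I \<psi> + 2 * nsq I \<chi>" .
qed

lemmas ell2_add [simp, intro] = ell2_add_nsq(1)

lemma ell2_scale [simp, intro]: "\<psi> \<in> ell2 I \<Longrightarrow> (\<lambda>i. c * \<psi> i) \<in> ell2 I"
  by (auto simp: ell2_def norm_mult power_mult_distrib intro!: summable_on_cmult_right)

lemma nsq_scale: "nsq I (\<lambda>i. c * \<psi> i) = (cmod c)\<^sup>2 * nsq I \<psi>"
  by (simp add: nsq_def norm_mult power_mult_distrib infsum_cmult_right')

lemma ell2_zero [simp, intro]: "(\<lambda>i. 0) \<in> ell2 I"
  by (simp add: ell2_def)

lemma nsq_zero [simp]: "nsq I (\<lambda>i. 0) = 0"
  by (simp add: nsq_def)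

lemma ell2_finite_support:
  assumes "finite F" "F \<subseteq> I" "\<And>i. i \<notin> F \<Longrightarrow> \<psi> i = 0"
  shows "\<psi> \<in> ell2 I"
proof -
  have "(\<lambda>i. (cmod (\<psi> i))\<^sup>2) summable_on I \<longleftrightarrow> (\<lambda>i. (cmod (\<psi> i))\<^sup>2) summable_on F"
    by (rule summable_on_cong_neutral) (use assms in auto)
  then show ?thesis using assms by (auto simp: ell2_def)
qed

lemma ket_ell2 [simp, intro]: "m \<in> I \<Longrightarrow> ket m \<in> ell2 I"
  by (rule ell2_finite_support[of "{m}"]) (auto simp: ket_def)

lemma ket_self [simp]: "ket m m = 1"
  by (simp add: ket_def)

lemma coord_le_nsq:
  assumes "\<psi> \<in> ell2 I" "k \<in> I" shows "(cmod (\<psi> k))\<^sup>2 \<le> nsq I \<psi>"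
  unfolding nsq_def using finite_sum_le_infsum[OF ell2_summable[OF assms(1)], of "{k}"] assms(2) by simp

lemma nsq_le_zeroD:
  assumes "\<psi> \<in> ell2 I" "nsq I \<psi> \<le> 0" shows "\<psi> = (\<lambda>i. 0)"
proof
  fix k show "\<psi> k = 0"
  proof (cases "k \<in> I")
    case True
    have "(cmod (\<psi> k))\<^sup>2 \<le> 0"
      using coord_le_nsq[OF assms(1) True] assms(2) by (rule order.trans)
    then show ?thesis by simp
  qed (rule ell2_outside[OF assms(1)])
qed

subsection \<open>The algebra of bounded operators\<close>

lemma bounded_opsI:
  assumes "T \<in> extensional (ell2 I)" "\<And>\<psi>. \<psi> \<in> ell2 I \<Longrightarrow> T \<psi> \<in> ell2 I"
    "\<And>\<psi> \<chi>. \<lbrakk>\<psi> \<in> ell2 I; \<chi> \<in> ell2 I\<rbrakk> \<Longrightarrow> T (\<lambda>i. \<psi> i + \<chi> i) = (\<lambda>i. T \<psi> i + T \<chi> i)"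
    "\<And>c \<psi>. \<psi> \<in> ell2 I \<Longrightarrow> T (\<lambda>i. c * \<psi> i) = (\<lambda>i. c * T \<psi> i)"
    "\<And>\<psi>. \<psi> \<in> ell2 I \<Longrightarrow> nsq I (T \<psi>) \<le> B * nsq I \<psi>"
  shows "T \<in> bounded_ops I"
proof -
  have "ell2_norm I (T \<psi>) \<le> sqrt B * ell2_norm I \<psi>" if "\<psi> \<in> ell2 I" for \<psi>
    using assms(5)[OF that] by (simp add: ell2_norm_eq flip: real_sqrt_mult)
  then show ?thesis
    using assms(1-4) by (auto simp: bounded_ops_def PiE_def)
qed

lemma bounded_ops_ext: "T \<in> bounded_ops I \<Longrightarrow> T \<in> extensional (ell2 I)"
  and bounded_ops_closed [simp]: "\<lbrakk>T \<in> bounded_ops I; \<psi> \<in> ell2 I\<rbrakk> \<Longrightarrow> T \<psi> \<in> ell2 I"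
  and bounded_ops_add: "\<lbrakk>T \<in> bounded_ops I; \<psi> \<in> ell2 I; \<chi> \<in> ell2 I\<rbrakk> \<Longrightarrow>
      T (\<lambda>i. \<psi> i + \<chi> i) = (\<lambda>i. T \<psi> i + T \<chi> i)"
  and bounded_ops_scale: "\<lbrakk>T \<in> bounded_ops I; \<psi> \<in> ell2 I\<rbrakk> \<Longrightarrow>
      T (\<lambda>i. c * \<psi> i) = (\<lambda>i. c * T \<psi> i)"
  by (auto simp: bounded_ops_def PiE_def)

lemma bounded_ops_bound:
  assumes "T \<in> bounded_ops I"
  obtains B where "0 \<le> B" "\<And>\<psi>. \<psi> \<in> ell2 I \<Longrightarrow> nsq I (T \<psi>) \<le> B * nsq I \<psi>"
proof -
  obtain B where B: "\<And>\<psi>. \<psi> \<in> ell2 I \<Longrightarrow> sqrt (nsq I (T \<psi>)) \<le> B * sqrt (nsq I \<psi>)"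
    using assms unfolding bounded_ops_def ell2_norm_eq by blast
  have "nsq I (T \<psi>) \<le> B\<^sup>2 * nsq I \<psi>" if "\<psi> \<in> ell2 I" for \<psi>
    using power_mono[OF B[OF that], of 2] by (simp add: power_mult_distrib)
  then show ?thesis using that[of "B\<^sup>2"] by simp
qed

lemma op_eqI:
  assumes "S \<in> bounded_ops I" "T \<in> bounded_ops I"
    and "\<And>\<psi> k. \<lbrakk>\<psi> \<in> ell2 I; k \<in> I\<rbrakk> \<Longrightarrow> S \<psi> k = T \<psi> k"
  shows "S = T"
proof (rule extensionalityI[OF bounded_ops_ext[OF assms(1)] bounded_ops_ext[OF assms(2)]])
  fix \<psi> assume \<psi>: "\<psi> \<in> ell2 I"
  show "S \<psi> = T \<psi>"
  proof
    fix k show "S \<psi> k = T \<psi> k"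
      using assms(3)[OF \<psi>, of k] ell2_outside[OF bounded_ops_closed[OF assms(1) \<psi>], of k]
        ell2_outside[OF bounded_ops_closed[OF assms(2) \<psi>], of k] by (cases "k \<in> I") auto
  qed
qed

lemma carrier_op_alg [simp]: "carrier (op_alg I) = bounded_ops I"
  and star_op_alg [simp]: "star (op_alg I) = adjoint_op I"
  by (simp_all add: op_alg_def)

lemma op_alg_apply [simp]:
  assumes "\<psi> \<in> ell2 I"
  shows "(S \<otimes>\<^bsub>op_alg I\<^esub> T) \<psi> = S (T \<psi>)" "\<one>\<^bsub>op_alg I\<^esub> \<psi> = \<psi>"
    "\<zero>\<^bsub>op_alg I\<^esub> \<psi> = (\<lambda>i. 0)" "(S \<oplus>\<^bsub>op_alg I\<^esub> T) \<psi> = (\<lambda>i. S \<psi> i + T \<psi> i)"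
    "scale (op_alg I) c T \<psi> = (\<lambda>i. c * T \<psi> i)"
  using assms by (simp_all add: op_alg_def compose_def)

lemma op_alg_ext:
  "S \<otimes>\<^bsub>op_alg I\<^esub> T \<in> extensional (ell2 I)" "\<one>\<^bsub>op_alg I\<^esub> \<in> extensional (ell2 I)"
  "\<zero>\<^bsub>op_alg I\<^esub> \<in> extensional (ell2 I)" "S \<oplus>\<^bsub>op_alg I\<^esub> T \<in> extensional (ell2 I)"
  "scale (op_alg I) c T \<in> extensional (ell2 I)"
  by (simp_all add: op_alg_def)

lemma op_mult_closed [simp, intro]:
  assumes S: "S \<in> bounded_ops I" and T: "T \<in> bounded_ops I"
  shows "S \<otimes>\<^bsub>op_alg I\<^esub> T \<in> bounded_ops I"
proof -
  obtain A where A: "0 \<le> A" "\<And>\<psi>. \<psi> \<in> ell2 I \<Longrightarrow> nsq I (S \<psi>) \<le> A * nsq I \<psi>"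
    by (rule bounded_ops_bound[OF S]) blast
  obtain B where B: "0 \<le> B" "\<And>\<psi>. \<psi> \<in> ell2 I \<Longrightarrow> nsq I (T \<psi>) \<le> B * nsq I \<psi>"
    by (rule bounded_ops_bound[OF T]) blast
  show ?thesis
  proof (rule bounded_opsI[where B = "A * B"])
    fix \<psi> assume \<psi>: "\<psi> \<in> ell2 I"
    have "nsq I (S (T \<psi>)) \<le> A * nsq I (T \<psi>)" using A(2) T \<psi> by simp
    also have "\<dots> \<le> A * (B * nsq I \<psi>)" by (rule mult_left_mono[OF B(2)[OF \<psi>] A(1)])
    finally show "nsq I ((S \<otimes>\<^bsub>op_alg I\<^esub> T) \<psi>) \<le> A * B * nsq I \<psi>" using \<psi> by (simp add: mult.assoc)
  qed (use S T in \<open>simp_all add: op_alg_ext bounded_ops_add bounded_ops_scale\<close>)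
qed

lemma op_add_closed [simp, intro]:
  assumes S: "S \<in> bounded_ops I" and T: "T \<in> bounded_ops I"
  shows "S \<oplus>\<^bsub>op_alg I\<^esub> T \<in> bounded_ops I"
proof -
  obtain A where A: "0 \<le> A" "\<And>\<psi>. \<psi> \<in> ell2 I \<Longrightarrow> nsq I (S \<psi>) \<le> A * nsq I \<psi>"
    by (rule bounded_ops_bound[OF S]) blast
  obtain B where B: "0 \<le> B" "\<And>\<psi>. \<psi> \<in> ell2 I \<Longrightarrow> nsq I (T \<psi>) \<le> B * nsq I \<psi>"
    by (rule bounded_ops_bound[OF T]) blast
  show ?thesis
  proof (rule bounded_opsI[where B = "2 * A + 2 * B"])
    fix \<psi> assume \<psi>: "\<psi> \<in> ell2 I"
    then show "nsq I ((S \<oplus>\<^bsub>op_alg I\<^esub> T) \<psi>) \<le> (2 * A + 2 * B) * nsq I \<psi>"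
      using ell2_add_nsq(2)[of "S \<psi>" I "T \<psi>"] A(2)[OF \<psi>] B(2)[OF \<psi>] S T
      by (simp add: algebra_simps)
  qed (use S T in \<open>simp_all add: op_alg_ext bounded_ops_add bounded_ops_scale algebra_simps\<close>)
qed

lemma op_scale_closed [simp, intro]:
  assumes T: "T \<in> bounded_ops I" shows "scale (op_alg I) c T \<in> bounded_ops I"
proof -
  obtain B where B: "0 \<le> B" "\<And>\<psi>. \<psi> \<in> ell2 I \<Longrightarrow> nsq I (T \<psi>) \<le> B * nsq I \<psi>"
    by (rule bounded_ops_bound[OF T]) blast
  show ?thesis
  proof (rule bounded_opsI[where B = "(cmod c)\<^sup>2 * B"])
    fix \<psi> assume \<psi>: "\<psi> \<in> ell2 I"
    then show "nsq I (scale (op_alg I) c T \<psi>) \<le> (cmod c)\<^sup>2 * B * nsq I \<psi>"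
      using mult_left_mono[OF B(2)[OF \<psi>], of "(cmod c)\<^sup>2"] by (simp add: nsq_scale mult.assoc)
  qed (use T in \<open>simp_all add: op_alg_ext bounded_ops_add bounded_ops_scale algebra_simps\<close>)
qed

lemma op_one_closed [simp, intro]: "\<one>\<^bsub>op_alg I\<^esub> \<in> bounded_ops I"
  by (rule bounded_opsI[where B = 1]) (simp_all add: op_alg_ext)

lemma op_zero_closed [simp, intro]: "\<zero>\<^bsub>op_alg I\<^esub> \<in> bounded_ops I"
  by (rule bounded_opsI[where B = 0]) (simp_all add: op_alg_ext)

lemma complex_algebra_op_alg: "complex_algebra (op_alg I)"
proof -
  interpret ring "op_alg I"
  proof (rule ringI)
    show "abelian_group (op_alg I)"
    proof (rule abelian_groupI)
      fix T assume "T \<in> carrier (op_alg I)"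
      then show "\<exists>S\<in>carrier (op_alg I). S \<oplus>\<^bsub>op_alg I\<^esub> T = \<zero>\<^bsub>op_alg I\<^esub>"
        by (intro bexI[of _ "scale (op_alg I) (-1) T"]) (auto intro!: op_eqI[of _ I])
    qed (auto intro!: op_eqI[of _ I] simp: algebra_simps)
    show "monoid (op_alg I)"
      by (rule monoidI) (auto intro!: op_eqI[of _ I])
  qed (auto intro!: op_eqI[of _ I] simp: bounded_ops_add)
  show ?thesis
    by standard (auto intro!: op_eqI[of _ I] simp: algebra_simps bounded_ops_scale)
qed

lemma finsum_op_alg_apply:
  assumes "finite X" "\<And>x. x \<in> X \<Longrightarrow> f x \<in> bounded_ops I" "\<psi> \<in> ell2 I"
  shows "(\<Oplus>\<^bsub>op_alg I\<^esub>x\<in>X. f x) \<psi> k = (\<Sum>x\<in>X. f x \<psi> k)"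
proof -
  interpret complex_algebra "op_alg I" by (rule complex_algebra_op_alg)
  show ?thesis using assms(1,2)
  proof (induction X rule: finite_induct)
    case (insert x X)
    have "(\<Oplus>\<^bsub>op_alg I\<^esub>x\<in>insert x X. f x) = f x \<oplus>\<^bsub>op_alg I\<^esub> (\<Oplus>\<^bsub>op_alg I\<^esub>x\<in>X. f x)"
      using insert by (intro finsum_insert) auto
    then show ?case using insert assms(3) by simp
  qed (use assms(3) in simp)
qed

text \<open>The finitely supported vectors are dense, so a bounded operator is determined by its values
  on the basis.\<close>

lemma op_zero_if_zero_on_basis:
  assumes D: "D \<in> bounded_ops I" and zero: "\<And>m. m \<in> I \<Longrightarrow> D (ket m) = (\<lambda>i. 0)"
    and \<psi>: "\<psi> \<in> ell2 I"
  shows "D \<psi> = (\<lambda>i. 0)"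
proof -
  obtain B where B: "0 \<le> B" "\<And>\<psi>. \<psi> \<in> ell2 I \<Longrightarrow> nsq I (D \<psi>) \<le> B * nsq I \<psi>"
    by (rule bounded_ops_bound[OF D]) blast
  \<comment> \<open>The tail of \<open>\<psi>\<close> outside a finite set \<open>F\<close> has the same image and arbitrarily small norm.\<close>
  define tl where "tl = (\<lambda>F i. if i \<in> F then 0 else \<psi> i)"
  have sub: "(\<lambda>i. (cmod (\<psi> i))\<^sup>2) summable_on J" if "J \<subseteq> I" for J
    using summable_on_subset_banach[OF ell2_summable[OF \<psi>] that] .
  have tl_ell2: "tl F \<in> ell2 I" for F
  proof -
    have "(\<lambda>i. (cmod (tl F i))\<^sup>2) summable_on I"
      by (rule summable_on_comparison_test[OF ell2_summable[OF \<psi>]]) (auto simp: tl_def)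
    then show ?thesis using \<psi> by (auto simp: ell2_def tl_def)
  qed
  have D_tl: "D (tl F) = D \<psi>" if "finite F" "F \<subseteq> I" for F
    using that
  proof (induction F rule: finite_induct)
    case empty
    then show ?case by (simp add: tl_def)
  next
    case (insert m F)
    have "tl F = (\<lambda>i. tl (insert m F) i + \<psi> m * ket m i)"
      using insert.hyps by (auto simp: tl_def ket_def fun_eq_iff)
    then have "D (tl F) = (\<lambda>i. D (tl (insert m F)) i + D (\<lambda>i. \<psi> m * ket m i) i)"
      using bounded_ops_add[OF D tl_ell2[of "insert m F"], of "\<lambda>i. \<psi> m * ket m i"] insert.prems by simp
    then show ?case
      using insert bounded_ops_scale[OF D, of "ket m" "\<psi> m"] zero[of m] by simp
  qed
  have tail: "nsq I (tl F) = nsq I \<psi> - (\<Sum>i\<in>F. (cmod (\<psi> i))\<^sup>2)" if F: "finite F" "F \<subseteq> I" for F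
  proof -
    have "nsq I (tl F) = (\<Sum>\<^sub>\<infinity>i\<in>I - F. (cmod (\<psi> i))\<^sup>2)"
      unfolding nsq_def by (rule infsum_cong_neutral) (auto simp: tl_def)
    also have "\<dots> = nsq I \<psi> - (\<Sum>\<^sub>\<infinity>i\<in>F. (cmod (\<psi> i))\<^sup>2)"
      unfolding nsq_def by (rule infsum_Diff[OF ell2_summable[OF \<psi>] sub]) (use F in auto)
    finally show ?thesis using F by simp
  qed
  have "nsq I (D \<psi>) \<le> B * e" if "e > 0" for e
  proof -
    obtain F where F: "finite F" "F \<subseteq> I" "dist (\<Sum>i\<in>F. (cmod (\<psi> i))\<^sup>2) (nsq I \<psi>) \<le> e"
      using infsum_finite_approximation[OF ell2_summable[OF \<psi>] \<open>e > 0\<close>] by (auto simp: nsq_def)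
    have "nsq I (D \<psi>) \<le> B * nsq I (tl F)"
      using B(2)[OF tl_ell2[of F]] D_tl[OF F(1,2)] by simp
    also have "\<dots> \<le> B * e"
      by (rule mult_left_mono[OF _ B(1)]) (use tail[OF F(1,2)] F(3) in \<open>simp add: dist_real_def\<close>)
    finally show ?thesis .
  qed
  note small = this
  have "nsq I (D \<psi>) \<le> 0 + e" if e: "e > 0" for e
  proof -
    have "nsq I (D \<psi>) \<le> B * (e / (B + 1))" by (rule small) (use e B(1) in simp)
    also have "\<dots> \<le> e" using e B(1) by (simp add: field_simps)
    finally show ?thesis by simp
  qed
  then have "nsq I (D \<psi>) \<le> 0" by (rule field_le_epsilon)
  then show ?thesis by (rule nsq_le_zeroD[OF bounded_ops_closed[OF D \<psi>]])
qed

lemma op_eq_on_basis: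
  assumes S: "S \<in> bounded_ops I" and T: "T \<in> bounded_ops I"
    and eq: "\<And>m. m \<in> I \<Longrightarrow> S (ket m) = T (ket m)"
  shows "S = T"
proof (rule op_eqI[OF S T])
  fix \<psi> k assume \<psi>: "\<psi> \<in> ell2 I"
  let ?D = "S \<oplus>\<^bsub>op_alg I\<^esub> scale (op_alg I) (-1) T"
  have "?D \<psi> = (\<lambda>i. 0)"
    by (rule op_zero_if_zero_on_basis[OF _ _ \<psi>]) (use S T eq in auto)
  then show "S \<psi> k = T \<psi> k" using \<psi> by (simp add: fun_eq_iff)
qed

lemma op_on_basis_eq:
  assumes T: "T \<in> bounded_ops I" and v: "\<And>m. m \<in> I \<Longrightarrow> T (ket m) = v m"
  shows "op_on_basis I v = T"
  unfolding op_on_basis_def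
proof (rule the_equality)
  fix S assume "S \<in> bounded_ops I \<and> (\<forall>m\<in>I. S (ket m) = v m)"
  then show "S = T" using v by (intro op_eq_on_basis[OF _ T]) auto
qed (use T v in auto)

subsection \<open>Adjoints\<close>

lemma ip_summable:
  assumes "\<psi> \<in> ell2 I" "\<chi> \<in> ell2 I" shows "(\<lambda>i. cnj (\<psi> i) * \<chi> i) summable_on I"
proof (rule abs_summable_summable)
  show "(\<lambda>i. cnj (\<psi> i) * \<chi> i) abs_summable_on I"
  proof (rule summable_on_comparison_test)
    show "(\<lambda>i. (cmod (\<psi> i))\<^sup>2 + (cmod (\<chi> i))\<^sup>2) summable_on I"
      using assms by (intro summable_on_add ell2_summable)
    show "norm (cnj (\<psi> i) * \<chi> i) \<le> (cmod (\<psi> i))\<^sup>2 + (cmod (\<chi> i))\<^sup>2" for i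
    proof -
      have "2 * (cmod (\<psi> i) * cmod (\<chi> i)) \<le> (cmod (\<psi> i))\<^sup>2 + (cmod (\<chi> i))\<^sup>2"
        using sum_squares_bound[of "cmod (\<psi> i)" "cmod (\<chi> i)"] by simp
      moreover have "0 \<le> cmod (\<psi> i) * cmod (\<chi> i)" by simp
      ultimately show ?thesis unfolding norm_mult complex_mod_cnj by linarith
    qed
  qed simp
qed

lemma ip_add_left:
  "\<lbrakk>\<psi> \<in> ell2 I; \<psi>' \<in> ell2 I; \<chi> \<in> ell2 I\<rbrakk> \<Longrightarrow> ip I (\<lambda>i. \<psi> i + \<psi>' i) \<chi> = ip I \<psi> \<chi> + ip I \<psi>' \<chi>"
  by (simp add: ip_def distrib_right infsum_add ip_summable)

lemma ip_add_right:
  "\<lbrakk>\<psi> \<in> ell2 I; \<chi> \<in> ell2 I; \<chi>' \<in> ell2 I\<rbrakk> \<Longrightarrow> ip I \<psi> (\<lambda>i. \<chi> i + \<chi>' i) = ip I \<psi> \<chi> + ip I \<psi> \<chi>'"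
  by (simp add: ip_def distrib_left infsum_add ip_summable)

lemma ip_scale_left: "ip I (\<lambda>i. c * \<psi> i) \<chi> = cnj c * ip I \<psi> \<chi>"
  by (simp add: ip_def mult.assoc infsum_cmult_right')

lemma ip_scale_right: "ip I \<psi> (\<lambda>i. c * \<chi> i) = c * ip I \<psi> \<chi>"
  by (simp add: ip_def mult.left_commute[of _ c] infsum_cmult_right')

lemma ip_ket_left: "m \<in> I \<Longrightarrow> ip I (ket m) \<chi> = \<chi> m"
proof -
  assume m: "m \<in> I"
  have "ip I (ket m) \<chi> = (\<Sum>\<^sub>\<infinity>i\<in>{m}. \<chi> i)"
    unfolding ip_def by (rule infsum_cong_neutral) (use m in \<open>auto simp: ket_def\<close>)
  then show ?thesis by simp
qed

lemma ip_ket_right: "m \<in> I \<Longrightarrow> ip I \<psi> (ket m) = cnj (\<psi> m)"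
proof -
  assume m: "m \<in> I"
  have "ip I \<psi> (ket m) = (\<Sum>\<^sub>\<infinity>i\<in>{m}. cnj (\<psi> i))"
    unfolding ip_def by (rule infsum_cong_neutral) (use m in \<open>auto simp: ket_def\<close>)
  then show ?thesis by simp
qed

lemma ip_weighted_self:
  "ip I \<psi> (\<lambda>i. complex_of_real (r i) * \<psi> i) = complex_of_real (\<Sum>\<^sub>\<infinity>i\<in>I. r i * (cmod (\<psi> i))\<^sup>2)"
proof -
  have self: "cnj (\<psi> i) * (complex_of_real (r i) * \<psi> i) = complex_of_real (r i * (cmod (\<psi> i))\<^sup>2)" for i
    using complex_norm_square[of "\<psi> i"] by (simp add: mult.left_commute mult.commute)
  have infsum_of_real: "(\<Sum>\<^sub>\<infinity>i\<in>I. complex_of_real (f i)) = complex_of_real (\<Sum>\<^sub>\<infinity>i\<in>I. f i)" for f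
  proof (cases "f summable_on I")
    case True
    then show ?thesis by (intro infsumI has_sum_of_real has_sum_infsum)
  next
    case False
    have "\<not> (\<lambda>i. complex_of_real (f i)) summable_on I"
      using False summable_on_Re[of "\<lambda>i. complex_of_real (f i)" I] by auto
    then show ?thesis using False by (simp add: infsum_not_exists)
  qed
  show ?thesis unfolding ip_def self infsum_of_real ..
qed

text \<open>Adjointness as a relation makes it compatible with sums and products without first
  constructing adjoints of arbitrary bounded operators.\<close>

definition adjoint_pair :: "'i set \<Rightarrow> 'i oper \<Rightarrow> 'i oper \<Rightarrow> bool" where
  "adjoint_pair I S T \<longleftrightarrow> (\<forall>\<psi>\<in>ell2 I. \<forall>\<chi>\<in>ell2 I. ip I (S \<psi>) \<chi> = ip I \<psi> (T \<chi>))"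

lemma adjoint_pair_unique:
  assumes "S \<in> bounded_ops I" "S' \<in> bounded_ops I" "adjoint_pair I S T" "adjoint_pair I S' T"
  shows "S = S'"
proof (rule op_eqI[OF assms(1,2)])
  fix \<psi> k assume "\<psi> \<in> ell2 I" "k \<in> I"
  then have "ip I (S \<psi>) (ket k) = ip I (S' \<psi>) (ket k)"
    using assms(3,4) by (simp add: adjoint_pair_def)
  then show "S \<psi> k = S' \<psi> k" using \<open>k \<in> I\<close> by (simp add: ip_ket_right)
qed

lemma adjoint_op_eq:
  assumes "S \<in> bounded_ops I" "adjoint_pair I S T" shows "adjoint_op I T = S"
  unfolding adjoint_op_def adjoint_pair_def[symmetric]
  by (rule the_equality) (use assms adjoint_pair_unique in auto)

text \<open>If the letters are represented compatibly with the involution, then so is the whole free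
  algebra; hence the adjoint of a relation that holds also holds.\<close>

lemma free_hom_adjoint_pair:
  fixes I :: "'i set" and a b n
  defines "h \<equiv> free_hom (op_alg I) a b"
  assumes ab: "complex_algebra.admissible (op_alg I) n a b"
    and letters: "\<And>l. l \<in> letters_upto n \<Longrightarrow> adjoint_pair I
       (letter_value (op_alg I) a b (star_letter l)) (letter_value (op_alg I) a b l)"
    and f: "f \<in> carrier (free_alg n)"
  shows "adjoint_pair I (h (free_star f)) (h f)"
proof -
  interpret complex_algebra "op_alg I" by (rule complex_algebra_op_alg)
  let ?lv = "letter_value (op_alg I) a b"
  have lv: "?lv l \<in> bounded_ops I" if "l \<in> letters_upto n" for l
    using ab that by (auto simp: admissible_def)
  have closed: "alg_prod (op_alg I) (map ?lv ls) \<in> bounded_ops I" if "set ls \<subseteq> letters_upto n" for ls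
    using alg_prod_closed[of "map ?lv ls"] lv that by auto
  have word: "adjoint_pair I (alg_prod (op_alg I) (map ?lv (rev (map star_letter ls))))
      (alg_prod (op_alg I) (map ?lv ls))" if "set ls \<subseteq> letters_upto n" for ls
    using that
  proof (induction ls)
    case Nil
    then show ?case by (simp add: adjoint_pair_def)
  next
    case (Cons l ls)
    let ?P = "alg_prod (op_alg I) (map ?lv (rev (map star_letter ls)))"
    let ?Q = "alg_prod (op_alg I) (map ?lv ls)"
    have starred: "set (rev (map star_letter ls)) \<subseteq> letters_upto n"
      using Cons.prems by (auto simp: subset_iff)
    have cl: "?P \<in> bounded_ops I" "?Q \<in> bounded_ops I" "?lv l \<in> bounded_ops I" "?lv (star_letter l) \<in> bounded_ops I"
      using Cons.prems closed[OF starred] closed[of ls] lv[of l] lv[of "star_letter l"] by auto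
    have "alg_prod (op_alg I) (map ?lv (rev (map star_letter (l # ls))))
        = ?P \<otimes>\<^bsub>op_alg I\<^esub> ?lv (star_letter l)"
      using starred cl(4) lv
        alg_prod_append[of "map ?lv (rev (map star_letter ls))" "[?lv (star_letter l)]"]
      by (auto simp: subset_iff)
    then show ?case
      using Cons cl letters[of l] unfolding adjoint_pair_def by simp
  qed
  have hc: "h g \<in> bounded_ops I" if "g \<in> carrier (free_alg n)" for g
    using free_hom_closed[OF ab that] by (simp add: h_def)
  from f show ?thesis
  proof (induction f rule: free_induct)
    case zero
    show ?case by (simp add: h_def free_hom_zero adjoint_pair_def ip_def)
  next
    case (single w c)
    have *: "set (letters (star_word w)) \<subseteq> letters_upto n" using single by auto
    show ?case
      using word[OF single]
      unfolding h_def free_star_single free_hom_single[OF ab *] free_hom_single[OF ab single]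
      by (simp add: adjoint_pair_def ip_scale_left ip_scale_right)
  next
    case (add f g)
    have "h (free_star (f + g)) = h (free_star f) \<oplus>\<^bsub>op_alg I\<^esub> h (free_star g)"
      "h (f + g) = h f \<oplus>\<^bsub>op_alg I\<^esub> h g"
      using add.hyps unfolding h_def by (simp_all add: free_hom_add[OF ab])
    then show ?case
      using add hc by (simp add: adjoint_pair_def ip_add_left ip_add_right)
  qed
qed

subsection \<open>Weighted shifts\<close>

text \<open>All operators of the representation move each basis vector to a multiple of another one. In
  terms of functions on \<open>I\<close> such an operator pulls back along \<open>g\<close>, in the direction opposite to
  the motion of the basis vectors; injectivity of \<open>g\<close> where the weight does not vanish makes it
  bounded.\<close>

definition wshift :: "'i set \<Rightarrow> ('i \<Rightarrow> complex) \<Rightarrow> ('i \<Rightarrow> 'i) \<Rightarrow> 'i oper" where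
  "wshift I w g = restrict (\<lambda>\<psi> k. if k \<in> I then w k * \<psi> (g k) else 0) (ell2 I)"

definition wshift_ok :: "'i set \<Rightarrow> ('i \<Rightarrow> complex) \<Rightarrow> ('i \<Rightarrow> 'i) \<Rightarrow> bool" where
  "wshift_ok I w g \<longleftrightarrow> g ` {k\<in>I. w k \<noteq> 0} \<subseteq> I \<and> inj_on g {k\<in>I. w k \<noteq> 0}
     \<and> (\<exists>B. \<forall>k\<in>I. cmod (w k) \<le> B)"

lemma wshift_apply [simp]:
  "\<psi> \<in> ell2 I \<Longrightarrow> wshift I w g \<psi> = (\<lambda>k. if k \<in> I then w k * \<psi> (g k) else 0)"
  by (simp add: wshift_def)

lemma wshift_bounded:
  assumes "wshift_ok I w g" shows "wshift I w g \<in> bounded_ops I"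
proof -
  let ?K = "{k\<in>I. w k \<noteq> 0}"
  obtain B where B: "\<And>k. k \<in> I \<Longrightarrow> cmod (w k) \<le> B"
    using assms by (auto simp: wshift_ok_def)
  have K: "g ` ?K \<subseteq> I" "inj_on g ?K" using assms by (auto simp: wshift_ok_def)
  have *: "(\<lambda>k. (cmod (wshift I w g \<psi> k))\<^sup>2) summable_on I
      \<and> nsq I (wshift I w g \<psi>) \<le> B\<^sup>2 * nsq I \<psi>" if \<psi>: "\<psi> \<in> ell2 I" for \<psi>
  proof -
    let ?s = "\<lambda>i. (cmod (\<psi> i))\<^sup>2"
    have image: "?s summable_on g ` ?K"
      using summable_on_subset_banach[OF ell2_summable[OF \<psi>] K(1)] .
    then have g: "(\<lambda>k. B\<^sup>2 * ?s (g k)) summable_on ?K"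
      using summable_on_reindex[OF K(2), of ?s] by (auto simp: comp_def intro: summable_on_cmult_right)
    have le: "(cmod (w k * \<psi> (g k)))\<^sup>2 \<le> B\<^sup>2 * ?s (g k)" if "k \<in> I" for k
      using power_mono[OF B[OF that], of 2] by (simp add: norm_mult power_mult_distrib mult_right_mono)
    have s: "(\<lambda>k. (cmod (w k * \<psi> (g k)))\<^sup>2) summable_on ?K"
      by (rule summable_on_comparison_test[OF g]) (use le in auto)
    have "(\<lambda>k. (cmod (wshift I w g \<psi> k))\<^sup>2) summable_on I
        \<longleftrightarrow> (\<lambda>k. (cmod (w k * \<psi> (g k)))\<^sup>2) summable_on ?K"
      by (rule summable_on_cong_neutral) (use \<psi> in auto)
    moreover have "nsq I (wshift I w g \<psi>) = (\<Sum>\<^sub>\<infinity>k\<in>?K. (cmod (w k * \<psi> (g k)))\<^sup>2)"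
      unfolding nsq_def by (rule infsum_cong_neutral) (use \<psi> in auto)
    moreover have "\<dots> \<le> (\<Sum>\<^sub>\<infinity>k\<in>?K. B\<^sup>2 * ?s (g k))"
      by (rule infsum_mono[OF s g]) (use le in auto)
    moreover have "\<dots> = B\<^sup>2 * infsum ?s (g ` ?K)"
      using infsum_reindex[OF K(2), of ?s] by (simp add: infsum_cmult_right' comp_def)
    moreover have "infsum ?s (g ` ?K) \<le> nsq I \<psi>"
      unfolding nsq_def by (rule infsum_mono_neutral[OF image ell2_summable[OF \<psi>]]) (use K in auto)
    then have "B\<^sup>2 * infsum ?s (g ` ?K) \<le> B\<^sup>2 * nsq I \<psi>" by (rule mult_left_mono) simp
    ultimately show ?thesis using s by linarith
  qed
  show ?thesis
  proof (rule bounded_opsI[where B = "B\<^sup>2"])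
    show "wshift I w g \<in> extensional (ell2 I)" by (simp add: wshift_def)
    show "wshift I w g \<psi> \<in> ell2 I" if "\<psi> \<in> ell2 I" for \<psi>
      using *[OF that] that by (simp add: ell2_def[of I])
  qed (use * in \<open>auto simp: fun_eq_iff algebra_simps\<close>)
qed

lemma wshift_ket:
  "m \<in> I \<Longrightarrow> wshift I w g (ket m) = (\<lambda>k. if k \<in> I \<and> g k = m then w k else 0)"
  by (subst wshift_apply[OF ket_ell2]) (auto simp: ket_def)

lemma adjoint_pair_wshift:
  assumes ok: "wshift_ok I w g" and ok': "wshift_ok I w' g'"
    and inv: "\<And>k. \<lbrakk>k \<in> I; w k \<noteq> 0\<rbrakk> \<Longrightarrow> w' (g k) = cnj (w k) \<and> g' (g k) = k"
      "\<And>k. \<lbrakk>k \<in> I; w' k \<noteq> 0\<rbrakk> \<Longrightarrow> w (g' k) = cnj (w' k) \<and> g (g' k) = k"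
  shows "adjoint_pair I (wshift I w g) (wshift I w' g')"
  unfolding adjoint_pair_def
proof (intro ballI)
  fix \<psi> \<chi> assume \<psi>: "\<psi> \<in> ell2 I" and \<chi>: "\<chi> \<in> ell2 I"
  let ?K = "{k\<in>I. w k \<noteq> 0}" and ?K' = "{k\<in>I. w' k \<noteq> 0}"
  let ?F = "\<lambda>l. cnj (\<psi> l) * (w' l * \<chi> (g' l))"
  have bij: "bij_betw g ?K ?K'"
    by (rule bij_betw_byWitness[where f' = g']) (use ok ok' inv in \<open>auto simp: wshift_ok_def\<close>)
  have "ip I (wshift I w g \<psi>) \<chi> = (\<Sum>\<^sub>\<infinity>k\<in>?K. ?F (g k))"
    unfolding ip_def by (rule infsum_cong_neutral) (use \<psi> inv(1) in auto)
  also have "\<dots> = (\<Sum>\<^sub>\<infinity>l\<in>?K'. ?F l)"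
    by (rule infsum_reindex_bij_betw[OF bij])
  also have "\<dots> = ip I \<psi> (wshift I w' g' \<chi>)"
    unfolding ip_def by (rule infsum_cong_neutral) (use \<chi> in auto)
  finally show "ip I (wshift I w g \<psi>) \<chi> = ip I \<psi> (wshift I w' g' \<chi>)" .
qed

abbreviation diag_op :: "'i set \<Rightarrow> ('i \<Rightarrow> complex) \<Rightarrow> 'i oper" where
  "diag_op I w \<equiv> wshift I w (\<lambda>k. k)"

lemma diag_ok: "(\<And>k. k \<in> I \<Longrightarrow> cmod (w k) \<le> B) \<Longrightarrow> wshift_ok I w (\<lambda>k. k)"
  by (auto simp: wshift_ok_def)

lemma diag_mult:
  assumes "wshift_ok I w (\<lambda>k. k)"
  shows "diag_op I v \<otimes>\<^bsub>op_alg I\<^esub> diag_op I w = diag_op I (\<lambda>k. v k * w k)"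
proof (rule extensionalityI[of _ "ell2 I"])
  fix \<psi> assume \<psi>: "\<psi> \<in> ell2 I"
  then have "diag_op I w \<psi> \<in> ell2 I" using wshift_bounded[OF assms] by (rule bounded_ops_closed[rotated])
  then show "(diag_op I v \<otimes>\<^bsub>op_alg I\<^esub> diag_op I w) \<psi> = diag_op I (\<lambda>k. v k * w k) \<psi>"
    using \<psi> by (auto simp: fun_eq_iff)
qed (simp_all add: op_alg_ext wshift_def)

text \<open>If \<open>S \<ge> 0\<close> and \<open>S\<^sup>2\<close> is diagonal with entries \<open>r\<^sub>j\<^sup>2 > 0\<close>, then \<open>\<psi> = (S - r\<^sub>j)|j\<rangle>\<close> satisfies
  \<open>S\<psi> = - r\<^sub>j\<psi>\<close>, which positivity of \<open>S\<close> only permits for \<open>\<psi> = 0\<close>.\<close>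

lemma pos_sqrt_op_diag:
  assumes r: "\<And>k. k \<in> I \<Longrightarrow> 0 < r k" and B: "\<And>k. k \<in> I \<Longrightarrow> r k \<le> B"
  shows "pos_sqrt_op I (diag_op I (\<lambda>k. complex_of_real ((r k)\<^sup>2)))
    = diag_op I (\<lambda>k. complex_of_real (r k))" (is "pos_sqrt_op I ?D = ?R")
  unfolding pos_sqrt_op_def
proof (rule the_equality)
  have ok: "wshift_ok I (\<lambda>k. complex_of_real (r k)) (\<lambda>k. k)"
    using B r by (intro diag_ok[of _ _ B]) (simp add: less_imp_le)
  have R: "?R \<in> bounded_ops I" by (rule wshift_bounded[OF ok])
  have "ip I \<psi> (?R \<psi>) \<in> \<real>\<^sub>\<ge>\<^sub>0" if \<psi>: "\<psi> \<in> ell2 I" for \<psi>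
  proof -
    have "ip I \<psi> (?R \<psi>) = ip I \<psi> (\<lambda>i. complex_of_real (r i) * \<psi> i)"
      unfolding ip_def by (rule infsum_cong) (use \<psi> in simp)
    then show ?thesis
      unfolding ip_weighted_self
      using r by (auto simp: complex_nonneg_Reals_iff less_imp_le intro!: infsum_nonneg)
  qed
  then have "positive_op I ?R" using R by (simp add: positive_op_def)
  moreover have "compose (ell2 I) ?R ?R = ?D"
    using diag_mult[OF ok, of "\<lambda>k. complex_of_real (r k)"]
    by (simp add: op_alg_def power2_eq_square)
  ultimately show "positive_op I ?R \<and> compose (ell2 I) ?R ?R = ?D" ..
  fix S assume S: "positive_op I S \<and> compose (ell2 I) S S = ?D"
  then have Sb: "S \<in> bounded_ops I" by (simp add: positive_op_def)
  show "S = ?R"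
  proof (rule op_eq_on_basis[OF Sb R])
    fix j assume j: "j \<in> I"
    let ?c = "complex_of_real (r j)"
    define \<psi> where "\<psi> = (\<lambda>i. S (ket j) i + (- ?c) * ket j i)"
    have Sk: "S (ket j) \<in> ell2 I" using Sb j by simp
    have \<psi>: "\<psi> \<in> ell2 I" unfolding \<psi>_def using Sk j by (intro ell2_add ell2_scale ket_ell2)
    have "S (S (ket j)) = ?D (ket j)"
      using S j by (metis compose_eq ket_ell2)
    then have SS: "S (S (ket j)) = (\<lambda>i. ?c\<^sup>2 * ket j i)"
      using j unfolding wshift_ket[OF j] by (auto simp: ket_def fun_eq_iff)
    have "S \<psi> = (\<lambda>i. S (S (ket j)) i + (- ?c) * S (ket j) i)"
      unfolding \<psi>_def
      using bounded_ops_add[OF Sb Sk ell2_scale[OF ket_ell2[OF j], of "- ?c"]]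
        bounded_ops_scale[OF Sb ket_ell2[OF j], of "- ?c"] by simp
    also have "\<dots> = (\<lambda>i. complex_of_real (- r j) * \<psi> i)"
      unfolding SS \<psi>_def by (simp add: fun_eq_iff algebra_simps power2_eq_square)
    finally have "ip I \<psi> (S \<psi>) = complex_of_real (\<Sum>\<^sub>\<infinity>i\<in>I. - r j * (cmod (\<psi> i))\<^sup>2)"
      using ip_weighted_self[of I \<psi> "\<lambda>_. - r j"] by simp
    then have "ip I \<psi> (S \<psi>) = complex_of_real (- r j * nsq I \<psi>)"
      unfolding infsum_cmult_right' nsq_def .
    moreover have "ip I \<psi> (S \<psi>) \<in> \<real>\<^sub>\<ge>\<^sub>0" using S \<psi> by (simp add: positive_op_def)
    ultimately have "0 \<le> - r j * nsq I \<psi>" by (simp add: complex_nonneg_Reals_iff)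
    then have "nsq I \<psi> \<le> 0" using r[OF j] by (simp add: mult_le_0_iff zero_le_mult_iff)
    then have "\<psi> = (\<lambda>i. 0)" by (rule nsq_le_zeroD[OF \<psi>])
    then have "S (ket j) i = ?c * ket j i" for i
      by (simp add: \<psi>_def fun_eq_iff)
    then show "S (ket j) = ?R (ket j)"
      using j unfolding wshift_ket[OF j] by (auto simp: fun_eq_iff ket_def)
  qed
qed

text \<open>The absolute value is the diagonal operator of absolute values, by \<open>pos_sqrt_op_diag\<close>; that
  lemma speaks of positive entries, whence the condition that no entry vanishes.\<close>

lemma op_trace_diag:
  assumes w: "\<And>k. k \<in> I \<Longrightarrow> w k \<noteq> 0" and s: "(\<lambda>k. cmod (w k)) summable_on I"
  shows "op_trace I (diag_op I w) = (\<Sum>\<^sub>\<infinity>k\<in>I. w k)"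
proof -
  have B: "cmod (w k) \<le> (\<Sum>\<^sub>\<infinity>k\<in>I. cmod (w k))" if "k \<in> I" for k
    using finite_sum_le_infsum[OF s, of "{k}"] that by simp
  have ok: "wshift_ok I w (\<lambda>k. k)" by (rule diag_ok[OF B])
  have ok': "wshift_ok I (\<lambda>k. cnj (w k)) (\<lambda>k. k)" by (rule diag_ok) (use B in simp)
  have "adjoint_pair I (diag_op I (\<lambda>k. cnj (w k))) (diag_op I w)"
    by (rule adjoint_pair_wshift[OF ok' ok]) auto
  then have "adjoint_op I (diag_op I w) = diag_op I (\<lambda>k. cnj (w k))"
    by (rule adjoint_op_eq[OF wshift_bounded[OF ok']])
  then have "compose (ell2 I) (adjoint_op I (diag_op I w)) (diag_op I w)
      = diag_op I (\<lambda>k. complex_of_real ((cmod (w k))\<^sup>2))"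
    using diag_mult[OF ok, of "\<lambda>k. cnj (w k)"]
    by (simp add: op_alg_def complex_norm_square mult.commute del: of_real_power)
  then have abs: "abs_op I (diag_op I w) = diag_op I (\<lambda>k. complex_of_real (cmod (w k)))"
    unfolding abs_op_def using pos_sqrt_op_diag[of I "\<lambda>k. cmod (w k)", OF _ B] w
    by (simp del: of_real_power)
  have "(\<lambda>k. ip I (ket k) (abs_op I (diag_op I w) (ket k))) summable_on I
      \<longleftrightarrow> (\<lambda>k. complex_of_real (cmod (w k))) summable_on I"
    unfolding abs by (rule summable_on_cong) (simp add: ip_ket_left)
  moreover have "(\<lambda>k. complex_of_real (cmod (w k))) summable_on I"
    using s by (intro summable_on_of_real)
  ultimately have "trace_class I (diag_op I w)"
    using wshift_bounded[OF ok] by (simp add: trace_class_def)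
  moreover have "(\<Sum>\<^sub>\<infinity>k\<in>I. ip I (ket k) (diag_op I w (ket k))) = (\<Sum>\<^sub>\<infinity>k\<in>I. w k)"
    by (rule infsum_cong) (simp add: ip_ket_left)
  ultimately show ?thesis by (simp add: op_trace_def)
qed

section \<open>The representation of the quantum sphere\<close>

lemma multi_upd [simp]: "\<lbrakk>m \<in> multi n; i \<in> {1..n}\<rbrakk> \<Longrightarrow> m(i := x) \<in> multi n"
  by (auto simp: multi_def PiE_def extensional_def)

lemma multi_eqI: "\<lbrakk>m \<in> multi n; k \<in> multi n; \<And>j. j \<in> {1..n} \<Longrightarrow> m j = k j\<rbrakk> \<Longrightarrow> m = k"
  unfolding multi_def by (rule PiE_ext)

lemma prod_indicator:
  "finite A \<Longrightarrow> (\<Prod>j\<in>A. if P j then 1 else 0 :: complex) = (if \<forall>j\<in>A. P j then 1 else 0)"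
  by (induction A rule: finite_induct) auto

lemma leg_shift_ok:
  assumes ok: "wshift_ok UNIV w g" and i: "i \<in> {1..n}"
  shows "wshift_ok (multi n) (\<lambda>m. w (m i)) (\<lambda>m. m(i := g (m i)))"
proof -
  have "inj_on (\<lambda>m. m(i := g (m i))) {m \<in> multi n. w (m i) \<noteq> 0}"
  proof (rule inj_onI)
    fix m k
    assume mk: "m \<in> {m \<in> multi n. w (m i) \<noteq> 0}" "k \<in> {m \<in> multi n. w (m i) \<noteq> 0}"
      and eq: "m(i := g (m i)) = k(i := g (k i))"
    have other: "m j = k j" if "j \<noteq> i" for j using fun_cong[OF eq, of j] that by simp
    have "g (m i) = g (k i)" using fun_cong[OF eq, of i] by simp
    then have "m i = k i" using ok mk by (auto simp: wshift_ok_def dest: inj_onD)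
    then show "m = k" using other by (metis ext)
  qed
  then show ?thesis using ok i by (auto simp: wshift_ok_def)
qed

lemma leg_op_wshift:
  assumes ok: "wshift_ok UNIV w g" and i: "i \<in> {1..n}"
  shows "leg_op n i (wshift UNIV w g)
    = wshift (multi n) (\<lambda>m. w (m i)) (\<lambda>m. m(i := g (m i)))"
  unfolding leg_op_def
proof (rule op_on_basis_eq[OF wshift_bounded[OF leg_shift_ok[OF ok i]]])
  fix m assume m: "m \<in> multi n"
  let ?v = "(\<lambda>j. ket (m j))(i := wshift UNIV w g (ket (m i)))"
  show "wshift (multi n) (\<lambda>m. w (m i)) (\<lambda>m. m(i := g (m i))) (ket m) = elem_tensor n ?v"
  proof
    fix k
    show "wshift (multi n) (\<lambda>m. w (m i)) (\<lambda>m. m(i := g (m i))) (ket m) k = elem_tensor n ?v k"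
    proof (cases "k \<in> multi n")
      case k: True
      have "(\<Prod>j\<in>{1..n}. ?v j (k j)) = ?v i (k i) * (\<Prod>j\<in>{1..n} - {i}. ?v j (k j))"
        using i by (intro prod.remove) auto
      also have "(\<Prod>j\<in>{1..n} - {i}. ?v j (k j)) = (\<Prod>j\<in>{1..n} - {i}. if k j = m j then 1 else 0)"
        by (intro prod.cong) (auto simp: ket_def)
      also have "\<dots> = (if \<forall>j\<in>{1..n} - {i}. k j = m j then 1 else 0)"
        by (rule prod_indicator) simp
      finally have "elem_tensor n ?v k
          = (if g (k i) = m i then w (k i) else 0) * (if \<forall>j\<in>{1..n} - {i}. k j = m j then 1 else 0)"
        using k by (simp add: elem_tensor_def wshift_ket del: wshift_apply)
      moreover have "k(i := g (k i)) = m \<longleftrightarrow> g (k i) = m i \<and> (\<forall>j\<in>{1..n} - {i}. k j = m j)"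
      proof
        assume "g (k i) = m i \<and> (\<forall>j\<in>{1..n} - {i}. k j = m j)"
        then show "k(i := g (k i)) = m"
          by (intro multi_eqI[OF multi_upd[OF k i] m]) auto
      qed (auto split: if_splits)
      ultimately show ?thesis using k by (auto simp: wshift_ket[OF m])
    qed (use m in \<open>simp add: elem_tensor_def\<close>)
  qed
qed

context
  fixes q :: real and n :: nat
  assumes q0: "0 < q" and q1: "q < 1"
begin

lemma q_pow_le_one: "q ^ k \<le> 1"
  using q0 q1 by (intro power_le_one) auto

definition alpha_weight :: "nat \<Rightarrow> real" where
  "alpha_weight k = q ^ k * sqrt (1 - q ^ (2 * k + 2))"

lemma alpha_weight_bounds: "0 \<le> alpha_weight k" "alpha_weight k \<le> 1"
proof -
  have "0 \<le> sqrt (1 - q ^ (2 * k + 2))" "sqrt (1 - q ^ (2 * k + 2)) \<le> 1"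
    using q_pow_le_one[of "2 * k + 2"] q0 by auto
  then show "0 \<le> alpha_weight k" "alpha_weight k \<le> 1"
    using q_pow_le_one[of k] q0 by (auto simp: alpha_weight_def mult_le_one)
qed

lemma alpha_ok: "wshift_ok UNIV (\<lambda>k. complex_of_real (alpha_weight k)) Suc"
  unfolding wshift_ok_def using alpha_weight_bounds
  by (auto intro!: exI[of _ 1] simp: abs_of_nonneg)

lemma sig_alpha_eq: "sig_alpha q = wshift UNIV (\<lambda>k. complex_of_real (alpha_weight k)) Suc"
  unfolding sig_alpha_def
proof (rule op_on_basis_eq[OF wshift_bounded[OF alpha_ok]])
  fix m :: nat
  show "wshift UNIV (\<lambda>k. complex_of_real (alpha_weight k)) Suc (ket m)
     = (\<lambda>k. complex_of_real (q powi (int m - 1) * sqrt (1 - q^(2 * m))) * ket (m - 1) k)"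
    unfolding wshift_ket[OF UNIV_I]
    by (cases m) (auto simp: ket_def alpha_weight_def fun_eq_iff)
qed

lemma tau_ok: "wshift_ok UNIV (\<lambda>k. complex_of_real (q ^ (2 * k))) (\<lambda>k. k)"
  using q_pow_le_one q0 by (intro diag_ok[where B = 1]) (simp add: norm_power)

lemma sig_tau_eq: "sig_tau q = diag_op UNIV (\<lambda>k. complex_of_real (q ^ (2 * k)))"
  unfolding sig_tau_def
proof (rule op_on_basis_eq[OF wshift_bounded[OF tau_ok]])
  fix m :: nat
  show "diag_op UNIV (\<lambda>k. complex_of_real (q ^ (2 * k))) (ket m)
     = (\<lambda>k. complex_of_real (q^(2 * m)) * ket m k)"
    unfolding wshift_ket[OF UNIV_I] by (auto simp: ket_def)
qed

lemma alpha_op_eq: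
  "i \<in> {1..n} \<Longrightarrow> alpha_op q n i
     = wshift (multi n) (\<lambda>m. complex_of_real (alpha_weight (m i))) (\<lambda>m. m(i := Suc (m i)))"
  unfolding alpha_op_def sig_alpha_eq by (rule leg_op_wshift[OF alpha_ok])

lemma tau_op_eq:
  "i \<in> {1..n} \<Longrightarrow> tau_op q n i = diag_op (multi n) (\<lambda>m. complex_of_real (q ^ (2 * m i)))"
  unfolding tau_op_def sig_tau_eq by (simp add: leg_op_wshift[OF tau_ok] del: of_real_power)

lemma qpow_ok: "wshift_ok I (\<lambda>m. complex_of_real (q ^ e m)) (\<lambda>m. m)"
  using q_pow_le_one q0 by (intro diag_ok[where B = 1]) (simp add: norm_power)

lemma sqrt_tau_op_eq:
  assumes "i \<in> {1..n}"
  shows "pos_sqrt_op (multi n) (tau_op q n i) = diag_op (multi n) (\<lambda>m. complex_of_real (q ^ m i))"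
  using pos_sqrt_op_diag[of "multi n" "\<lambda>m. q ^ m i" 1] q0 q_pow_le_one
  by (simp add: tau_op_eq[OF assms] power_mult mult.commute[of 2] del: of_real_power)

text \<open>The operator \<open>\<tau>\<^sub>k\<close> to the power \<open>M\<^sub>i\<^sub>k\<close> is diagonal with entries \<open>q\<close> to this power, so \<open>a_exp\<close> and
  \<open>t_exp\<close> below are the exponents of \<open>q\<close> for the product over \<open>k\<close> and for \<open>\<sigma>\<^sub>n(t)\<close>.\<close>

definition tau_exp :: "nat \<Rightarrow> nat \<Rightarrow> (nat \<Rightarrow> nat) \<Rightarrow> nat" where
  "tau_exp i k m = (if i < k then 2 * m k else if k < i then m k else 0)"

lemma tau_pow_M_eq:
  "k \<in> {1..n} \<Longrightarrow> tau_pow_M q n i k = diag_op (multi n) (\<lambda>m. complex_of_real (q ^ tau_exp i k m))"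
proof -
  assume k: "k \<in> {1..n}"
  have "\<one>\<^bsub>op_alg (multi n)\<^esub> = diag_op (multi n) (\<lambda>m. 1)"
    by (rule op_eqI[OF op_one_closed wshift_bounded[OF diag_ok[where B = 1]]]) auto
  then show ?thesis
    using tau_op_eq[OF k] sqrt_tau_op_eq[OF k]
    by (cases i k rule: linorder_cases) (simp_all add: tau_pow_M_def tau_exp_def del: of_real_power)
qed

lemma alg_prod_diag:
  assumes "set xs \<subseteq> {1..n}" "\<And>k. k \<in> {1..n} \<Longrightarrow> D k = diag_op (multi n) (\<lambda>m. complex_of_real (q ^ e k m))"
  shows "alg_prod (op_alg (multi n)) (map D xs)
    = diag_op (multi n) (\<lambda>m. complex_of_real (q ^ (\<Sum>k\<leftarrow>xs. e k m)))"
  using assms(1)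
proof (induction xs)
  case Nil
  show ?case
    by (rule op_eqI[of _ "multi n"]) (auto intro!: wshift_bounded diag_ok[where B = 1])
next
  case (Cons k xs)
  then show ?case
    using assms(2)[of k] diag_mult[OF qpow_ok, of "multi n" _ "\<lambda>m. \<Sum>k\<leftarrow>xs. e k m"]
    by (simp add: power_add)
qed

lemma sum_list_upt: "(\<Sum>k\<leftarrow>[1..<Suc n]. f k) = (\<Sum>k\<in>{1..n}. f k :: nat)"
  by (simp add: sum_list_distinct_conv_sum_set atLeastLessThanSuc_atLeastAtMost del: upt_Suc)

lemma alg_prod_diag_all:
  assumes "\<And>k. k \<in> {1..n} \<Longrightarrow> D k = diag_op (multi n) (\<lambda>m. complex_of_real (q ^ e k m))"
  shows "alg_prod (op_alg (multi n)) (map D [1..<Suc n])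
    = diag_op (multi n) (\<lambda>m. complex_of_real (q ^ (\<Sum>k\<in>{1..n}. e k m)))"
  unfolding sum_list_upt[symmetric] by (rule alg_prod_diag[OF _ assms]) auto

definition a_exp :: "nat \<Rightarrow> (nat \<Rightarrow> nat) \<Rightarrow> nat" where
  "a_exp i m = (\<Sum>k\<in>{1..n}. tau_exp i k m)"

definition t_exp :: "(nat \<Rightarrow> nat) \<Rightarrow> nat" where
  "t_exp m = (\<Sum>k\<in>{1..n}. 2 * m k)"

text \<open>Coefficients of the weighted shifts: \<open>\<sigma>\<^sub>n(a\<^sub>i)\<close> sends \<open>|m + \<delta>\<^sub>i\<rangle>\<close> to \<open>a_weight i m\<close> times \<open>|m\<rangle>\<close>,
  where \<open>\<delta>\<^sub>i\<close> is the \<open>i\<close>-th unit vector, and its adjoint sends \<open>|m - \<delta>\<^sub>i\<rangle>\<close> to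
  \<open>a_star_weight i m\<close> times \<open>|m\<rangle>\<close>.\<close>

definition a_weight :: "nat \<Rightarrow> (nat \<Rightarrow> nat) \<Rightarrow> real" where
  "a_weight i m = alpha_weight (m i) * q ^ a_exp i m"

definition a_star_weight :: "nat \<Rightarrow> (nat \<Rightarrow> nat) \<Rightarrow> real" where
  "a_star_weight i m = (if m i = 0 then 0 else a_weight i (m(i := m i - 1)))"

definition t_weight :: "(nat \<Rightarrow> nat) \<Rightarrow> real" where
  "t_weight m = q ^ t_exp m"

lemma sigma_t_eq: "sigma_t q n = diag_op (multi n) (\<lambda>m. complex_of_real (t_weight m))"
  unfolding sigma_t_def t_weight_def t_exp_def by (rule alg_prod_diag_all[OF tau_op_eq])

lemma t_ok: "wshift_ok I (\<lambda>m. complex_of_real (t_weight m)) (\<lambda>m. m)"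
  unfolding t_weight_def by (rule qpow_ok)

lemma tau_exp_upd:
  "tau_exp i k (m(j := x)) = (if k = j then tau_exp i k (\<lambda>_. x) else tau_exp i k m)"
  by (simp add: tau_exp_def)

text \<open>Raising \<open>m\<^sub>j\<close> changes the power of \<open>\<tau>\<^sub>j\<close> in \<open>a\<^sub>i\<close>, which is \<open>1\<close> for \<open>i < j\<close> and \<open>1/2\<close> for
  \<open>j < i\<close>. These two factors, \<open>q\<^sup>2\<close> and \<open>q\<close>, are the source of the commutation constants
  \<open>q\<^bsup>-1\<^esup>\<close> and \<open>q\<^sup>3\<close>.\<close>

lemma a_exp_Suc:
  assumes j: "j \<in> {1..n}"
  shows "a_exp i (m(j := Suc (m j))) = a_exp i m + (if i < j then 2 else if j < i then 1 else 0)"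
proof -
  have "a_exp i (m(j := x)) = tau_exp i j (\<lambda>_. x) + (\<Sum>k\<in>{1..n} - {j}. tau_exp i k m)" for x
    unfolding a_exp_def using j by (subst sum.remove[of _ j]) (auto simp: tau_exp_upd)
  from this[of "Suc (m j)"] this[of "m j"] show ?thesis
    by (simp add: tau_exp_def)
qed

lemma t_exp_Suc: "j \<in> {1..n} \<Longrightarrow> t_exp (m(j := Suc (m j))) = t_exp m + 2"
proof -
  assume j: "j \<in> {1..n}"
  have "t_exp (m(j := x)) = 2 * x + (\<Sum>k\<in>{1..n} - {j}. 2 * m k)" for x
    unfolding t_exp_def using j by (subst sum.remove[of _ j]) auto
  from this[of "Suc (m j)"] this[of "m j"] show ?thesis by simp
qed

lemma a_weight_Suc_less:
  assumes "i < j" "j \<in> {1..n}"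
  shows "a_weight i (m(j := Suc (m j))) = q\<^sup>2 * a_weight i m"
  using assms a_exp_Suc[of j i m] by (simp add: a_weight_def power2_eq_square mult_ac)

lemma a_weight_Suc_greater:
  assumes "j < i" "j \<in> {1..n}"
  shows "a_weight i (m(j := Suc (m j))) = q * a_weight i m"
  using assms a_exp_Suc[of j i m] by (simp add: a_weight_def mult_ac)

lemma t_weight_Suc: "j \<in> {1..n} \<Longrightarrow> t_weight (m(j := Suc (m j))) = q\<^sup>2 * t_weight m"
  by (simp add: t_weight_def t_exp_Suc power2_eq_square mult_ac)

lemma a_weight_bounds: "0 \<le> a_weight i m" "a_weight i m \<le> 1"
  using alpha_weight_bounds[of "m i"] q_pow_le_one[of "a_exp i m"] q0
  by (auto simp: a_weight_def mult_le_one)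

lemma a_ok:
  assumes i: "i \<in> {1..n}"
  shows "wshift_ok (multi n) (\<lambda>m. complex_of_real (a_weight i m)) (\<lambda>m. m(i := Suc (m i)))"
proof -
  have "inj_on (\<lambda>m. m(i := Suc (m i))) M" for M :: "(nat \<Rightarrow> nat) set"
    by (rule inj_onI) (metis fun_upd_apply fun_upd_triv fun_upd_upd old.nat.inject)
  then show ?thesis
    using i a_weight_bounds unfolding wshift_ok_def
    by (auto intro!: exI[of _ 1] simp: abs_of_nonneg)
qed

lemma a_star_ok:
  assumes i: "i \<in> {1..n}"
  shows "wshift_ok (multi n) (\<lambda>m. complex_of_real (a_star_weight i m)) (\<lambda>m. m(i := m i - 1))"
proof -
  have "inj_on (\<lambda>m. m(i := m i - 1)) {m \<in> multi n. complex_of_real (a_star_weight i m) \<noteq> 0}"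
  proof (rule inj_onI)
    fix m k
    assume "m \<in> {m \<in> multi n. complex_of_real (a_star_weight i m) \<noteq> 0}"
      "k \<in> {m \<in> multi n. complex_of_real (a_star_weight i m) \<noteq> 0}"
      and eq: "m(i := m i - 1) = k(i := k i - 1)"
    then have "m i \<noteq> 0" "k i \<noteq> 0" by (auto simp: a_star_weight_def split: if_splits)
    moreover have "m i - 1 = k i - 1" using fun_cong[OF eq, of i] by simp
    ultimately have "m i = k i" by simp
    moreover have "m j = k j" if "j \<noteq> i" for j using fun_cong[OF eq, of j] that by simp
    ultimately show "m = k" by (metis ext)
  qed
  moreover have "cmod (complex_of_real (a_star_weight i m)) \<le> 1" for m
    using a_weight_bounds by (simp add: a_star_weight_def)
  ultimately show ?thesis
    using i unfolding wshift_ok_def by (auto intro!: exI[of _ 1])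
qed

lemma sigma_a_eq:
  assumes i: "i \<in> {1..n}"
  shows "sigma_a q n i = wshift (multi n) (\<lambda>m. complex_of_real (a_weight i m)) (\<lambda>m. m(i := Suc (m i)))"
proof -
  let ?D = "diag_op (multi n) (\<lambda>m. complex_of_real (q ^ a_exp i m))"
  have "alg_prod (op_alg (multi n)) (map (tau_pow_M q n i) [1..<Suc n]) = ?D"
    unfolding a_exp_def by (rule alg_prod_diag_all[OF tau_pow_M_eq])
  then have eq: "sigma_a q n i = alpha_op q n i \<otimes>\<^bsub>op_alg (multi n)\<^esub> ?D"
    by (simp add: sigma_a_def del: upt_Suc of_real_power)
  have D: "?D \<in> bounded_ops (multi n)" by (rule wshift_bounded[OF qpow_ok])
  have \<alpha>: "alpha_op q n i \<in> bounded_ops (multi n)"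
    unfolding alpha_op_eq[OF i] by (rule wshift_bounded[OF leg_shift_ok[OF alpha_ok i]])
  show ?thesis
  proof (rule op_eqI[of _ "multi n"])
    show "sigma_a q n i \<in> bounded_ops (multi n)" unfolding eq using D \<alpha> by simp
    show "wshift (multi n) (\<lambda>m. complex_of_real (a_weight i m)) (\<lambda>m. m(i := Suc (m i)))
        \<in> bounded_ops (multi n)" by (rule wshift_bounded[OF a_ok[OF i]])
    fix \<psi> m assume \<psi>: "\<psi> \<in> ell2 (multi n)" and m: "m \<in> multi n"
    show "sigma_a q n i \<psi> m
        = wshift (multi n) (\<lambda>m. complex_of_real (a_weight i m)) (\<lambda>m. m(i := Suc (m i))) \<psi> m"
      unfolding eq op_alg_apply(1)[OF \<psi>] alpha_op_eq[OF i]
        wshift_apply[OF bounded_ops_closed[OF D \<psi>]]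
      using \<psi> m i a_exp_Suc[OF i, of i m] by (simp add: a_weight_def)
  qed
qed

abbreviation sigma_a_star :: "nat \<Rightarrow> (nat \<Rightarrow> nat) oper" where
  "sigma_a_star i \<equiv>
     wshift (multi n) (\<lambda>m. complex_of_real (a_star_weight i m)) (\<lambda>m. m(i := m i - 1))"

lemma sigma_a_adjoint:
  assumes i: "i \<in> {1..n}"
  shows "adjoint_pair (multi n) (sigma_a_star i) (sigma_a q n i)"
    "adjoint_pair (multi n) (sigma_a q n i) (sigma_a_star i)"
  unfolding sigma_a_eq[OF i]
  by (intro adjoint_pair_wshift a_ok[OF i] a_star_ok[OF i];
      auto simp: a_star_weight_def split: if_splits)+

lemma sigma_t_adjoint: "adjoint_pair (multi n) (sigma_t q n) (sigma_t q n)"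
  unfolding sigma_t_eq by (rule adjoint_pair_wshift[OF t_ok t_ok]) auto

abbreviation sigma_letter :: "letter \<Rightarrow> (nat \<Rightarrow> nat) oper" where
  "sigma_letter \<equiv> letter_value (op_alg (multi n)) (sigma_a q n) (sigma_t q n)"

abbreviation sigma_free :: "free \<Rightarrow> (nat \<Rightarrow> nat) oper" where
  "sigma_free \<equiv> free_hom (op_alg (multi n)) (sigma_a q n) (sigma_t q n)"

lemma sigma_letter_simps:
  "sigma_letter LY = sigma_t q n" "sigma_letter (LX i) = sigma_a q n i"
  "i \<in> {1..n} \<Longrightarrow> sigma_letter (LXs i) = sigma_a_star i"
  using adjoint_op_eq[OF wshift_bounded[OF a_star_ok] sigma_a_adjoint(1)] by auto

lemma sigma_letter_eq:
  "sigma_letter LY = diag_op (multi n) (\<lambda>m. complex_of_real (t_weight m))"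
  "i \<in> {1..n} \<Longrightarrow> sigma_letter (LX i)
     = wshift (multi n) (\<lambda>m. complex_of_real (a_weight i m)) (\<lambda>m. m(i := Suc (m i)))"
  "i \<in> {1..n} \<Longrightarrow> sigma_letter (LXs i) = sigma_a_star i"
  by (simp only: letter_value.simps sigma_t_eq) (simp only: letter_value.simps sigma_a_eq, rule sigma_letter_simps(3))

lemma sigma_admissible:
  "complex_algebra.admissible (op_alg (multi n)) n (sigma_a q n) (sigma_t q n)"
  unfolding complex_algebra.admissible_def[OF complex_algebra_op_alg]
proof
  fix T assume "T \<in> sigma_letter ` letters_upto n"
  then obtain l where l: "l \<in> letters_upto n" "T = sigma_letter l" by auto
  show "T \<in> carrier (op_alg (multi n))"
    unfolding l(2) carrier_op_alg
  proof (cases l)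
    case (LX i)
    then have "i \<in> {1..n}" using l by simp
    then show "sigma_letter l \<in> bounded_ops (multi n)"
      unfolding LX sigma_letter_eq(2)[OF \<open>i \<in> {1..n}\<close>] by (rule wshift_bounded[OF a_ok])
  next
    case (LXs i)
    then have "i \<in> {1..n}" using l by simp
    then show "sigma_letter l \<in> bounded_ops (multi n)"
      unfolding LXs sigma_letter_eq(3)[OF \<open>i \<in> {1..n}\<close>] by (rule wshift_bounded[OF a_star_ok])
  next
    case LY
    show "sigma_letter l \<in> bounded_ops (multi n)"
      unfolding LY sigma_letter_eq(1) by (rule wshift_bounded[OF t_ok])
  qed
qed

lemma sigma_letter_bounded: "l \<in> letters_upto n \<Longrightarrow> sigma_letter l \<in> bounded_ops (multi n)"
  using sigma_admissible unfolding complex_algebra.admissible_def[OF complex_algebra_op_alg] by auto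

lemma sigma_letter_adjoint:
  "l \<in> letters_upto n \<Longrightarrow>
     adjoint_pair (multi n) (sigma_letter (star_letter l)) (sigma_letter l)"
proof (cases l)
  case (LX i)
  assume "l \<in> letters_upto n"
  then have i: "i \<in> {1..n}" using LX by simp
  show ?thesis
    unfolding LX star_letter.simps sigma_letter_simps(2) sigma_letter_simps(3)[OF i]
    by (rule sigma_a_adjoint(1)[OF i])
next
  case (LXs i)
  assume "l \<in> letters_upto n"
  then have i: "i \<in> {1..n}" using LXs by simp
  show ?thesis
    unfolding LXs star_letter.simps sigma_letter_simps(2) sigma_letter_simps(3)[OF i]
    by (rule sigma_a_adjoint(2)[OF i])
next
  case LY
  show ?thesis unfolding LY star_letter.simps sigma_letter_simps by (rule sigma_t_adjoint)
qed

lemma sigma_letter_apply: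
  assumes "\<psi> \<in> ell2 (multi n)" "m \<in> multi n"
  shows "sigma_letter LY \<psi> m = complex_of_real (t_weight m) * \<psi> m"
    "i \<in> {1..n} \<Longrightarrow> sigma_letter (LX i) \<psi> m = complex_of_real (a_weight i m) * \<psi> (m(i := Suc (m i)))"
    "i \<in> {1..n} \<Longrightarrow> sigma_letter (LXs i) \<psi> m = complex_of_real (a_star_weight i m) * \<psi> (m(i := m i - 1))"
  using assms by (simp_all only: sigma_letter_eq wshift_apply if_True)

lemma sigma_free_closed: "f \<in> carrier (free_alg n) \<Longrightarrow> sigma_free f \<in> bounded_ops (multi n)"
  using complex_algebra.free_hom_closed[OF complex_algebra_op_alg sigma_admissible] by simp

lemma sigma_free_apply:
  assumes "\<psi> \<in> ell2 (multi n)"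
  shows "l \<in> letters_upto n \<Longrightarrow> sigma_free (gen l) \<psi> = sigma_letter l \<psi>"
    and "\<lbrakk>k \<in> letters_upto n; l \<in> letters_upto n\<rbrakk> \<Longrightarrow>
           sigma_free (gen k * gen l) \<psi> = sigma_letter k (sigma_letter l \<psi>)"
    and "f \<in> carrier (free_alg n) \<Longrightarrow> sigma_free (free_scale c f) \<psi> m = c * sigma_free f \<psi> m"
    and "\<lbrakk>f \<in> carrier (free_alg n); g \<in> carrier (free_alg n)\<rbrakk> \<Longrightarrow>
           sigma_free (f + g) \<psi> m = sigma_free f \<psi> m + sigma_free g \<psi> m"
    and "\<lbrakk>finite X; \<And>x. x \<in> X \<Longrightarrow> F x \<in> carrier (free_alg n)\<rbrakk> \<Longrightarrow>
           sigma_free (sum F X) \<psi> m = (\<Sum>x\<in>X. sigma_free (F x) \<psi> m)"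
proof -
  interpret complex_algebra "op_alg (multi n)" by (rule complex_algebra_op_alg)
  note ad = sigma_admissible
  show "l \<in> letters_upto n \<Longrightarrow> sigma_free (gen l) \<psi> = sigma_letter l \<psi>"
    by (simp only: free_hom_gen[OF ad])
  show "\<lbrakk>k \<in> letters_upto n; l \<in> letters_upto n\<rbrakk> \<Longrightarrow>
           sigma_free (gen k * gen l) \<psi> = sigma_letter k (sigma_letter l \<psi>)"
    by (simp only: free_hom_mult[OF ad] free_hom_gen[OF ad] free_carrier_gen op_alg_apply[OF assms])
  show "f \<in> carrier (free_alg n) \<Longrightarrow> sigma_free (free_scale c f) \<psi> m = c * sigma_free f \<psi> m"
    by (simp only: free_hom_scale[OF ad] op_alg_apply[OF assms])
  show "\<lbrakk>f \<in> carrier (free_alg n); g \<in> carrier (free_alg n)\<rbrakk> \<Longrightarrow>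
           sigma_free (f + g) \<psi> m = sigma_free f \<psi> m + sigma_free g \<psi> m"
    by (simp only: free_hom_add[OF ad] op_alg_apply[OF assms])
  show "\<lbrakk>finite X; \<And>x. x \<in> X \<Longrightarrow> F x \<in> carrier (free_alg n)\<rbrakk> \<Longrightarrow>
           sigma_free (sum F X) \<psi> m = (\<Sum>x\<in>X. sigma_free (F x) \<psi> m)"
    by (subst free_hom_sum[OF ad], assumption, assumption, rule finsum_op_alg_apply)
       (auto intro: sigma_free_closed assms)
qed

lemma sigma_free_diff_zeroI:
  assumes "f \<in> carrier (free_alg n)" "g \<in> carrier (free_alg n)"
    and "\<And>\<psi> m. \<lbrakk>\<psi> \<in> ell2 (multi n); m \<in> multi n\<rbrakk> \<Longrightarrow> sigma_free f \<psi> m = sigma_free g \<psi> m"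
  shows "sigma_free (f - g) = \<zero>\<^bsub>op_alg (multi n)\<^esub>"
  by (rule complex_algebra.free_hom_diff_eq_zero[OF complex_algebra_op_alg sigma_admissible assms(1,2)])
     (rule op_eqI[OF sigma_free_closed[OF assms(1)] sigma_free_closed[OF assms(2)] assms(3)])

lemma sigma_word2:
  assumes \<psi>: "\<psi> \<in> ell2 (multi n)" and m: "m \<in> multi n" and l: "l \<in> letters_upto n"
  shows "sigma_free (gen LY * gen l) \<psi> m = complex_of_real (t_weight m) * sigma_letter l \<psi> m"
    "i \<in> {1..n} \<Longrightarrow> sigma_free (gen (LX i) * gen l) \<psi> m
       = complex_of_real (a_weight i m) * sigma_letter l \<psi> (m(i := Suc (m i)))"
    "i \<in> {1..n} \<Longrightarrow> sigma_free (gen (LXs i) * gen l) \<psi> m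
       = complex_of_real (a_star_weight i m) * sigma_letter l \<psi> (m(i := m i - 1))"
  using sigma_letter_apply[OF bounded_ops_closed[OF sigma_letter_bounded[OF l] \<psi>] m]
    sigma_free_apply(2)[OF \<psi> _ l] by simp_all

text \<open>The products \<open>a\<^sub>i\<^sup>*a\<^sub>i\<close> telescope: with \<open>P\<^sub>i = \<Prod>\<^bsub>k<i\<^esub>\<tau>\<^sub>k \<Prod>\<^bsub>k\<ge>i\<^esub>\<tau>\<^sub>k\<^sup>2\<close> one has
  \<open>q\<^sup>2a\<^sub>i\<^sup>*a\<^sub>i = P\<^bsub>i+1\<^esub> - P\<^sub>i\<close>, where \<open>P\<^sub>1 = t\<^sup>2\<close> and \<open>P\<^bsub>n+1\<^esub> = t\<close>.\<close>

definition partial_t :: "nat \<Rightarrow> (nat \<Rightarrow> nat) \<Rightarrow> real" where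
  "partial_t i m = q ^ (\<Sum>k\<in>{1..n}. if k < i then 2 * m k else 4 * m k)"

lemma partial_t_ends: "partial_t 1 m = (t_weight m)\<^sup>2" "partial_t (Suc n) m = t_weight m"
proof -
  have "(\<Sum>k\<in>{1..n}. if k < 1 then 2 * m k else 4 * m k) = t_exp m * 2"
    unfolding t_exp_def sum_distrib_right by (intro sum.cong) auto
  then show "partial_t 1 m = (t_weight m)\<^sup>2"
    by (simp add: partial_t_def t_weight_def power_mult)
  have "(\<Sum>k\<in>{1..n}. if k < Suc n then 2 * m k else 4 * m k) = t_exp m"
    unfolding t_exp_def by (intro sum.cong) auto
  then show "partial_t (Suc n) m = t_weight m"
    by (simp add: partial_t_def t_weight_def)
qed

lemma partial_t_exponent:
  assumes i: "i \<in> {1..n}"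
  shows "partial_t (Suc i) m = q ^ (2 * m i + 2 * a_exp i m)"
    and "partial_t i m = q ^ (4 * m i + 2 * a_exp i m)"
proof -
  have exp: "2 * a_exp i m = (\<Sum>k\<in>{1..n} - {i}. if k < i then 2 * m k else 4 * m k)"
    unfolding a_exp_def sum_distrib_left using i
    by (subst sum.remove[of _ i]) (auto simp: tau_exp_def intro!: sum.cong split: if_splits)
  have "(\<Sum>k\<in>{1..n}. if k < Suc i then 2 * m k else 4 * m k) = 2 * m i + 2 * a_exp i m"
    unfolding exp using i by (subst sum.remove[of _ i]) (auto intro!: sum.cong split: if_splits)
  then show "partial_t (Suc i) m = q ^ (2 * m i + 2 * a_exp i m)" by (simp add: partial_t_def)
  have "(\<Sum>k\<in>{1..n}. if k < i then 2 * m k else 4 * m k) = 4 * m i + 2 * a_exp i m"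
    unfolding exp using i by (subst sum.remove[of _ i]) (auto intro!: sum.cong split: if_splits)
  then show "partial_t i m = q ^ (4 * m i + 2 * a_exp i m)" by (simp add: partial_t_def)
qed

lemma a_weight_squared:
  "(a_weight i m)\<^sup>2 = q ^ (2 * m i + 2 * a_exp i m) * (1 - q ^ (2 * m i + 2))"
proof -
  have "(sqrt (1 - q ^ (2 * m i + 2)))\<^sup>2 = 1 - q ^ (2 * m i + 2)"
    using q_pow_le_one[of "2 * m i + 2"] by (intro real_sqrt_pow2) auto
  then show ?thesis
    by (simp add: a_weight_def alpha_weight_def power_mult_distrib power_add mult.commute
        flip: power_mult)
qed

lemma a_star_a_weight:
  assumes i: "i \<in> {1..n}"
  shows "q\<^sup>2 * (a_star_weight i m * a_weight i (m(i := m i - 1))) = partial_t (Suc i) m - partial_t i m"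
proof (cases "m i")
  case 0
  then show ?thesis using partial_t_exponent[OF i, of m] by (simp add: a_star_weight_def)
next
  case (Suc x)
  let ?m = "m(i := x)"
  have e: "a_exp i m = a_exp i ?m"
    using a_exp_Suc[OF i, of i ?m] Suc by (simp add: fun_upd_idem)
  have "q\<^sup>2 * (a_weight i ?m)\<^sup>2 = q ^ (2 * Suc x + 2 * a_exp i m) * (1 - q ^ (2 * Suc x))"
    unfolding a_weight_squared e by (simp add: power_add power2_eq_square)
  also have "\<dots> = partial_t (Suc i) m - partial_t i m"
    unfolding partial_t_exponent[OF i] Suc by (simp add: algebra_simps flip: power_add)
      (simp add: power_add numeral_eq_Suc)
  finally show ?thesis using Suc by (simp add: a_star_weight_def power2_eq_square)
qed

lemma a_a_star_weight:
  assumes i: "i \<in> {1..n}"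
  shows "(a_weight i m)\<^sup>2 = partial_t (Suc i) m - q\<^sup>2 * partial_t i m"
  unfolding a_weight_squared partial_t_exponent[OF i]
  by (simp add: algebra_simps flip: power_add)

lemma sum_a_star_a_weight:
  assumes i: "i \<in> {1..Suc n}"
  shows "q\<^sup>2 * (\<Sum>l\<in>{1..<i}. a_star_weight l m * a_weight l (m(l := m l - 1)))
    = partial_t i m - (t_weight m)\<^sup>2"
proof -
  have "q\<^sup>2 * (\<Sum>l\<in>{1..<i}. a_star_weight l m * a_weight l (m(l := m l - 1)))
      = (\<Sum>l\<in>{1..<i}. partial_t (Suc l) m - partial_t l m)"
    unfolding sum_distrib_left using i by (intro sum.cong refl a_star_a_weight) auto
  also have "\<dots> = partial_t i m - partial_t 1 m"
    using i by (intro sum_Suc_diff') auto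
  finally show ?thesis unfolding partial_t_ends .
qed

lemma sigma_a_star_a:
  assumes "\<psi> \<in> ell2 (multi n)" "m \<in> multi n" "i \<in> {1..n}"
  shows "sigma_free (gen (LXs i) * gen (LX i)) \<psi> m
    = complex_of_real (a_star_weight i m * a_weight i (m(i := m i - 1))) * \<psi> m"
  using assms sigma_word2(3)[of \<psi> m "LX i" i] sigma_letter_apply(2)[of \<psi> "m(i := m i - 1)" i]
  by (cases "m i") (auto simp: a_star_weight_def fun_upd_idem)

lemma sigma_a_a_star:
  assumes "\<psi> \<in> ell2 (multi n)" "m \<in> multi n" "i \<in> {1..n}"
  shows "sigma_free (gen (LX i) * gen (LXs i)) \<psi> m = complex_of_real ((a_weight i m)\<^sup>2) * \<psi> m"
  using assms sigma_word2(2)[of \<psi> m "LXs i" i] sigma_letter_apply(3)[of \<psi> "m(i := Suc (m i))" i]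
  by (simp add: a_star_weight_def power2_eq_square)

lemma sigma_sum_a_star_a:
  assumes "\<psi> \<in> ell2 (multi n)" "m \<in> multi n" "L \<subseteq> {1..n}"
  shows "sigma_free (\<Sum>l\<in>L. gen (LXs l) * gen (LX l)) \<psi> m
    = complex_of_real (\<Sum>l\<in>L. a_star_weight l m * a_weight l (m(l := m l - 1))) * \<psi> m"
proof -
  have "finite L" using assms(3) finite_subset by blast
  moreover have "gen (LXs l) * gen (LX l) \<in> carrier (free_alg n)" if "l \<in> L" for l
    using that assms(3) by (intro free_carrier_mult free_carrier_gen) auto
  ultimately have "sigma_free (\<Sum>l\<in>L. gen (LXs l) * gen (LX l)) \<psi> m
      = (\<Sum>l\<in>L. sigma_free (gen (LXs l) * gen (LX l)) \<psi> m)"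
    by (rule sigma_free_apply(5)[OF assms(1)])
  also have "\<dots> = (\<Sum>l\<in>L. complex_of_real (a_star_weight l m * a_weight l (m(l := m l - 1))) * \<psi> m)"
    using assms by (intro sum.cong refl sigma_a_star_a) auto
  finally show ?thesis by (simp add: sum_distrib_right)
qed

lemma sigma_rel_xy:
  assumes i: "i \<in> {1..n}"
  shows "sigma_free (gen (LX i) * gen LY - free_scale (complex_of_real (q^2)) (gen LY * gen (LX i)))
    = \<zero>\<^bsub>op_alg (multi n)\<^esub>"
proof (rule sigma_free_diff_zeroI)
  fix \<psi> m assume \<psi>: "\<psi> \<in> ell2 (multi n)" and m: "m \<in> multi n"
  have "gen LY * gen (LX i) \<in> carrier (free_alg n)" using i by auto
  then show "sigma_free (gen (LX i) * gen LY) \<psi> m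
      = sigma_free (free_scale (complex_of_real (q^2)) (gen LY * gen (LX i))) \<psi> m"
    using i \<psi> m
    by (simp add: sigma_free_apply(3) sigma_word2 sigma_letter_apply t_weight_Suc
        del: letter_value.simps)
qed (use i in auto)

lemma sigma_rel_xx:
  assumes i: "i \<in> {1..n}" and j: "j \<in> {1..n}" and ij: "i < j"
  shows "sigma_free (gen (LX i) * gen (LX j)
      - free_scale (complex_of_real (1 / q)) (gen (LX j) * gen (LX i))) = \<zero>\<^bsub>op_alg (multi n)\<^esub>"
proof (rule sigma_free_diff_zeroI)
  fix \<psi> m assume \<psi>: "\<psi> \<in> ell2 (multi n)" and m: "m \<in> multi n"
  have "gen (LX j) * gen (LX i) \<in> carrier (free_alg n)" using i j by auto
  moreover have "(m(i := Suc (m i)))(j := Suc (m j)) = (m(j := Suc (m j)))(i := Suc (m i))"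
    using ij by (simp add: fun_upd_twist)
  ultimately show "sigma_free (gen (LX i) * gen (LX j)) \<psi> m
      = sigma_free (free_scale (complex_of_real (1 / q)) (gen (LX j) * gen (LX i))) \<psi> m"
    using i j \<psi> m ij q0 a_weight_Suc_less[OF ij j, of m] a_weight_Suc_greater[OF ij i, of m]
    by (simp add: sigma_free_apply(3) sigma_word2 sigma_letter_apply power2_eq_square
        del: letter_value.simps)
qed (use i j in auto)

lemma sigma_rel_xxs:
  assumes i: "i \<in> {1..n}" and j: "j \<in> {1..n}" and ij: "i < j"
  shows "sigma_free (gen (LX i) * gen (LXs j)
      - free_scale (complex_of_real (q^3)) (gen (LXs j) * gen (LX i))) = \<zero>\<^bsub>op_alg (multi n)\<^esub>"
proof (rule sigma_free_diff_zeroI)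
  fix \<psi> m assume \<psi>: "\<psi> \<in> ell2 (multi n)" and m: "m \<in> multi n"
  have c: "gen (LXs j) * gen (LX i) \<in> carrier (free_alg n)" using i j by auto
  show "sigma_free (gen (LX i) * gen (LXs j)) \<psi> m
      = sigma_free (free_scale (complex_of_real (q^3)) (gen (LXs j) * gen (LX i))) \<psi> m"
  proof (cases "m j")
    case 0
    then show ?thesis
      using c i j \<psi> m ij
      by (simp add: sigma_free_apply(3) sigma_word2 sigma_letter_apply a_star_weight_def
          del: letter_value.simps)
  next
    case (Suc x)
    let ?m = "m(j := x)"
    have m': "m = ?m(j := Suc (?m j))" using Suc by (simp add: fun_upd_idem)
    have tw: "(m(i := Suc (m i)))(j := x) = ?m(i := Suc (?m i))"
      using ij by (simp add: fun_upd_twist)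
    have w: "a_weight i m = q\<^sup>2 * a_weight i ?m"
      "a_weight j ((m(i := Suc (m i)))(j := x)) = q * a_weight j ?m"
      using a_weight_Suc_less[OF ij j, of ?m] m' a_weight_Suc_greater[OF ij i, of ?m] tw
      by simp_all
    show ?thesis
      using c i j \<psi> m ij Suc w tw
      by (simp add: sigma_free_apply(3) sigma_word2 sigma_letter_apply a_star_weight_def
          power2_eq_square power3_eq_cube del: letter_value.simps)
  qed
qed (use i j in auto)

lemma sigma_rel_xsx:
  assumes i: "i \<in> {1..n}"
  shows "sigma_free (gen (LX i) * gen (LXs i)
      - (free_scale (complex_of_real (q^2)) (gen (LXs i) * gen (LX i))
        + free_scale (complex_of_real (q^2 * (1 - q^2))) (\<Sum>l\<in>{1..<i}. gen (LXs l) * gen (LX l))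
        + free_scale (complex_of_real (1 - q^2)) (gen LY * gen LY))) = \<zero>\<^bsub>op_alg (multi n)\<^esub>"
proof (rule sigma_free_diff_zeroI)
  have L: "{1..<i} \<subseteq> {1..n}" using i by auto
  have c: "gen (LXs i) * gen (LX i) \<in> carrier (free_alg n)" "gen LY * gen LY \<in> carrier (free_alg n)"
    "(\<Sum>l\<in>{1..<i}. gen (LXs l) * gen (LX l)) \<in> carrier (free_alg n)"
    using i by (auto intro!: free_carrier_sum)
  then show "free_scale (complex_of_real (q^2)) (gen (LXs i) * gen (LX i))
        + free_scale (complex_of_real (q^2 * (1 - q^2))) (\<Sum>l\<in>{1..<i}. gen (LXs l) * gen (LX l))
        + free_scale (complex_of_real (1 - q^2)) (gen LY * gen LY) \<in> carrier (free_alg n)"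
    by (intro free_carrier_add free_carrier_scale)
  fix \<psi> m assume \<psi>: "\<psi> \<in> ell2 (multi n)" and m: "m \<in> multi n"
  let ?s = "\<Sum>l\<in>{1..<i}. a_star_weight l m * a_weight l (m(l := m l - 1))"
  let ?v = "a_star_weight i m * a_weight i (m(i := m i - 1))"
  have "(a_weight i m)\<^sup>2 = q\<^sup>2 * ?v + (1 - q\<^sup>2) * (q\<^sup>2 * ?s) + (1 - q\<^sup>2) * (t_weight m)\<^sup>2"
    using i unfolding a_a_star_weight[OF i] a_star_a_weight[OF i]
    by (subst sum_a_star_a_weight) (auto simp: algebra_simps)
  then have weights: "(a_weight i m)\<^sup>2
      = q^2 * ?v + q^2 * (1 - q^2) * ?s + (1 - q^2) * (t_weight m * t_weight m)"
    by (simp add: mult_ac power2_eq_square)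
  have yy: "sigma_free (gen LY * gen LY) \<psi> m = complex_of_real (t_weight m * t_weight m) * \<psi> m"
    using \<psi> m by (simp add: sigma_word2 sigma_letter_apply del: letter_value.simps)
  show "sigma_free (gen (LX i) * gen (LXs i)) \<psi> m
      = sigma_free (free_scale (complex_of_real (q^2)) (gen (LXs i) * gen (LX i))
        + free_scale (complex_of_real (q^2 * (1 - q^2))) (\<Sum>l\<in>{1..<i}. gen (LXs l) * gen (LX l))
        + free_scale (complex_of_real (1 - q^2)) (gen LY * gen LY)) \<psi> m"
    unfolding sigma_free_apply(4)[OF \<psi> free_carrier_add[OF free_carrier_scale[OF c(1)]
          free_carrier_scale[OF c(3)]] free_carrier_scale[OF c(2)]]
      sigma_free_apply(4)[OF \<psi> free_carrier_scale[OF c(1)] free_carrier_scale[OF c(3)]]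
      sigma_free_apply(3)[OF \<psi> c(1)] sigma_free_apply(3)[OF \<psi> c(2)] sigma_free_apply(3)[OF \<psi> c(3)]
      sigma_a_star_a[OF \<psi> m i] sigma_a_a_star[OF \<psi> m i] sigma_sum_a_star_a[OF \<psi> m L] yy weights
      of_real_add of_real_mult distrib_right mult.assoc ..
qed (use i in auto)

lemma sigma_kills_euclid_rels:
  "r \<in> euclid_rels q n \<Longrightarrow> sigma_free r = \<zero>\<^bsub>op_alg (multi n)\<^esub>"
  unfolding euclid_rels_def Let_def Un_iff mem_Collect_eq
  using sigma_rel_xy sigma_rel_xx sigma_rel_xxs sigma_rel_xsx by blast

lemma sigma_kills_star_euclid_rels:
  assumes r: "r \<in> euclid_rels q n" shows "sigma_free (free_star r) = \<zero>\<^bsub>op_alg (multi n)\<^esub>"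
proof -
  have rc: "r \<in> carrier (free_alg n)" using r euclid_rels_closed by blast
  have "adjoint_pair (multi n) (sigma_free (free_star r)) \<zero>\<^bsub>op_alg (multi n)\<^esub>"
    using free_hom_adjoint_pair[OF sigma_admissible sigma_letter_adjoint rc]
    by (simp add: sigma_kills_euclid_rels[OF r])
  moreover have "adjoint_pair (multi n) \<zero>\<^bsub>op_alg (multi n)\<^esub> \<zero>\<^bsub>op_alg (multi n)\<^esub>"
    by (simp add: adjoint_pair_def ip_def)
  ultimately show ?thesis
    using adjoint_pair_unique sigma_free_closed[OF free_star_closed[OF rc]] op_zero_closed by blast
qed

lemma sigma_kills_sphere_rel: "sigma_free (sphere_rel q n) = \<zero>\<^bsub>op_alg (multi n)\<^esub>"
proof -
  let ?sum = "\<Sum>i\<in>{1..n}. gen (LXs i) * gen (LX i)"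
  have c: "?sum \<in> carrier (free_alg n)" "gen LY * gen LY \<in> carrier (free_alg n)"
    by (auto intro!: free_carrier_sum)
  have "sigma_free (free_scale (complex_of_real (q^2)) ?sum + gen LY * gen LY - gen LY)
      = \<zero>\<^bsub>op_alg (multi n)\<^esub>"
  proof (rule sigma_free_diff_zeroI)
    show "free_scale (complex_of_real (q^2)) ?sum + gen LY * gen LY \<in> carrier (free_alg n)"
      using c by (intro free_carrier_add free_carrier_scale)
    fix \<psi> m assume \<psi>: "\<psi> \<in> ell2 (multi n)" and m: "m \<in> multi n"
    let ?s = "\<Sum>l\<in>{1..n}. a_star_weight l m * a_weight l (m(l := m l - 1))"
    have "q^2 * ?s + t_weight m * t_weight m = t_weight m"
      using sum_a_star_a_weight[of "Suc n" m] partial_t_ends(2)[of m]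
      by (simp add: atLeastLessThanSuc_atLeastAtMost power2_eq_square)
    then have weights: "complex_of_real (t_weight m)
        = complex_of_real (q^2 * ?s + t_weight m * t_weight m)" by simp
    have yy: "sigma_free (gen LY * gen LY) \<psi> m = complex_of_real (t_weight m * t_weight m) * \<psi> m"
      using \<psi> m by (simp add: sigma_word2 sigma_letter_apply del: letter_value.simps)
    have "sigma_free (gen LY) \<psi> m = complex_of_real (t_weight m) * \<psi> m"
      using \<psi> m by (simp add: sigma_free_apply sigma_letter_apply del: letter_value.simps)
    then show "sigma_free (free_scale (complex_of_real (q^2)) ?sum + gen LY * gen LY) \<psi> m
        = sigma_free (gen LY) \<psi> m"
      unfolding sigma_free_apply(4)[OF \<psi> free_carrier_scale[OF c(1)] c(2)]
        sigma_free_apply(3)[OF \<psi> c(1)] sigma_sum_a_star_a[OF \<psi> m subset_refl] yy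
      by (subst (asm) weights) (simp only: of_real_add of_real_mult distrib_right mult.assoc)
  qed auto
  then show ?thesis by (simp add: sphere_rel_def algebra_simps)
qed

lemma sigma_rep_proj_S:
  "f \<in> carrier (free_alg n) \<Longrightarrow> sigma_rep q n (proj_S q n (cls q n f)) = sigma_free f"
  unfolding sigma_rep_def
  by (rule complex_algebra.sphere_hom_proj_S[OF complex_algebra_op_alg sigma_admissible
        sigma_kills_euclid_rels sigma_kills_star_euclid_rels sigma_kills_sphere_rel])

subsection \<open>The trace of \<open>\<sigma>\<^sub>n(t)\<close>\<close>

text \<open>Summation over \<open>\<nat>\<^sup>n\<close> factors into \<open>n\<close> geometric series with ratio \<open>q\<^sup>2\<close>.\<close>

lemma infsum_t_weight:
  "(\<Sum>\<^sub>\<infinity>m\<in>multi n. t_weight m) = 1 / (1 - q\<^sup>2) ^ n"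
proof -
  have q2: "norm (q\<^sup>2) < 1" using q0 q1 by (simp add: abs_square_less_1 power_less_one_iff)
  have "((\<lambda>k. (q\<^sup>2) ^ k) has_sum (1 / (1 - q\<^sup>2))) UNIV"
    by (rule norm_summable_imp_has_sum) (use q2 in \<open>auto simp: norm_power intro!: geometric_sums summable_geometric\<close>)
  then have geom: "(\<Sum>\<^sub>\<infinity>k. (q\<^sup>2) ^ k) = 1 / (1 - q\<^sup>2)" "(\<lambda>k. (q\<^sup>2) ^ k) abs_summable_on UNIV"
    using q0 by (auto simp: infsumI has_sum_imp_summable power_abs)
  have "(\<Sum>\<^sub>\<infinity>m\<in>multi n. t_weight m) = (\<Sum>\<^sub>\<infinity>m\<in>PiE {1..n} (\<lambda>_. UNIV). \<Prod>k\<in>{1..n}. (q\<^sup>2) ^ m k)"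
    by (simp add: multi_def t_weight_def t_exp_def power_sum power_mult)
  also have "\<dots> = (\<Prod>k\<in>{1..n}. \<Sum>\<^sub>\<infinity>x. (q\<^sup>2) ^ x)"
    by (rule infsum_prod_PiE_abs) (use geom in auto)
  finally show ?thesis by (simp add: geom power_one_over)
qed

lemma op_trace_scaled_sigma_t:
  assumes c: "c \<noteq> 0"
  shows "op_trace (multi n) (scale (op_alg (multi n)) c (sigma_t q n)) = c / complex_of_real ((1 - q\<^sup>2) ^ n)"
proof -
  have q2: "1 - q\<^sup>2 \<noteq> 0" using q0 q1 by (simp add: power2_eq_1_iff)
  have t_pos: "0 < t_weight m" for m using q0 by (simp add: t_weight_def)
  \<comment> \<open>A divergent sum would have value \<open>0\<close>, whereas the sum is known to be nonzero.\<close>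
  have s: "t_weight summable_on multi n"
    using infsum_t_weight q2 by (metis infsum_not_exists divide_eq_0_iff one_neq_zero power_not_zero)
  have S: "sigma_t q n \<in> bounded_ops (multi n)"
    unfolding sigma_t_eq by (rule wshift_bounded[OF t_ok])
  let ?w = "\<lambda>m. c * complex_of_real (t_weight m)"
  have "wshift_ok (multi n) ?w (\<lambda>m. m)"
    by (rule diag_ok[where B = "cmod c"])
       (use q_pow_le_one q0 in \<open>simp add: norm_mult t_weight_def norm_power mult_left_le\<close>)
  then have "scale (op_alg (multi n)) c (sigma_t q n) = diag_op (multi n) ?w"
    by (intro op_eqI[OF op_scale_closed[OF S] wshift_bounded]) (auto simp: sigma_t_eq)
  moreover have "op_trace (multi n) (diag_op (multi n) ?w) = (\<Sum>\<^sub>\<infinity>m\<in>multi n. ?w m)"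
  proof (rule op_trace_diag)
    show "?w m \<noteq> 0" for m using c t_pos[of m] by simp
    show "(\<lambda>m. cmod (?w m)) summable_on multi n"
      using summable_on_cmult_right[OF s, of "cmod c"] t_pos by (simp add: norm_mult less_imp_le)
  qed
  moreover have "(\<Sum>\<^sub>\<infinity>m\<in>multi n. ?w m) = c * complex_of_real (1 / (1 - q\<^sup>2) ^ n)"
    unfolding infsum_cmult_right' infsum_t_weight[symmetric]
    by (intro arg_cong[of _ _ "(*) c"] infsumI has_sum_of_real has_sum_infsum s)
  ultimately show ?thesis by simp
qed

text \<open>Subtracting \<open>\<epsilon>\<close> removes the constant term, which is not trace class.\<close>

lemma tr_sigma_affine_y:
  assumes r: "r \<noteq> 0"
  shows "tr_sigma q n (proj_S q n (cls q n (affine_y c r))) = r / complex_of_real ((1 - q\<^sup>2) ^ n)"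
proof -
  interpret B: complex_algebra "op_alg (multi n)" by (rule complex_algebra_op_alg)
  let ?B = "op_alg (multi n)"
  have S: "sigma_t q n \<in> bounded_ops (multi n)"
    unfolding sigma_t_eq by (rule wshift_bounded[OF t_ok])
  have "affine_y c r = free_scale c 1 + free_scale r (gen LY)"
    by (simp add: affine_y_def gen_def free_scale_simps) (simp add: free_scale_def)
  then have "sigma_free (affine_y c r) = scale ?B c \<one>\<^bsub>?B\<^esub> \<oplus>\<^bsub>?B\<^esub> scale ?B r (sigma_t q n)"
    using B.free_hom_add[OF sigma_admissible, of "free_scale c 1" "free_scale r (gen LY)"]
      B.free_hom_scale[OF sigma_admissible, of 1] B.free_hom_scale[OF sigma_admissible, of "gen LY"]
      B.free_hom_one[OF sigma_admissible] B.free_hom_gen[OF sigma_admissible, of LY]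
    by auto
  moreover have "eps_char (proj_S q n (cls q n (affine_y c r))) = c"
    by (simp add: eps_char_proj_S[OF affine_y_closed])
  moreover have "scale ?B c \<one>\<^bsub>?B\<^esub> \<oplus>\<^bsub>?B\<^esub> scale ?B r (sigma_t q n) \<ominus>\<^bsub>?B\<^esub> scale ?B c \<one>\<^bsub>?B\<^esub>
      = scale ?B r (sigma_t q n)"
  proof -
    have u: "scale ?B c \<one>\<^bsub>?B\<^esub> \<in> carrier ?B" and v: "scale ?B r (sigma_t q n) \<in> carrier ?B"
      using S by auto
    show ?thesis
      unfolding a_minus_def B.a_comm[OF u v] B.a_assoc[OF v u B.a_inv_closed[OF u]] B.r_neg[OF u]
      by (rule B.r_zero[OF v])
  qed
  ultimately show ?thesis
    unfolding tr_sigma_def Let_def sigma_rep_proj_S[OF affine_y_closed]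
    by (simp only: op_trace_scaled_sigma_t[OF r])
qed

end

theorem mainTheorem7:
  fixes q :: real and n :: nat
  assumes "0 < q" and "q < 1" and "n \<ge> 1"
  shows "chern_pairing (Pol_S q n) eps_char (G_mat q n) = 2 ^ (n - 1)
    \<and> chern_pairing (Pol_S q n) (tr_sigma q n) (G_mat q n) = -1"
proof -
  define d where "d = complex_of_real ((1 - q\<^sup>2) ^ n)"
  have "1 - q\<^sup>2 \<noteq> 0" using assms(1,2) by (simp add: power2_eq_1_iff)
  then have d: "d \<noteq> 0" unfolding d_def of_real_eq_0_iff by simp
  have coeff: "(1 - complex_of_real (q^2)) ^ n = d" by (simp add: d_def)
  have "chern_pairing (Pol_S q n) eps_char (G_mat q n) = 2 ^ (n - 1)"
    unfolding chern_pairing_def mat_trace_G_mat[OF assms(3)] by (simp add: eps_char_proj_S[OF affine_y_closed])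
  moreover have "chern_pairing (Pol_S q n) (tr_sigma q n) (G_mat q n) = -1"
    unfolding chern_pairing_def mat_trace_G_mat[OF assms(3)] coeff
    using tr_sigma_affine_y[OF assms(1,2), of "- d" n "2 ^ (n - 1)", folded d_def] d by simp
  ultimately show ?thesis by blast
qed

end
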